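(* Let $\mathbb X=(X,d,\mathfrak m)$ be a metric measure space. Then the section functor $\Gamma:\mathbf{MBB}(\mathbb X)\to\mathbf{NMod}_{\rm pr}(\mathbb X)$, from the category of measurable Banach bundles over $\mathbb X$ to the category of proper $L^0(\mathfrak m)$-normed $L^0(\mathfrak m)$-modules, is an equivalence of categories.
   Context: A metric measure space $(X,d,\mathfrak m)$ is a complete separable metric space $(X,d)$ with a non-negative Radon (in particular locally finite, hence $\sigma$-finite) Borel measure $\mathfrak m\neq 0$. $\mathbb N=\{0,1,2,\dots\}$. $L^0(\mathfrak m)$ is the commutative ring of Borel functions $X\to\mathbb R$ modulo $\mathfrak m$-a.e. equality; $\chi_A$ is the indicator function of $A$. Algebraic $L^0(\mathfrak m)$-modules. For an $L^0(\mathfrak m)$-module $M$ and a Borel set $A\subseteq X$, put $M|_A:=\chi_A\cdot M$, a module over $L^0(\mathfrak m|_A)\cong\chi_A L^0(\mathfrak m)$. If $\mathfrak m(A)>0$, elements $v_1,\dots,v_n\in M$ form a local basis on $A$ if $\chi_A\cdot v_1,\dots,\chi_A\cdot v_n$ is a basis of the $L^0(\mathfrak m|_A)$-module $M|_A$; then $M$ has dimension $n$ on $A$. $M$ has dimension $0$ on $A$ if $M|_A=\{0\}$. A dimensional decomposition of $M$ is a Borel partition $(E_n)_{n\in\mathbb N\cup\{\infty\}}$ of $X$ such that $M$ has dimension $n$ on $E_n$ whenever $n\in\mathbb N$ and $\mathfrak m(E_n)>0$, and $M$ admits no finite basis (possibly empty, i.e. $M$ has dimension $n$ for no $n\in\mathbb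 N$) on any Borel $A\subseteq E_\infty$ with $\mathfrak m(A)>0$. $M$ has the locality property if, for all $v\in M$ and Borel sets $(A_n)_{n\in\mathbb N}$, $\chi_{A_n}\cdot v=0$ for all $n$ implies $\chi_{\bigcup_n A_n}\cdot v=0$; it has the glueing property if for all $(v_n)_{n\in\mathbb N}\subseteq M$ and pairwise disjoint Borel sets $(A_n)_{n\in\mathbb N}$ there is $v\in M$ with $\chi_{A_n}\cdot v=\chi_{A_n}\cdot v_n$ for all $n$. A module with locality and glueing admits a dimensional decomposition, unique up to $\mathfrak m$-null sets; it is called proper if $\mathfrak m(E_\infty)=0$. Normed modules. An $L^0(\mathfrak m)$-normed $L^0(\mathfrak m)$-module is an $L^0(\mathfrak m)$-module $\mathscr M$ with a map $|\cdot|:\mathscr M\to L^0(\mathfrak m)$ (pointwise norm) such that $|v|\ge 0$ and $|f\cdot v|=|f||v|$ $\mathfrak m$-a.e. for all $v\in\mathscr M$, $f\in L^0(\mathfrak m)$, and such that, for a Borel probability measure $\mathfrak m'$ with $\mathfrak m\ll\mathfrak m'\ll\mathfrak m$ (the choice is irrelevant), $d_{\mathscr M}(v,w):=\int|v-w|\wedge 1\,d\mathfrak m'$ is a complete distance on $\mathscr M$; $\mathscr M$ carries the induced topology. Such modules have locality and glueing. A module morphism $\Phi:\mathscr M\to\mathscr N$ is an $L^0(\mathfrak m)$-linear map with $|\Phi(v)|\le|v|$ $\mathfrak m$-a.e. for every $v$. $\mathbf{NMod}_{\rm pr}(\mathbb X)$ is the category of proper $L^0(\mathfrak m)$-normed $L^0(\mathfrak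 m)$-modules with module morphisms as arrows. Measurable Banach bundles. An MBB over $\mathbb X$ is a quadruple $\mathbb T=(T,\underline E,\pi,\mathsf n)$ where $\underline E=(E_n)_{n\in\mathbb N}$ is a Borel partition of $X$; $T=\bigsqcup_{n\in\mathbb N}E_n\times\mathbb R^n$, with the $\sigma$-algebra of sets $S$ such that $S\cap(E_n\times\mathbb R^n)$ is Borel for every $n$; $\pi:T\to X$, $\pi(x,v)=x$; and $\mathsf n:T\to[0,+\infty)$ is measurable and such that for every $n$, $\mathsf n(x,\cdot)$ is a norm on $\mathbb R^n$ for $\mathfrak m$-a.e. $x\in E_n$. The fiber over $x\in E_n$ is $\mathbb T_x=\pi^{-1}\{x\}=\{x\}\times\mathbb R^n\cong\mathbb R^n$. A pre-morphism $\mathbb T_1\to\mathbb T_2$ is a measurable map $\overline\varphi:T_1\to T_2$ with $\pi_2\circ\overline\varphi=\pi_1$ such that for $\mathfrak m$-a.e. $x$ the restriction $\overline\varphi:((\mathbb T_1)_x,\mathsf n_1(x,\cdot))\to((\mathbb T_2)_x,\mathsf n_2(x,\cdot))$ is linear and $1$-Lipschitz. Two pre-morphisms are equivalent if they agree on $(\mathbb T_1)_x$ for $\mathfrak m$-a.e. $x$. $\mathbf{MBB}(\mathbb X)$ has MBBs as objects and equivalence classes of pre-morphisms as arrows. Section functor. A section of $\mathbb T$ is a measurable map $\overline s:X\to T$ with $\pi\circ\overline s=\mathrm{id}_X$. $\Gamma(\mathbb T)$ is the set of sections modulo $\mathfrak m$-a.e. equality, with fiberwise addition and multiplication by functions in $L^0(\mathfrak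 m)$, pointwise norm $|s|(x):=\mathsf n(\overline s(x))$, and distance $\int|s_1-s_2|\wedge 1\,d\mathfrak m'$. For a bundle morphism $\varphi:\mathbb T_1\to\mathbb T_2$ represented by $\overline\varphi$, $\Gamma(\varphi)(s)$ is the class of $\overline\varphi\circ\overline s$. *)

theory Defs
  imports "HOL-Probability.Probability_Measure" "HOL-Algebra.Module"
begin

section \<open>Categories\<close>

text \<open>Hom-sets are indexed by source and target and need not be disjoint;
  \<open>Comp C a b c g f\<close> is the composite of \<open>f \<in> Hom C a b\<close> and \<open>g \<in> Hom C b c\<close>.\<close>

record ('o, 'a) precat =
  Obj :: "'o set"
  Hom :: "'o \<Rightarrow> 'o \<Rightarrow> 'a set"
  Ident :: "'o \<Rightarrow> 'a"
  Comp :: "'o \<Rightarrow> 'o \<Rightarrow> 'o \<Rightarrow> 'a \<Rightarrow> 'a \<Rightarrow> 'a"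

definition category :: "('o, 'a) precat \<Rightarrow> bool" where
  "category C \<longleftrightarrow>
    (\<forall>a\<in>Obj C. Ident C a \<in> Hom C a a) \<and>
    (\<forall>a\<in>Obj C. \<forall>b\<in>Obj C. \<forall>c\<in>Obj C. \<forall>f\<in>Hom C a b. \<forall>g\<in>Hom C b c.
       Comp C a b c g f \<in> Hom C a c) \<and>
    (\<forall>a\<in>Obj C. \<forall>b\<in>Obj C. \<forall>f\<in>Hom C a b.
       Comp C a a b f (Ident C a) = f \<and> Comp C a b b (Ident C b) f = f) \<and>
    (\<forall>a\<in>Obj C. \<forall>b\<in>Obj C. \<forall>c\<in>Obj C. \<forall>d\<in>Obj C.
       \<forall>f\<in>Hom C a b. \<forall>g\<in>Hom C b c. \<forall>h\<in>Hom C c d.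
         Comp C a c d h (Comp C a b c g f) = Comp C a b d (Comp C b c d h g) f)"

definition isomorphism :: "('o, 'a) precat \<Rightarrow> 'o \<Rightarrow> 'o \<Rightarrow> 'a \<Rightarrow> bool" where
  "isomorphism C a b f \<longleftrightarrow> f \<in> Hom C a b \<and>
    (\<exists>g\<in>Hom C b a. Comp C a b a g f = Ident C a \<and> Comp C b a b f g = Ident C b)"

record ('o, 'a, 'p, 'b) prefunctor =
  fobj :: "'o \<Rightarrow> 'p"
  farr :: "'o \<Rightarrow> 'o \<Rightarrow> 'a \<Rightarrow> 'b"

definition is_functor ::
  "('o, 'a) precat \<Rightarrow> ('p, 'b) precat \<Rightarrow> ('o, 'a, 'p, 'b) prefunctor \<Rightarrow> bool" where
  "is_functor C D F \<longleftrightarrow> category C \<and> category D \<and>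
    (\<forall>a\<in>Obj C. fobj F a \<in> Obj D) \<and>
    (\<forall>a\<in>Obj C. \<forall>b\<in>Obj C. \<forall>f\<in>Hom C a b. farr F a b f \<in> Hom D (fobj F a) (fobj F b)) \<and>
    (\<forall>a\<in>Obj C. farr F a a (Ident C a) = Ident D (fobj F a)) \<and>
    (\<forall>a\<in>Obj C. \<forall>b\<in>Obj C. \<forall>c\<in>Obj C. \<forall>f\<in>Hom C a b. \<forall>g\<in>Hom C b c.
       farr F a c (Comp C a b c g f) =
         Comp D (fobj F a) (fobj F b) (fobj F c) (farr F b c g) (farr F a b f))"

definition id_functor :: "('o, 'a, 'o, 'a) prefunctor" where
  "id_functor = \<lparr>fobj = (\<lambda>a. a), farr = (\<lambda>a b f. f)\<rparr>"

definition comp_functor ::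
  "('p, 'b, 'q, 'c) prefunctor \<Rightarrow> ('o, 'a, 'p, 'b) prefunctor \<Rightarrow> ('o, 'a, 'q, 'c) prefunctor"
  where
  "comp_functor G F = \<lparr>fobj = (\<lambda>a. fobj G (fobj F a)),
     farr = (\<lambda>a b f. farr G (fobj F a) (fobj F b) (farr F a b f))\<rparr>"

definition natural_iso ::
  "('o, 'a) precat \<Rightarrow> ('p, 'b) precat \<Rightarrow> ('o, 'a, 'p, 'b) prefunctor \<Rightarrow>
   ('o, 'a, 'p, 'b) prefunctor \<Rightarrow> ('o \<Rightarrow> 'b) \<Rightarrow> bool" where
  "natural_iso C D F G \<eta> \<longleftrightarrow>
    (\<forall>a\<in>Obj C. isomorphism D (fobj F a) (fobj G a) (\<eta> a)) \<and>
    (\<forall>a\<in>Obj C. \<forall>b\<in>Obj C. \<forall>f\<in>Hom C a b.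
       Comp D (fobj F a) (fobj F b) (fobj G b) (\<eta> b) (farr F a b f) =
       Comp D (fobj F a) (fobj G a) (fobj G b) (farr G a b f) (\<eta> a))"

definition equivalence_of_categories ::
  "('o, 'a) precat \<Rightarrow> ('p, 'b) precat \<Rightarrow> ('o, 'a, 'p, 'b) prefunctor \<Rightarrow> bool" where
  "equivalence_of_categories C D F \<longleftrightarrow> is_functor C D F \<and>
    (\<exists>G. is_functor D C G \<and>
      (\<exists>\<eta>. natural_iso C C id_functor (comp_functor G F) \<eta>) \<and>
      (\<exists>\<epsilon>. natural_iso D D (comp_functor F G) id_functor \<epsilon>))"


section \<open>Metric measure spaces and the ring of measurable functions\<close>

definition metric_measure_space :: "'x::polish_space measure \<Rightarrow> bool" where
  "metric_measure_space m \<longleftrightarrow>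
    sets m = sets borel \<and>
    (\<forall>x. \<exists>U. open U \<and> x \<in> U \<and> emeasure m U < \<infinity>) \<and>
    (\<forall>B\<in>sets borel. emeasure m B = (SUP K\<in>{K. compact K \<and> K \<subseteq> B}. emeasure m K)) \<and>
    emeasure m UNIV \<noteq> 0"

definition ae_rel :: "'x measure \<Rightarrow> ('x \<Rightarrow> 'y) set \<Rightarrow> (('x \<Rightarrow> 'y) \<times> ('x \<Rightarrow> 'y)) set" where
  "ae_rel m A = {(f, g). f \<in> A \<and> g \<in> A \<and> (AE x in m. f x = g x)}"

text \<open>Operations on equivalence classes are defined through an arbitrarily chosen representative.\<close>

definition rep :: "'f set \<Rightarrow> 'f" where
  "rep C = (SOME f. f \<in> C)"

definition L0_class :: "'x measure \<Rightarrow> ('x \<Rightarrow> real) \<Rightarrow> ('x \<Rightarrow> real) set" where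
  "L0_class m f = ae_rel m (borel_measurable m) `` {f}"

definition L0 :: "'x measure \<Rightarrow> ('x \<Rightarrow> real) set ring" where
  "L0 m = \<lparr>carrier = borel_measurable m // ae_rel m (borel_measurable m),
     mult = (\<lambda>F G. L0_class m (\<lambda>x. rep F x * rep G x)),
     one = L0_class m (\<lambda>_. 1),
     zero = L0_class m (\<lambda>_. 0),
     add = (\<lambda>F G. L0_class m (\<lambda>x. rep F x + rep G x))\<rparr>"

definition L0_abs :: "'x measure \<Rightarrow> ('x \<Rightarrow> real) set \<Rightarrow> ('x \<Rightarrow> real) set" where
  "L0_abs m F = L0_class m (\<lambda>x. \<bar>rep F x\<bar>)"

definition L0_le :: "'x measure \<Rightarrow> ('x \<Rightarrow> real) set \<Rightarrow> ('x \<Rightarrow> real) set \<Rightarrow> bool" where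
  "L0_le m F G \<longleftrightarrow> (AE x in m. rep F x \<le> rep G x)"

definition chi :: "'x measure \<Rightarrow> 'x set \<Rightarrow> ('x \<Rightarrow> real) set" where
  "chi m A = L0_class m (indicator A)"


section \<open>Dimension of modules over \<open>L0\<close>\<close>

text \<open>The library record of modules extends that of rings; its fields \<open>mult\<close> and \<open>one\<close>
  play no role for a module.\<close>

definition L0_restrict :: "'x measure \<Rightarrow> 'x set \<Rightarrow> ('x \<Rightarrow> real) set ring" where
  "L0_restrict m A =
     (L0 m)\<lparr>carrier := (\<lambda>F. chi m A \<otimes>\<^bsub>L0 m\<^esub> F) ` carrier (L0 m), one := chi m A\<rparr>"

definition mod_restrict ::
  "'x measure \<Rightarrow> (('x \<Rightarrow> real) set, 'v, 'z) module_scheme \<Rightarrow> 'x set \<Rightarrow>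
   (('x \<Rightarrow> real) set, 'v, 'z) module_scheme" where
  "mod_restrict m M A = M\<lparr>carrier := (\<lambda>v. chi m A \<odot>\<^bsub>M\<^esub> v) ` carrier M\<rparr>"

definition module_basis ::
  "('r, 'y) ring_scheme \<Rightarrow> ('r, 'v, 'z) module_scheme \<Rightarrow> nat \<Rightarrow> (nat \<Rightarrow> 'v) \<Rightarrow> bool" where
  "module_basis R M n b \<longleftrightarrow>
    b \<in> {..<n} \<rightarrow> carrier M \<and>
    (\<forall>c \<in> {..<n} \<rightarrow> carrier R.
       (\<Oplus>\<^bsub>M\<^esub>i\<in>{..<n}. c i \<odot>\<^bsub>M\<^esub> b i) = \<zero>\<^bsub>M\<^esub> \<longrightarrow> (\<forall>i<n. c i = \<zero>\<^bsub>R\<^esub>)) \<and>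
    (\<forall>w \<in> carrier M. \<exists>c \<in> {..<n} \<rightarrow> carrier R. w = (\<Oplus>\<^bsub>M\<^esub>i\<in>{..<n}. c i \<odot>\<^bsub>M\<^esub> b i))"

definition local_basis ::
  "'x measure \<Rightarrow> (('x \<Rightarrow> real) set, 'v, 'z) module_scheme \<Rightarrow> 'x set \<Rightarrow> nat \<Rightarrow> (nat \<Rightarrow> 'v) \<Rightarrow> bool"
  where
  "local_basis m M A n b \<longleftrightarrow>
    b \<in> {..<n} \<rightarrow> carrier M \<and>
    module_basis (L0_restrict m A) (mod_restrict m M A) n (\<lambda>i. chi m A \<odot>\<^bsub>M\<^esub> b i)"

text \<open>For \<open>n = 0\<close> the basis is empty, and the condition says that the restriction of \<open>M\<close>
  to \<open>A\<close> is zero.\<close>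

definition has_dim ::
  "'x measure \<Rightarrow> (('x \<Rightarrow> real) set, 'v, 'z) module_scheme \<Rightarrow> 'x set \<Rightarrow> nat \<Rightarrow> bool" where
  "has_dim m M A n \<longleftrightarrow> (\<exists>b. local_basis m M A n b)"

definition dimensional_decomposition ::
  "'x::topological_space measure \<Rightarrow> (('x \<Rightarrow> real) set, 'v, 'z) module_scheme \<Rightarrow>
   (enat \<Rightarrow> 'x set) \<Rightarrow> bool" where
  "dimensional_decomposition m M E \<longleftrightarrow>
    (\<forall>k. E k \<in> sets borel) \<and> disjoint_family E \<and> (\<Union>k. E k) = UNIV \<and>
    (\<forall>n::nat. emeasure m (E (enat n)) > 0 \<longrightarrow> has_dim m M (E (enat n)) n) \<and>
    (\<forall>A\<in>sets borel. A \<subseteq> E \<infinity> \<and> emeasure m A > 0 \<longrightarrow> (\<forall>n. \<not> has_dim m M A n))"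

definition proper_module ::
  "'x::topological_space measure \<Rightarrow> (('x \<Rightarrow> real) set, 'v, 'z) module_scheme \<Rightarrow> bool" where
  "proper_module m M \<longleftrightarrow> (\<exists>E. dimensional_decomposition m M E \<and> emeasure m (E \<infinity>) = 0)"


section \<open>Normed modules\<close>

record ('r, 'v) nmodule = "('r, 'v) module" +
  pnorm :: "'v \<Rightarrow> 'r"

type_synonym ('x, 'v) L0_nmodule = "(('x \<Rightarrow> real) set, 'v) nmodule"

text \<open>The value 0 outside the carrier is needed because the library locale \<open>Metric_space\<close>
  demands symmetry and non-negativity of the distance on the whole type.\<close>

definition nmod_dist :: "'x measure \<Rightarrow> ('x, 'v) L0_nmodule \<Rightarrow> 'v \<Rightarrow> 'v \<Rightarrow> real" where
  "nmod_dist m' M v w =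
    (if v \<in> carrier M \<and> w \<in> carrier M
     then (\<integral>x. min (rep (pnorm M (v \<ominus>\<^bsub>M\<^esub> w)) x) 1 \<partial>m') else 0)"

definition normed_L0_module ::
  "'x::topological_space measure \<Rightarrow> ('x, 'v) L0_nmodule \<Rightarrow> bool" where
  "normed_L0_module m M \<longleftrightarrow>
    Module.module (L0 m) M \<and>
    pnorm M \<in> carrier M \<rightarrow> carrier (L0 m) \<and>
    (\<forall>v\<in>carrier M. L0_le m \<zero>\<^bsub>L0 m\<^esub> (pnorm M v)) \<and>
    (\<forall>F\<in>carrier (L0 m). \<forall>v\<in>carrier M.
       pnorm M (F \<odot>\<^bsub>M\<^esub> v) = L0_abs m F \<otimes>\<^bsub>L0 m\<^esub> pnorm M v) \<and>
    (\<exists>m'. prob_space m' \<and> sets m' = sets borel \<and>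
       absolutely_continuous m m' \<and> absolutely_continuous m' m \<and>
       Metric_space (carrier M) (nmod_dist m' M) \<and>
       Metric_space.mcomplete (carrier M) (nmod_dist m' M))"

text \<open>Morphisms are extensional so that equality of arrows is equality of maps on the carrier.\<close>

definition nmod_hom ::
  "'x measure \<Rightarrow> ('x, 'v) L0_nmodule \<Rightarrow> ('x, 'v) L0_nmodule \<Rightarrow> ('v \<Rightarrow> 'v) set" where
  "nmod_hom m M N = {\<Phi> \<in> carrier M \<rightarrow>\<^sub>E carrier N.
    (\<forall>v\<in>carrier M. \<forall>w\<in>carrier M. \<Phi> (v \<oplus>\<^bsub>M\<^esub> w) = \<Phi> v \<oplus>\<^bsub>N\<^esub> \<Phi> w) \<and>
    (\<forall>F\<in>carrier (L0 m). \<forall>v\<in>carrier M. \<Phi> (F \<odot>\<^bsub>M\<^esub> v) = F \<odot>\<^bsub>N\<^esub> \<Phi> v) \<and>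
    (\<forall>v\<in>carrier M. L0_le m (pnorm N (\<Phi> v)) (pnorm M v))}"

definition NMod_pr ::
  "'x::topological_space measure \<Rightarrow> (('x, 'v) L0_nmodule, 'v \<Rightarrow> 'v) precat" where
  "NMod_pr m = \<lparr>Obj = {M. normed_L0_module m M \<and> proper_module m M},
     Hom = nmod_hom m,
     Ident = (\<lambda>M. \<lambda>v\<in>carrier M. v),
     Comp = (\<lambda>M N P \<Psi> \<Phi>. compose (carrier M) \<Psi> \<Phi>)\<rparr>"


section \<open>Measurable Banach bundles\<close>

text \<open>\<open>Rn n\<close> is the set underlying the library space \<open>Euclidean_space n\<close>, whose topology is
  induced by the product topology on \<open>nat \<Rightarrow> real\<close>.  As \<open>E \<times> Rn n\<close> is Borel in
  \<open>'x \<times> (nat \<Rightarrow> real)\<close> for Borel \<open>E\<close>, its Borel subsets are the Borel subsets of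
  \<open>'x \<times> (nat \<Rightarrow> real)\<close> that it contains.\<close>

definition Rn :: "nat \<Rightarrow> (nat \<Rightarrow> real) set" where
  "Rn n = topspace (Euclidean_space n)"

record 'x mbb =
  part :: "nat \<Rightarrow> 'x set"
  bnorm :: "'x \<times> (nat \<Rightarrow> real) \<Rightarrow> real"

definition total_set :: "'x mbb \<Rightarrow> ('x \<times> (nat \<Rightarrow> real)) set" where
  "total_set T = (\<Union>n. part T n \<times> Rn n)"

definition total_space :: "'x::topological_space mbb \<Rightarrow> ('x \<times> (nat \<Rightarrow> real)) measure" where
  "total_space T =
     sigma (total_set T) {S. S \<subseteq> total_set T \<and> (\<forall>n. S \<inter> (part T n \<times> Rn n) \<in> sets borel)}"

definition fiber :: "'x mbb \<Rightarrow> 'x \<Rightarrow> (nat \<Rightarrow> real) set" where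
  "fiber T x = {v. (x, v) \<in> total_set T}"

definition norm_on_Rn :: "nat \<Rightarrow> ((nat \<Rightarrow> real) \<Rightarrow> real) \<Rightarrow> bool" where
  "norm_on_Rn n N \<longleftrightarrow>
    (\<forall>v\<in>Rn n. 0 \<le> N v \<and> (N v = 0 \<longleftrightarrow> v = (\<lambda>i. 0))) \<and>
    (\<forall>c. \<forall>v\<in>Rn n. N (\<lambda>i. c * v i) = \<bar>c\<bar> * N v) \<and>
    (\<forall>v\<in>Rn n. \<forall>w\<in>Rn n. N (\<lambda>i. v i + w i) \<le> N v + N w)"

definition is_mbb :: "'x::topological_space measure \<Rightarrow> 'x mbb \<Rightarrow> bool" where
  "is_mbb m T \<longleftrightarrow>
    (\<forall>n. part T n \<in> sets borel) \<and> disjoint_family (part T) \<and> (\<Union>n. part T n) = UNIV \<and>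
    bnorm T \<in> borel_measurable (total_space T) \<and>
    (\<forall>z\<in>total_set T. 0 \<le> bnorm T z) \<and>
    (\<forall>n. AE x in m. x \<in> part T n \<longrightarrow> norm_on_Rn n (\<lambda>v. bnorm T (x, v)))"

definition linear_on_fiber ::
  "'x mbb \<Rightarrow> ('x \<times> (nat \<Rightarrow> real) \<Rightarrow> 'x \<times> (nat \<Rightarrow> real)) \<Rightarrow> 'x \<Rightarrow> bool" where
  "linear_on_fiber T \<phi> x \<longleftrightarrow>
    (\<forall>v\<in>fiber T x. \<forall>w\<in>fiber T x.
       snd (\<phi> (x, \<lambda>i. v i + w i)) = (\<lambda>i. snd (\<phi> (x, v)) i + snd (\<phi> (x, w)) i)) \<and>
    (\<forall>c. \<forall>v\<in>fiber T x. snd (\<phi> (x, \<lambda>i. c * v i)) = (\<lambda>i. c * snd (\<phi> (x, v)) i))"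

definition lipschitz_on_fiber ::
  "'x mbb \<Rightarrow> 'x mbb \<Rightarrow> ('x \<times> (nat \<Rightarrow> real) \<Rightarrow> 'x \<times> (nat \<Rightarrow> real)) \<Rightarrow> 'x \<Rightarrow> bool" where
  "lipschitz_on_fiber T1 T2 \<phi> x \<longleftrightarrow>
    (\<forall>v\<in>fiber T1 x. \<forall>w\<in>fiber T1 x.
       bnorm T2 (x, \<lambda>i. snd (\<phi> (x, v)) i - snd (\<phi> (x, w)) i) \<le> bnorm T1 (x, \<lambda>i. v i - w i))"

definition premorphisms ::
  "'x::topological_space measure \<Rightarrow> 'x mbb \<Rightarrow> 'x mbb \<Rightarrow>
   ('x \<times> (nat \<Rightarrow> real) \<Rightarrow> 'x \<times> (nat \<Rightarrow> real)) set" where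
  "premorphisms m T1 T2 = {\<phi> \<in> total_space T1 \<rightarrow>\<^sub>M total_space T2.
    (\<forall>z\<in>total_set T1. fst (\<phi> z) = fst z) \<and>
    (AE x in m. linear_on_fiber T1 \<phi> x \<and> lipschitz_on_fiber T1 T2 \<phi> x)}"

text \<open>Premorphisms are total functions whose values outside \<open>total_set T1\<close> are arbitrary;
  the relation below ignores these values.\<close>

definition premorphism_rel ::
  "'x::topological_space measure \<Rightarrow> 'x mbb \<Rightarrow> 'x mbb \<Rightarrow>
   (('x \<times> (nat \<Rightarrow> real) \<Rightarrow> 'x \<times> (nat \<Rightarrow> real)) \<times>
    ('x \<times> (nat \<Rightarrow> real) \<Rightarrow> 'x \<times> (nat \<Rightarrow> real))) set" where
  "premorphism_rel m T1 T2 = {(\<phi>, \<psi>). \<phi> \<in> premorphisms m T1 T2 \<and> \<psi> \<in> premorphisms m T1 T2 \<and>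
     (AE x in m. \<forall>v\<in>fiber T1 x. \<phi> (x, v) = \<psi> (x, v))}"

type_synonym 'x mbb_arrow = "('x \<times> (nat \<Rightarrow> real) \<Rightarrow> 'x \<times> (nat \<Rightarrow> real)) set"

definition MBB :: "'x::topological_space measure \<Rightarrow> ('x mbb, 'x mbb_arrow) precat" where
  "MBB m = \<lparr>Obj = {T. is_mbb m T},
     Hom = (\<lambda>T1 T2. premorphisms m T1 T2 // premorphism_rel m T1 T2),
     Ident = (\<lambda>T. premorphism_rel m T T `` {\<lambda>z. z}),
     Comp = (\<lambda>T1 T2 T3 \<psi> \<phi>. premorphism_rel m T1 T3 `` {rep \<psi> \<circ> rep \<phi>})\<rparr>"


section \<open>The section functor\<close>

definition bundle_sections ::
  "'x::topological_space mbb \<Rightarrow> ('x \<Rightarrow> 'x \<times> (nat \<Rightarrow> real)) set" where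
  "bundle_sections T = {s \<in> borel \<rightarrow>\<^sub>M total_space T. \<forall>x. fst (s x) = x}"

definition section_class ::
  "'x::topological_space measure \<Rightarrow> 'x mbb \<Rightarrow> ('x \<Rightarrow> 'x \<times> (nat \<Rightarrow> real)) \<Rightarrow>
   ('x \<Rightarrow> 'x \<times> (nat \<Rightarrow> real)) set" where
  "section_class m T s = ae_rel m (bundle_sections T) `` {s}"

text \<open>All modules of one category have their elements in a common type.  Section modules live in
  the left summand of the type below; the right summand is an arbitrary type, so that modules with
  elements of any type whatsoever are covered, too.\<close>

type_synonym ('x, 'u) melem = "('x \<Rightarrow> 'x \<times> (nat \<Rightarrow> real)) set + 'u"

definition srep :: "('x, 'u) melem \<Rightarrow> 'x \<Rightarrow> (nat \<Rightarrow> real)" where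
  "srep S x = snd (rep (projl S) x)"

definition section_module ::
  "'x::topological_space measure \<Rightarrow> 'x mbb \<Rightarrow> ('x, ('x, 'u) melem) L0_nmodule" where
  "section_module m T =
    \<lparr>carrier = Inl ` (bundle_sections T // ae_rel m (bundle_sections T)),
     mult = undefined,
     one = undefined,
     zero = Inl (section_class m T (\<lambda>x. (x, \<lambda>i. 0))),
     add = (\<lambda>S S'. Inl (section_class m T (\<lambda>x. (x, \<lambda>i. srep S x i + srep S' x i)))),
     smult = (\<lambda>F S. Inl (section_class m T (\<lambda>x. (x, \<lambda>i. rep F x * srep S x i)))),
     pnorm = (\<lambda>S. L0_class m (\<lambda>x. bnorm T (x, srep S x)))\<rparr>"

definition section_functor ::
  "'x::topological_space measure \<Rightarrow>
   ('x mbb, 'x mbb_arrow, ('x, ('x, 'u) melem) L0_nmodule, ('x, 'u) melem \<Rightarrow> ('x, 'u) melem)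
   prefunctor" where
  "section_functor m =
    \<lparr>fobj = section_module m,
     farr = (\<lambda>T1 T2 \<phi>. \<lambda>S\<in>carrier (section_module m T1).
       Inl (section_class m T2 (rep \<phi> \<circ> rep (projl S))))\<rparr>"

end

theory Submission
  imports Defs
begin

text \<open>A functor that is full, faithful and essentially surjective is an equivalence.

  Over the part of the base with fibre \<open>R^n\<close>, a section is the combination of the \<open>n\<close> coordinate
  sections whose coefficients are its own coordinates.  Hence a module morphism is determined by the
  images of the coordinate sections, which assemble to a bundle morphism; that it is a contraction is
  seen on rational vectors, for which one null set suffices, and extends by continuity.

  Conversely, let \<open>b_1, ..., b_n\<close> be a basis of a module on a set \<open>A\<close>.  Outside one null set the numbers
  \<open>|q_1 b_1 + ... + q_n b_n|(x)\<close>, with \<open>q\<close> rational, form a Lipschitz seminorm in \<open>q\<close>, which McShane's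
  formula extends to a jointly measurable function \<open>n(x, v)\<close> of \<open>x\<close> and a real vector \<open>v\<close>.  For measurable
  coefficients \<open>f\<close> the pointwise norm of \<open>f_1 b_1 + ... + f_n b_n\<close> at \<open>x\<close> is \<open>n(x, f(x))\<close>, since both differ
  from the value at a rational \<open>q\<close> by a multiple of the distance of \<open>f(x)\<close> and \<open>q\<close>.  Linear independence
  makes \<open>n(x, _)\<close> a norm for almost every \<open>x\<close> in \<open>A\<close>.  So the parts of a dimensional decomposition carry
  the fibres of a bundle, and glueing, a consequence of completeness, identifies its sections
  isometrically with the module.\<close>

section \<open>Full, faithful and essentially surjective functors\<close>

text \<open>A module element has values only almost everywhere, so a statement about all vectors of
  a fibre must be reduced to countably many before null sets are discarded. This is hardest for the
  definiteness of \<open>n(x, _)\<close>. A kernel vector at each bad \<open>x\<close> contradicts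
  nothing by itself; only a measurable choice of such vectors gives coefficients to which linear
  independence applies. Hence they are found one dimension at a time: where \<open>n(x, _)\<close>
  dominates the sum norm on the span of the unit vectors of index below \<open>k\<close>, at most
  one combination of these cancels the unit vector of index \<open>k\<close>, and it is the limit of
  nearly cancelling rational ones, each picked as the first suitable one in a fixed enumeration. The
  same domination makes fast Cauchy sequences of sections converge fibrewise, which gives
  completeness of section modules. Two further mismatches: the axioms of a normed module state the
  triangle inequality only for the integrated, truncated distance, and a decomposition says nothing
  about null parts, whereas a bundle needs a fibre everywhere; over a null set every finite
  dimension is correct.\<close>

lemma category_ident: "category C \<Longrightarrow> a \<in> Obj C \<Longrightarrow> Ident C a \<in> Hom C a a"
  by (simp add: category_def)

lemma category_comp:
  "category C \<Longrightarrow> a \<in> Obj C \<Longrightarrow> b \<in> Obj C \<Longrightarrow> c \<in> Obj C \<Longrightarrow> f \<in> Hom C a b \<Longrightarrow> g \<in> Hom C b c \<Longrightarrow>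
    Comp C a b c g f \<in> Hom C a c"
  by (simp add: category_def)

lemma category_unit:
  assumes "category C" "a \<in> Obj C" "b \<in> Obj C" "f \<in> Hom C a b"
  shows "Comp C a a b f (Ident C a) = f" "Comp C a b b (Ident C b) f = f"
  using assms by (simp_all add: category_def)

lemma category_assoc:
  "category C \<Longrightarrow> a \<in> Obj C \<Longrightarrow> b \<in> Obj C \<Longrightarrow> c \<in> Obj C \<Longrightarrow> d \<in> Obj C \<Longrightarrow>
    f \<in> Hom C a b \<Longrightarrow> g \<in> Hom C b c \<Longrightarrow> h \<in> Hom C c d \<Longrightarrow>
    Comp C a c d h (Comp C a b c g f) = Comp C a b d (Comp C b c d h g) f"
  unfolding category_def by simp

lemma functor_obj: "is_functor C D F \<Longrightarrow> a \<in> Obj C \<Longrightarrow> fobj F a \<in> Obj D"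
  by (simp add: is_functor_def)

lemma functor_arr:
  "is_functor C D F \<Longrightarrow> a \<in> Obj C \<Longrightarrow> b \<in> Obj C \<Longrightarrow> f \<in> Hom C a b \<Longrightarrow>
    farr F a b f \<in> Hom D (fobj F a) (fobj F b)"
  by (simp add: is_functor_def)

lemma functor_ident:
  "is_functor C D F \<Longrightarrow> a \<in> Obj C \<Longrightarrow> farr F a a (Ident C a) = Ident D (fobj F a)"
  by (simp add: is_functor_def)

lemma functor_comp:
  "is_functor C D F \<Longrightarrow> a \<in> Obj C \<Longrightarrow> b \<in> Obj C \<Longrightarrow> c \<in> Obj C \<Longrightarrow> f \<in> Hom C a b \<Longrightarrow>
    g \<in> Hom C b c \<Longrightarrow> farr F a c (Comp C a b c g f) =
      Comp D (fobj F a) (fobj F b) (fobj F c) (farr F b c g) (farr F a b f)"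
  by (simp add: is_functor_def)

lemma natural_isoI:
  assumes "\<And>a. a \<in> Obj C \<Longrightarrow> isomorphism D (fobj F a) (fobj G a) (\<eta> a)"
    and "\<And>a b f. a \<in> Obj C \<Longrightarrow> b \<in> Obj C \<Longrightarrow> f \<in> Hom C a b \<Longrightarrow>
       Comp D (fobj F a) (fobj F b) (fobj G b) (\<eta> b) (farr F a b f) =
       Comp D (fobj F a) (fobj G a) (fobj G b) (farr G a b f) (\<eta> a)"
  shows "natural_iso C D F G \<eta>"
  using assms unfolding natural_iso_def by blast

text \<open>Essential surjectivity chooses the objects of the inverse functor and fullness its
  arrows. Neither choice is canonical, but faithfulness allows every equation in \<open>C\<close> to
  be checked in \<open>D\<close> after applying \<open>F\<close>, where the chosen isomorphisms
  \<open>e\<close> are available.\<close>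

lemma equivalence_of_categoriesI:
  assumes F: "is_functor C D F"
    and full: "\<And>a b g. a \<in> Obj C \<Longrightarrow> b \<in> Obj C \<Longrightarrow> g \<in> Hom D (fobj F a) (fobj F b) \<Longrightarrow>
      \<exists>f\<in>Hom C a b. farr F a b f = g"
    and faithful: "\<And>a b f f'. a \<in> Obj C \<Longrightarrow> b \<in> Obj C \<Longrightarrow> f \<in> Hom C a b \<Longrightarrow> f' \<in> Hom C a b \<Longrightarrow>
      farr F a b f = farr F a b f' \<Longrightarrow> f = f'"
    and ess_surj: "\<And>d. d \<in> Obj D \<Longrightarrow> \<exists>a\<in>Obj C. \<exists>e. isomorphism D (fobj F a) d e"
  shows "equivalence_of_categories C D F"
proof -
  have C: "category C" and D: "category D"
    using F by (simp_all add: is_functor_def)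
  note idC = category_ident[OF C] and compC = category_comp[OF C]
    and idD = category_ident[OF D] and compD = category_comp[OF D]
    and unitD = category_unit[OF D] and assocD = category_assoc[OF D]
  note Fo = functor_obj[OF F] and Fa = functor_arr[OF F] and Fid = functor_ident[OF F]
    and Fcomp = functor_comp[OF F]
  obtain G e where G: "\<And>d. d \<in> Obj D \<Longrightarrow> G d \<in> Obj C"
    and e: "\<And>d. d \<in> Obj D \<Longrightarrow> isomorphism D (fobj F (G d)) d (e d)"
    using ess_surj by metis
  have "\<forall>d. \<exists>e'. d \<in> Obj D \<longrightarrow> e' \<in> Hom D d (fobj F (G d)) \<and>
      Comp D (fobj F (G d)) d (fobj F (G d)) e' (e d) = Ident D (fobj F (G d)) \<and>
      Comp D d (fobj F (G d)) d (e d) e' = Ident D d"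
    using e unfolding isomorphism_def by blast
  then obtain e' where e': "\<And>d. d \<in> Obj D \<Longrightarrow> e' d \<in> Hom D d (fobj F (G d))"
    and e'e: "\<And>d. d \<in> Obj D \<Longrightarrow>
      Comp D (fobj F (G d)) d (fobj F (G d)) (e' d) (e d) = Ident D (fobj F (G d))"
    and ee': "\<And>d. d \<in> Obj D \<Longrightarrow> Comp D d (fobj F (G d)) d (e d) (e' d) = Ident D d"
    by metis
  have eh: "e d \<in> Hom D (fobj F (G d)) d" if "d \<in> Obj D" for d
    using e[OF that] unfolding isomorphism_def by blast
  define lift where "lift a b g = (SOME f. f \<in> Hom C a b \<and> farr F a b f = g)" for a b g
  have lift: "lift a b g \<in> Hom C a b" "farr F a b (lift a b g) = g"
    if "a \<in> Obj C" "b \<in> Obj C" "g \<in> Hom D (fobj F a) (fobj F b)" for a b g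
  proof -
    have "\<exists>f. f \<in> Hom C a b \<and> farr F a b f = g" using full[OF that] by blast
    from someI_ex[OF this] show "lift a b g \<in> Hom C a b" "farr F a b (lift a b g) = g"
      unfolding lift_def by auto
  qed
  \<comment> \<open>The transport of \<open>u\<close> along the isomorphisms \<open>e\<close>,
    forced by the requirement \<open>e_conj\<close> that \<open>e\<close> be natural.\<close>
  define conj where "conj d d' u = Comp D (fobj F (G d)) d (fobj F (G d'))
      (Comp D d d' (fobj F (G d')) (e' d') u) (e d)" for d d' u
  have conj: "conj d d' u \<in> Hom D (fobj F (G d)) (fobj F (G d'))"
    if "d \<in> Obj D" "d' \<in> Obj D" "u \<in> Hom D d d'" for d d' u
    using that unfolding conj_def by (intro compD Fo G e' eh) auto
  have e_conj: "Comp D (fobj F (G d)) (fobj F (G d')) d' (e d') (conj d d' u) =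
      Comp D (fobj F (G d)) d d' u (e d)"
    if d: "d \<in> Obj D" "d' \<in> Obj D" "u \<in> Hom D d d'" for d d' u
  proof -
    have "Comp D (fobj F (G d)) (fobj F (G d')) d' (e d') (conj d d' u) =
      Comp D (fobj F (G d)) d d'
        (Comp D d (fobj F (G d')) d' (e d') (Comp D d d' (fobj F (G d')) (e' d') u)) (e d)"
      unfolding conj_def using d by (intro assocD compD Fo G e' eh) auto
    also have "Comp D d (fobj F (G d')) d' (e d') (Comp D d d' (fobj F (G d')) (e' d') u) =
      Comp D d d' d' (Comp D d' (fobj F (G d')) d' (e d') (e' d')) u"
      using d by (intro assocD compD Fo G e' eh) auto
    also have "\<dots> = u" using d by (simp add: ee' unitD)
    finally show ?thesis .
  qed
  \<comment> \<open>Each \<open>e d\<close> has the left inverse \<open>e' d\<close> and is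
    therefore monic; equations between transported arrows are proved by composing with
    \<open>e\<close> and cancelling it.\<close>
  have e_cancel: "x = y"
    if d: "d \<in> Obj D" "a \<in> Obj D" and x: "x \<in> Hom D a (fobj F (G d))"
      and y: "y \<in> Hom D a (fobj F (G d))"
      and eq: "Comp D a (fobj F (G d)) d (e d) x = Comp D a (fobj F (G d)) d (e d) y" for d a x y
  proof -
    have "z = Comp D a d (fobj F (G d)) (e' d) (Comp D a (fobj F (G d)) d (e d) z)"
      if "z \<in> Hom D a (fobj F (G d))" for z
      using that d by (simp add: assocD Fo G e' eh e'e unitD)
    from this[OF x] this[OF y] eq show ?thesis by simp
  qed
  have e_comp2: "Comp D (fobj F (G d)) (fobj F (G d'')) d'' (e d'')
        (Comp D (fobj F (G d)) (fobj F (G d')) (fobj F (G d'')) (conj d' d'' v) (conj d d' u)) =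
      Comp D (fobj F (G d)) d d'' (Comp D d d' d'' v u) (e d)"
    if d: "d \<in> Obj D" "d' \<in> Obj D" "d'' \<in> Obj D" "u \<in> Hom D d d'" "v \<in> Hom D d' d''"
    for d d' d'' u v
  proof -
    have "Comp D (fobj F (G d)) (fobj F (G d'')) d'' (e d'')
        (Comp D (fobj F (G d)) (fobj F (G d')) (fobj F (G d'')) (conj d' d'' v) (conj d d' u)) =
      Comp D (fobj F (G d)) (fobj F (G d')) d''
        (Comp D (fobj F (G d')) (fobj F (G d'')) d'' (e d'') (conj d' d'' v)) (conj d d' u)"
      using d by (intro assocD compD Fo G e' eh conj) auto
    also have "\<dots> = Comp D (fobj F (G d)) (fobj F (G d')) d''
        (Comp D (fobj F (G d')) d' d'' v (e d')) (conj d d' u)"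
      using d by (simp add: e_conj)
    also have "\<dots> = Comp D (fobj F (G d)) d' d'' v
        (Comp D (fobj F (G d)) (fobj F (G d')) d' (e d') (conj d d' u))"
      using d by (intro assocD[symmetric] compD Fo G e' eh conj) auto
    also have "\<dots> = Comp D (fobj F (G d)) d' d'' v (Comp D (fobj F (G d)) d d' u (e d))"
      using d by (simp add: e_conj)
    also have "\<dots> = Comp D (fobj F (G d)) d d'' (Comp D d d' d'' v u) (e d)"
      using d by (intro assocD compD Fo G e' eh conj) auto
    finally show ?thesis .
  qed
  define GF where "GF = \<lparr>fobj = G, farr = (\<lambda>d d' u. lift (G d) (G d') (conj d d' u))\<rparr>"
  have GF_arr: "farr GF d d' u = lift (G d) (G d') (conj d d' u)" and GF_obj: "fobj GF d = G d"
    for d d' u by (simp_all add: GF_def)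
  have FGF: "farr F (G d) (G d') (farr GF d d' u) = conj d d' u"
    and GF_hom: "farr GF d d' u \<in> Hom C (G d) (G d')"
    if "d \<in> Obj D" "d' \<in> Obj D" "u \<in> Hom D d d'" for d d' u
    using that by (simp_all add: GF_arr lift G conj)
  have GF_functor: "is_functor D C GF"
    unfolding is_functor_def
  proof (intro conjI ballI)
    show "category C" "category D" using F unfolding is_functor_def by auto
    fix d assume d: "d \<in> Obj D"
    show "fobj GF d \<in> Obj C" using d by (simp add: GF_obj G)
    have "conj d d (Ident D d) = Ident D (fobj F (G d))"
      unfolding conj_def using d by (simp add: unitD e' e'e Fo G)
    then show "farr GF d d (Ident D d) = Ident C (fobj GF d)" 
      using d by (intro faithful[of "G d" "G d"])
        (auto simp: GF_obj G idC idD GF_hom FGF Fid)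
  next
    fix d d' u assume "d \<in> Obj D" "d' \<in> Obj D" "u \<in> Hom D d d'"
    then show "farr GF d d' u \<in> Hom C (fobj GF d) (fobj GF d')"
      by (simp add: GF_hom GF_obj)
  next
    fix d d' d'' u v
    assume d: "d \<in> Obj D" "d' \<in> Obj D" "d'' \<in> Obj D" "u \<in> Hom D d d'" "v \<in> Hom D d' d''"
    let ?w = "Comp D d d' d'' v u"
    have w: "?w \<in> Hom D d d''" using d by (intro compD) auto
    have c: "Comp D (fobj F (G d)) (fobj F (G d')) (fobj F (G d'')) (conj d' d'' v) (conj d d' u)
        \<in> Hom D (fobj F (G d)) (fobj F (G d''))"
      using d by (intro compD Fo G conj) auto
    have eq: "conj d d'' ?w =
        Comp D (fobj F (G d)) (fobj F (G d')) (fobj F (G d'')) (conj d' d'' v) (conj d d' u)"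
      by (rule e_cancel[OF d(3) Fo[OF G[OF d(1)]] conj[OF d(1,3) w] c])
        (simp only: e_conj[OF d(1,3) w] e_comp2[OF d])
    have "farr GF d d'' ?w = Comp C (G d) (G d') (G d'') (farr GF d' d'' v) (farr GF d d' u)"
    proof (rule faithful[OF G[OF d(1)] G[OF d(3)] GF_hom[OF d(1,3) w]])
      show "Comp C (G d) (G d') (G d'') (farr GF d' d'' v) (farr GF d d' u) \<in> Hom C (G d) (G d'')"
        using d by (intro compC G GF_hom) auto
      show "farr F (G d) (G d'') (farr GF d d'' ?w) =
          farr F (G d) (G d'') (Comp C (G d) (G d') (G d'') (farr GF d' d'' v) (farr GF d d' u))"
        using FGF[OF d(1,3) w] d by (simp add: eq Fcomp G GF_hom FGF)
    qed
    then show "farr GF d d'' ?w =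
        Comp C (fobj GF d) (fobj GF d') (fobj GF d'') (farr GF d' d'' v) (farr GF d d' u)"
      by (simp add: GF_obj)
  qed
  have eps: "natural_iso D D (comp_functor F GF) id_functor e"
  proof (rule natural_isoI)
    fix d assume "d \<in> Obj D"
    then show "isomorphism D (fobj (comp_functor F GF) d) (fobj id_functor d) (e d)"
      by (simp add: comp_functor_def id_functor_def GF_obj e)
  next
    fix d d' u assume "d \<in> Obj D" "d' \<in> Obj D" "u \<in> Hom D d d'"
    then show "Comp D (fobj (comp_functor F GF) d) (fobj (comp_functor F GF) d')
          (fobj id_functor d') (e d') (farr (comp_functor F GF) d d' u) =
        Comp D (fobj (comp_functor F GF) d) (fobj id_functor d) (fobj id_functor d')
          (farr id_functor d d' u) (e d)"
      by (simp add: comp_functor_def id_functor_def GF_obj FGF e_conj)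
  qed
  \<comment> \<open>The unit at \<open>a\<close> is a preimage of the inverse of the counit at
    \<open>F a\<close>; a preimage of the counit itself is its inverse.\<close>
  define \<eta> where "\<eta> a = lift a (G (fobj F a)) (e' (fobj F a))" for a
  have \<eta>: "\<eta> a \<in> Hom C a (G (fobj F a))" "farr F a (G (fobj F a)) (\<eta> a) = e' (fobj F a)"
    if "a \<in> Obj C" for a
    using that by (simp_all add: \<eta>_def lift Fo G e')
  have eta: "natural_iso C C id_functor (comp_functor GF F) \<eta>"
  proof (rule natural_isoI)
    fix a assume a: "a \<in> Obj C"
    define g where "g = lift (G (fobj F a)) a (e (fobj F a))"
    have g: "g \<in> Hom C (G (fobj F a)) a" "farr F (G (fobj F a)) a g = e (fobj F a)"
      using a by (simp_all add: g_def lift Fo G eh)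
    have "Comp C a (G (fobj F a)) a g (\<eta> a) = Ident C a"
      using a by (intro faithful[of a a]) (simp_all add: compC Fo G \<eta> g idC Fcomp Fid ee')
    moreover have "Comp C (G (fobj F a)) a (G (fobj F a)) (\<eta> a) g = Ident C (G (fobj F a))"
      using a by (intro faithful[of "G (fobj F a)" "G (fobj F a)"])
        (simp_all add: compC Fo G \<eta> g idC Fcomp Fid e'e)
    ultimately show "isomorphism C (fobj id_functor a) (fobj (comp_functor GF F) a) (\<eta> a)"
      using a g \<eta> unfolding isomorphism_def
      by (auto simp: comp_functor_def id_functor_def GF_obj)
  next
    fix a b f assume a: "a \<in> Obj C" "b \<in> Obj C" "f \<in> Hom C a b"
    let ?a = "fobj F a" and ?b = "fobj F b" and ?f = "farr F a b f"
    \<comment> \<open>Naturality of the unit, after applying \<open>F\<close> and composing with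
      \<open>e ?b\<close>: both sides reduce to \<open>?f\<close>.\<close>
    have "Comp D ?a (fobj F (G ?b)) ?b (e ?b) (Comp D ?a ?b (fobj F (G ?b)) (e' ?b) ?f) = ?f"
      using a by (simp add: assocD[of ?a ?b "fobj F (G ?b)" ?b ?f] Fo Fa G e' eh ee' unitD)
    moreover have "Comp D ?a (fobj F (G ?b)) ?b (e ?b)
        (Comp D ?a (fobj F (G ?a)) (fobj F (G ?b)) (conj ?a ?b ?f) (e' ?a)) = ?f"
    proof -
      have "Comp D ?a (fobj F (G ?b)) ?b (e ?b)
          (Comp D ?a (fobj F (G ?a)) (fobj F (G ?b)) (conj ?a ?b ?f) (e' ?a)) =
        Comp D ?a (fobj F (G ?a)) ?b
          (Comp D (fobj F (G ?a)) (fobj F (G ?b)) ?b (e ?b) (conj ?a ?b ?f)) (e' ?a)"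
        using a by (intro assocD compD Fo Fa G e' eh conj) auto
      also have "\<dots> = Comp D ?a (fobj F (G ?a)) ?b (Comp D (fobj F (G ?a)) ?a ?b ?f (e ?a)) (e' ?a)"
        using a by (simp add: e_conj Fo Fa)
      also have "\<dots> = Comp D ?a ?a ?b ?f (Comp D ?a (fobj F (G ?a)) ?a (e ?a) (e' ?a))"
        using a by (intro assocD[symmetric] compD Fo Fa G e' eh conj) auto
      also have "\<dots> = ?f" using a by (simp add: ee' unitD Fo Fa)
      finally show ?thesis .
    qed
    ultimately have "Comp D ?a ?b (fobj F (G ?b)) (e' ?b) ?f =
        Comp D ?a (fobj F (G ?a)) (fobj F (G ?b)) (conj ?a ?b ?f) (e' ?a)"
      using a by - (rule e_cancel[of ?b ?a], simp_all add: compD Fo Fa G e' conj)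
    then have "Comp C a b (G ?b) (\<eta> b) f = Comp C a (G ?a) (G ?b) (farr GF ?a ?b ?f) (\<eta> a)"
      using a by (intro faithful[of a "G ?b"])
        (simp_all add: compC Fo Fa G \<eta> GF_hom FGF Fcomp)
    then show "Comp C (fobj id_functor a) (fobj id_functor b) (fobj (comp_functor GF F) b) (\<eta> b)
          (farr id_functor a b f) =
        Comp C (fobj id_functor a) (fobj (comp_functor GF F) a) (fobj (comp_functor GF F) b)
          (farr (comp_functor GF F) a b f) (\<eta> a)"
      by (simp add: comp_functor_def id_functor_def GF_obj)
  qed
  show ?thesis
    unfolding equivalence_of_categories_def using F GF_functor eta eps by blast
qed

section \<open>Seminorms on coordinate space\<close>

definition l1norm :: "nat \<Rightarrow> (nat \<Rightarrow> real) \<Rightarrow> real" where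
  "l1norm n v = (\<Sum>i<n. \<bar>v i\<bar>)"

definition unit_vec :: "nat \<Rightarrow> nat \<Rightarrow> real" where
  "unit_vec k = (\<lambda>i. if i = k then 1 else 0)"

definition Qn :: "nat \<Rightarrow> (nat \<Rightarrow> real) set" where
  "Qn n = {v \<in> Rn n. \<forall>i. v i \<in> \<rat>}"

definition seminorm_on_Rn :: "nat \<Rightarrow> ((nat \<Rightarrow> real) \<Rightarrow> real) \<Rightarrow> bool" where
  "seminorm_on_Rn n N \<longleftrightarrow>
    (\<forall>v\<in>Rn n. 0 \<le> N v) \<and>
    (\<forall>c. \<forall>v\<in>Rn n. N (\<lambda>i. c * v i) = \<bar>c\<bar> * N v) \<and>
    (\<forall>v\<in>Rn n. \<forall>w\<in>Rn n. N (\<lambda>i. v i + w i) \<le> N v + N w)"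

lemma Rn_iff: "v \<in> Rn n \<longleftrightarrow> (\<forall>i\<ge>n. v i = 0)"
  by (simp add: Rn_def topspace_Euclidean_space)

lemma Rn_mono: "k \<le> n \<Longrightarrow> Rn k \<subseteq> Rn n"
  by (auto simp: Rn_iff)

lemma Rn_zero: "(\<lambda>i. 0) \<in> Rn n"
  and Rn_add: "v \<in> Rn n \<Longrightarrow> w \<in> Rn n \<Longrightarrow> (\<lambda>i. v i + w i) \<in> Rn n"
  and Rn_diff: "v \<in> Rn n \<Longrightarrow> w \<in> Rn n \<Longrightarrow> (\<lambda>i. v i - w i) \<in> Rn n"
  and Rn_scale: "v \<in> Rn n \<Longrightarrow> (\<lambda>i. c * v i) \<in> Rn n"
  and Rn_unit_vec: "k < n \<Longrightarrow> unit_vec k \<in> Rn n"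
  by (auto simp: Rn_iff unit_vec_def)

lemma Rn_sum: "(\<And>i. i \<in> A \<Longrightarrow> f i \<in> Rn n) \<Longrightarrow> (\<lambda>j. \<Sum>i\<in>A. c i * f i j) \<in> Rn n"
  by (auto simp: Rn_iff intro!: sum.neutral)

lemma Rn_expand: "v \<in> Rn n \<Longrightarrow> (\<lambda>j. \<Sum>i<n. v i * unit_vec i j) = v"
  by (rule ext) (auto simp: Rn_iff unit_vec_def if_distrib cong: if_cong)

lemma Qn_subset: "Qn n \<subseteq> Rn n"
  by (auto simp: Qn_def)

text \<open>A vector in \<open>Qn n\<close> is coded by the list of its first \<open>n\<close>
  coordinates, and there are only countably many lists of rationals.\<close>

lemma countable_Qn: "countable (Qn n)"
proof -
  have "Qn n \<subseteq> range (\<lambda>l i. if i < length l then of_rat (l ! i) else 0)"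
  proof
    fix v assume v: "v \<in> Qn n"
    then have "\<forall>i. \<exists>r. v i = of_rat r" by (auto simp: Qn_def Rats_def)
    then obtain r where r: "\<And>i. v i = of_rat (r i)" by metis
    have "v = (\<lambda>i. if i < length (map r [0..<n]) then of_rat (map r [0..<n] ! i) else 0)"
      using v r by (auto simp: Qn_def Rn_iff fun_eq_iff)
    then show "v \<in> range (\<lambda>l i. if i < length l then of_rat (l ! i) else 0)" by blast
  qed
  then show ?thesis by (rule countable_subset) simp
qed

lemma l1norm_nonneg: "0 \<le> l1norm n v"
  by (simp add: l1norm_def sum_nonneg)

lemma l1norm_coord: "i < n \<Longrightarrow> \<bar>v i\<bar> \<le> l1norm n v"
  unfolding l1norm_def by (rule member_le_sum) auto

lemma l1norm_minus_commute: "l1norm n (\<lambda>i. v i - w i) = l1norm n (\<lambda>i. w i - v i)"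
  by (simp add: l1norm_def abs_minus_commute)

lemma Qn_dense:
  assumes v: "v \<in> Rn n" and e: "0 < e"
  shows "\<exists>q\<in>Qn n. l1norm n (\<lambda>i. v i - q i) < e"
proof -
  \<comment> \<open>Dividing by \<open>n + 1\<close> rather than \<open>n\<close> covers dimension 0
    and makes the sum of the \<open>n\<close> errors strictly smaller than \<open>e\<close>.\<close>
  have "\<exists>r\<in>\<rat>. \<bar>v i - r\<bar> < e / (n + 1)" for i
  proof -
    have "v i < v i + e / (n + 1)" using e by simp
    then obtain r where "r \<in> \<rat>" "v i < r" "r < v i + e / (n + 1)" using Rats_dense_in_real by blast
    then show ?thesis by (intro bexI[of _ r]) auto
  qed
  then obtain r where r: "\<And>i. r i \<in> \<rat>" "\<And>i. \<bar>v i - r i\<bar> < e / (n + 1)" by metis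
  define q where "q i = (if i < n then r i else 0)" for i
  have "l1norm n (\<lambda>i. v i - q i) \<le> (\<Sum>i<n. e / (n + 1))"
    unfolding l1norm_def q_def using r(2) by (intro sum_mono) (auto intro: less_imp_le)
  also have "\<dots> < e" using e by (simp add: field_simps)
  finally show ?thesis using r(1) by (intro bexI[of _ q]) (auto simp: Qn_def Rn_iff q_def)
qed

lemma Qn_approx:
  assumes "v \<in> Rn n"
  obtains q where "\<And>j. q j \<in> Qn n" "(\<lambda>j. l1norm n (\<lambda>i. v i - q j i)) \<longlonglongrightarrow> 0"
proof -
  have "\<forall>j. \<exists>q\<in>Qn n. l1norm n (\<lambda>i. v i - q i) < inverse (real (Suc j))"
    using Qn_dense[OF assms] by simp
  then obtain q where q: "\<And>j. q j \<in> Qn n" "\<And>j. l1norm n (\<lambda>i. v i - q j i) < inverse (real (Suc j))"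
    by metis
  have "(\<lambda>j. l1norm n (\<lambda>i. v i - q j i)) \<longlonglongrightarrow> 0"
    by (rule tendsto_sandwich[OF _ _ tendsto_const LIMSEQ_inverse_real_of_nat])
      (auto simp: l1norm_nonneg simp del: of_nat_Suc intro!: always_eventually less_imp_le q(2))
  then show ?thesis using q(1) that by blast
qed

lemma lipschitz_tendsto:
  assumes "\<And>j. \<bar>g (q j) - g v\<bar> \<le> K * l1norm n (\<lambda>i. v i - q j i)"
    and "(\<lambda>j. l1norm n (\<lambda>i. v i - q j i)) \<longlonglongrightarrow> 0"
  shows "(\<lambda>j. g (q j)) \<longlonglongrightarrow> g v"
proof -
  have "(\<lambda>j. g (q j) - g v) \<longlonglongrightarrow> 0"
    by (rule Lim_null_comparison[where g = "\<lambda>j. K * l1norm n (\<lambda>i. v i - q j i)"])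
      (use assms tendsto_mult_left[OF assms(2), of K] in auto)
  then show ?thesis by (simp add: LIM_zero_iff)
qed

text \<open>Only one half of definiteness has to be demanded on top of a seminorm: the value at the
  zero vector is 0 by homogeneity with factor 0.\<close>

lemma norm_on_Rn_iff:
  "norm_on_Rn n N \<longleftrightarrow> seminorm_on_Rn n N \<and> (\<forall>v\<in>Rn n. N v = 0 \<longrightarrow> v = (\<lambda>i. 0))"
proof -
  have "N (\<lambda>i. 0) = 0" if "seminorm_on_Rn n N"
  proof -
    have "\<forall>c. \<forall>v\<in>Rn n. N (\<lambda>i. c * v i) = \<bar>c\<bar> * N v"
      using that by (simp add: seminorm_on_Rn_def)
    from bspec[OF spec[OF this, of 0] Rn_zero] show ?thesis by simp
  qed
  then show ?thesis unfolding norm_on_Rn_def seminorm_on_Rn_def by blast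
qed

context
  fixes n N assumes N: "seminorm_on_Rn n N"
begin

lemma seminorm_nonneg: "v \<in> Rn n \<Longrightarrow> 0 \<le> N v"
  and seminorm_scale: "v \<in> Rn n \<Longrightarrow> N (\<lambda>i. c * v i) = \<bar>c\<bar> * N v"
  and seminorm_triangle: "v \<in> Rn n \<Longrightarrow> w \<in> Rn n \<Longrightarrow> N (\<lambda>i. v i + w i) \<le> N v + N w"
  using N unfolding seminorm_on_Rn_def by blast+

lemma seminorm_zero: "N (\<lambda>i. 0) = 0"
  using seminorm_scale[of "\<lambda>i. 0" 0] by (simp add: Rn_zero)

lemma seminorm_minus: "v \<in> Rn n \<Longrightarrow> w \<in> Rn n \<Longrightarrow> N (\<lambda>i. v i - w i) = N (\<lambda>i. w i - v i)"
  using seminorm_scale[of "\<lambda>i. w i - v i" "-1"] by (simp add: Rn_diff)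

lemma seminorm_triangle_diff:
  assumes "u \<in> Rn n" "v \<in> Rn n" "w \<in> Rn n"
  shows "N (\<lambda>i. u i - w i) \<le> N (\<lambda>i. u i - v i) + N (\<lambda>i. v i - w i)"
  using seminorm_triangle[of "\<lambda>i. u i - v i" "\<lambda>i. v i - w i"] assms by (simp add: Rn_diff)

lemma seminorm_sum:
  assumes "finite A" "\<And>i. i \<in> A \<Longrightarrow> f i \<in> Rn n"
  shows "N (\<lambda>j. \<Sum>i\<in>A. c i * f i j) \<le> (\<Sum>i\<in>A. \<bar>c i\<bar> * N (f i))"
  using assms
proof (induction A rule: finite_induct)
  case empty then show ?case by (simp add: seminorm_zero)
next
  case (insert k A)
  have "N (\<lambda>j. \<Sum>i\<in>insert k A. c i * f i j) = N (\<lambda>j. c k * f k j + (\<Sum>i\<in>A. c i * f i j))"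
    using insert by simp
  also have "\<dots> \<le> N (\<lambda>j. c k * f k j) + N (\<lambda>j. \<Sum>i\<in>A. c i * f i j)"
    using insert by (intro seminorm_triangle Rn_scale Rn_sum) auto
  also have "\<dots> \<le> (\<Sum>i\<in>insert k A. \<bar>c i\<bar> * N (f i))"
    using insert by (simp add: seminorm_scale)
  finally show ?case .
qed

text \<open>Expansion in unit vectors makes the sum of their seminorms a Lipschitz constant. The
  constant in \<open>local_pnorm\<close> is the analogue, with basis elements in place of unit
  vectors.\<close>

lemma seminorm_le_l1norm:
  assumes "v \<in> Rn n" shows "N v \<le> (\<Sum>i<n. N (unit_vec i)) * l1norm n v"
proof -
  have "N v \<le> (\<Sum>i<n. \<bar>v i\<bar> * N (unit_vec i))"
    using seminorm_sum[of "{..<n}" unit_vec v] Rn_expand[OF assms] by (simp add: Rn_unit_vec)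
  also have "\<dots> \<le> (\<Sum>i<n. l1norm n v * N (unit_vec i))"
    by (intro sum_mono mult_right_mono l1norm_coord seminorm_nonneg Rn_unit_vec) auto
  finally show ?thesis by (simp add: sum_distrib_left mult.commute)
qed

lemma seminorm_abs_diff:
  assumes "v \<in> Rn n" "w \<in> Rn n" shows "\<bar>N v - N w\<bar> \<le> N (\<lambda>i. v i - w i)"
  using seminorm_triangle[of "\<lambda>i. v i - w i" w] seminorm_triangle[of "\<lambda>i. w i - v i" v]
    seminorm_minus[of v w] assms by (simp add: Rn_diff)

lemma seminorm_lipschitz:
  assumes "v \<in> Rn n" "w \<in> Rn n"
  shows "\<bar>N v - N w\<bar> \<le> (\<Sum>i<n. N (unit_vec i)) * l1norm n (\<lambda>i. w i - v i)"
  using seminorm_abs_diff[OF assms] seminorm_le_l1norm[OF Rn_diff[OF assms]]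
  by (simp add: l1norm_minus_commute[of n w v])

lemma seminorm_tendsto:
  assumes "v \<in> Rn n" "\<And>j. q j \<in> Rn n" "(\<lambda>j. l1norm n (\<lambda>i. v i - q j i)) \<longlonglongrightarrow> 0"
  shows "(\<lambda>j. N (q j)) \<longlonglongrightarrow> N v"
  by (rule lipschitz_tendsto[OF seminorm_lipschitz assms(3)]) (use assms in auto)

text \<open>The approximate kernel vectors \<open>w j + unit_vec k\<close> are Cauchy since \<open>N\<close> dominates
  \<open>l1norm\<close> on \<open>Rn k\<close>, so no compactness is needed.\<close>

lemma seminorm_kernel_limit:
  assumes k: "k < n" and c: "0 < c" "\<And>v. v \<in> Rn k \<Longrightarrow> c * l1norm k v \<le> N v"
    and w: "\<And>j. w j \<in> Rn k" and lim: "(\<lambda>j. N (\<lambda>i. unit_vec k i + w j i)) \<longlonglongrightarrow> 0"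
  defines "u \<equiv> \<lambda>i. lim (\<lambda>j. w j i)"
  shows "u \<in> Rn k" "N (\<lambda>i. unit_vec k i + u i) = 0"
proof -
  have wn: "w j \<in> Rn n" for j using w Rn_mono[of k n] k by (auto dest: less_imp_le)
  have conv: "(\<lambda>j. w j i) \<longlonglongrightarrow> u i" for i
  proof (cases "i < k")
    case False
    then have "w j i = 0" for j using w by (simp add: Rn_iff)
    then show ?thesis by (simp add: u_def)
  next
    case True
    have "Cauchy (\<lambda>j. w j i)"
    proof (rule metric_CauchyI)
      fix e :: real assume e: "0 < e"
      then have "0 < c * e / 2" using c by simp
      from LIMSEQ_D[OF lim this] obtain M where
        M: "\<And>j. j \<ge> M \<Longrightarrow> N (\<lambda>i. unit_vec k i + w j i) < c * e / 2"
        using seminorm_nonneg[OF Rn_add[OF Rn_unit_vec[OF k] wn]] by force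
      show "\<exists>M. \<forall>j\<ge>M. \<forall>l\<ge>M. dist (w j i) (w l i) < e"
      proof (intro exI allI impI)
        fix j l assume jl: "j \<ge> M" "l \<ge> M"
        let ?a = "\<lambda>j i. unit_vec k i + w j i"
        have a: "?a j \<in> Rn n" for j by (intro Rn_add Rn_unit_vec k wn)
        \<comment> \<open>In the difference of two approximate kernel vectors
          \<open>unit_vec k\<close> cancels, so it lies in \<open>Rn k\<close>, where
          \<open>N\<close> dominates the coordinates.\<close>
        have "c * \<bar>w j i - w l i\<bar> \<le> c * l1norm k (\<lambda>i. w j i - w l i)"
          using l1norm_coord[OF True, of "\<lambda>i. w j i - w l i"] c by simp
        also have "\<dots> \<le> N (\<lambda>i. w j i - w l i)" by (intro c Rn_diff w)
        also have "\<dots> = N (\<lambda>i. ?a j i - ?a l i)" by simp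
        also have "\<dots> \<le> N (?a j) + N (?a l)"
          using seminorm_triangle_diff[OF a Rn_zero a, of j l] seminorm_minus[OF Rn_zero a, of l]
          by simp
        also have "\<dots> < c * e" using M[OF jl(1)] M[OF jl(2)] by simp
        finally show "dist (w j i) (w l i) < e" using c by (simp add: dist_real_def)
      qed
    qed
    then show ?thesis unfolding u_def by (simp add: Cauchy_convergent_iff convergent_LIMSEQ_iff)
  qed
  show u: "u \<in> Rn k"
  proof -
    have "u i = 0" if "i \<ge> k" for i
      using LIMSEQ_unique[OF conv[of i], of 0] w that by (simp add: Rn_iff)
    then show ?thesis by (simp add: Rn_iff)
  qed
  then have un: "u \<in> Rn n" using Rn_mono[of k n] k by auto
  have "(\<lambda>j. \<Sum>i<n. \<bar>u i - w j i\<bar>) \<longlonglongrightarrow> (\<Sum>i<n. \<bar>u i - u i\<bar>)"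
    by (intro tendsto_intros conv)
  then have "(\<lambda>j. l1norm n (\<lambda>i. (unit_vec k i + u i) - (unit_vec k i + w j i))) \<longlonglongrightarrow> 0"
    by (simp add: l1norm_def)
  then have "(\<lambda>j. N (\<lambda>i. unit_vec k i + w j i)) \<longlonglongrightarrow> N (\<lambda>i. unit_vec k i + u i)"
    by (intro seminorm_tendsto Rn_add Rn_unit_vec k un wn)
  then show "N (\<lambda>i. unit_vec k i + u i) = 0" using lim LIMSEQ_unique by blast
qed

text \<open>Equivalence of norms in finite dimension, with compactness replaced by the hypothesis
  that each unit vector keeps a positive distance \<open>d\<close> from the span of those before it.
  Splitting off the last coordinate \<open>t\<close> of \<open>v\<close>, this distance bounds
  \<open>t\<close> by a multiple of \<open>N v\<close>, hence also \<open>N\<close> of the remaining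
  vector, to which the induction hypothesis applies.\<close>

lemma seminorm_dominates_l1norm:
  assumes "k \<le> n" "\<And>l. l < k \<Longrightarrow> \<exists>d>0. \<forall>w\<in>Rn l. d \<le> N (\<lambda>i. unit_vec l i + w i)"
  shows "\<exists>c>0. \<forall>v\<in>Rn k. c * l1norm k v \<le> N v"
  using assms
proof (induction k)
  case 0
  then show ?case using seminorm_nonneg Rn_mono[of 0 n]
    by (intro exI[of _ 1]) (auto simp: l1norm_def)
next
  case (Suc k)
  then obtain c where c: "0 < c" "\<And>v. v \<in> Rn k \<Longrightarrow> c * l1norm k v \<le> N v" by auto
  obtain d where d: "0 < d" "\<And>w. w \<in> Rn k \<Longrightarrow> d \<le> N (\<lambda>i. unit_vec k i + w i)"
    using Suc.prems(2)[of k] by auto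
  have k: "k < n" using Suc.prems by simp
  have ek: "unit_vec k \<in> Rn n" by (intro Rn_unit_vec k)
  \<comment> \<open>The first summand pays for the remaining vector \<open>w\<close>, for which
    \<open>N w\<close> is at most \<open>1 + N (unit_vec k) / d\<close> times \<open>N v\<close>;
    the second pays for \<open>t\<close>, which is at most \<open>N v / d\<close> in absolute
    value.\<close>
  define C where "C = inverse c * (1 + N (unit_vec k) / d) + inverse d"
  have "0 < C" unfolding C_def using c d seminorm_nonneg[OF ek]
    by (intro add_nonneg_pos mult_nonneg_nonneg) auto
  have "l1norm (Suc k) v \<le> C * N v" if v: "v \<in> Rn (Suc k)" for v
  proof -
    define t where "t = v k"
    define w where "w = (\<lambda>i. if i = k then 0 else v i)"
    have w: "w \<in> Rn k" using v by (auto simp: Rn_iff w_def)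
    have wn: "w \<in> Rn n" "v \<in> Rn n" using w v Rn_mono[of k n] Rn_mono[of "Suc k" n] k by auto
    have v_eq: "v = (\<lambda>i. w i + t * unit_vec k i)" by (auto simp: w_def t_def unit_vec_def)
    have 1: "\<bar>t\<bar> * d \<le> N v"
    proof (cases "t = 0")
      case False
      have "\<bar>t\<bar> * d \<le> \<bar>t\<bar> * N (\<lambda>i. unit_vec k i + inverse t * w i)"
        using d(2)[OF Rn_scale[OF w, of "inverse t"]] by (intro mult_left_mono) auto
      also have "\<dots> = N (\<lambda>i. t * (unit_vec k i + inverse t * w i))"
        by (intro seminorm_scale[symmetric] Rn_add ek Rn_scale wn)
      also have "(\<lambda>i. t * (unit_vec k i + inverse t * w i)) = v"
        using False by (auto simp: v_eq algebra_simps)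
      finally show ?thesis .
    qed (use seminorm_nonneg[OF wn(2)] in simp)
    have "w = (\<lambda>i. v i + (- t) * unit_vec k i)" by (auto simp: v_eq)
    then have "N w \<le> N v + \<bar>t\<bar> * N (unit_vec k)"
      using seminorm_triangle[OF wn(2) Rn_scale[OF ek, of "- t"]] seminorm_scale[OF ek, of "- t"]
      by simp
    also have "\<dots> \<le> N v + N v / d * N (unit_vec k)"
      using 1 d seminorm_nonneg[OF ek] by (intro add_left_mono mult_right_mono) (auto simp: field_simps)
    finally have 2: "N w \<le> (1 + N (unit_vec k) / d) * N v" by (simp add: field_simps)
    have "l1norm (Suc k) v = l1norm k w + \<bar>t\<bar>"
      by (simp add: l1norm_def w_def t_def)
    also have "\<dots> \<le> inverse c * N w + inverse d * N v"
      using c(1) c(2)[OF w] d(1) 1 by (intro add_mono) (auto simp: field_simps)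
    also have "\<dots> \<le> inverse c * ((1 + N (unit_vec k) / d) * N v) + inverse d * N v"
      using 2 c(1) by (intro add_right_mono mult_left_mono) auto
    also have "\<dots> = C * N v" unfolding C_def by (simp add: algebra_simps)
    finally show ?thesis .
  qed
  then show ?case using \<open>0 < C\<close>
    by (intro exI[of _ "inverse C"]) (auto simp: field_simps)
qed

end

lemma norm_on_Rn_mono: "norm_on_Rn n N \<Longrightarrow> k \<le> n \<Longrightarrow> norm_on_Rn k N"
  using Rn_mono[of k n] unfolding norm_on_Rn_def by (simp add: subset_iff)

text \<open>For a norm the distances required by \<open>seminorm_dominates_l1norm\<close> are
  positive: otherwise \<open>seminorm_kernel_limit\<close> produces a vector of norm 0 whose
  coordinate \<open>k\<close> is 1.\<close>

lemma norm_dominates_l1norm: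
  assumes "norm_on_Rn n N"
  shows "\<exists>c>0. \<forall>v\<in>Rn n. c * l1norm n v \<le> N v"
  using assms
proof (induction n)
  case 0
  then show ?case by (intro exI[of _ 1]) (auto simp: l1norm_def norm_on_Rn_def)
next
  case (Suc n)
  have N: "seminorm_on_Rn (Suc n) N" "\<And>v. v \<in> Rn (Suc n) \<Longrightarrow> N v = 0 \<Longrightarrow> v = (\<lambda>i. 0)"
    using Suc.prems by (auto simp: norm_on_Rn_iff)
  have gap: "\<exists>d>0. \<forall>w\<in>Rn k. d \<le> N (\<lambda>i. unit_vec k i + w i)"
    if "k \<le> n" and c: "\<exists>c>0. \<forall>v\<in>Rn k. c * l1norm k v \<le> N v" for k
  proof (rule ccontr)
    assume "\<not> ?thesis"
    then have "\<forall>d>0. \<exists>w\<in>Rn k. N (\<lambda>i. unit_vec k i + w i) < d" by (meson not_le)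
    then have "\<forall>j. \<exists>w\<in>Rn k. N (\<lambda>i. unit_vec k i + w i) < inverse (real (Suc j))" by simp
    then obtain w where w: "\<And>j. w j \<in> Rn k"
      "\<And>j. N (\<lambda>i. unit_vec k i + w j i) < inverse (real (Suc j))" by metis
    have k: "k < Suc n" using that by simp
    have wn: "w j \<in> Rn (Suc n)" for j using w(1) Rn_mono[of k "Suc n"] k by auto
    have lim: "(\<lambda>j. N (\<lambda>i. unit_vec k i + w j i)) \<longlonglongrightarrow> 0"
      by (rule tendsto_sandwich[OF _ _ tendsto_const LIMSEQ_inverse_real_of_nat])
        (auto simp del: of_nat_Suc intro!: always_eventually less_imp_le w(2) seminorm_nonneg[OF N(1)] Rn_add
          Rn_unit_vec k wn)
    obtain c where "0 < c" "\<And>v. v \<in> Rn k \<Longrightarrow> c * l1norm k v \<le> N v" using c by auto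
    note u = seminorm_kernel_limit[OF N(1) k this w(1) lim]
    have "(\<lambda>i. unit_vec k i + lim (\<lambda>j. w j i)) = (\<lambda>i. 0)"
      using u Rn_mono[of k "Suc n"] k by (intro N(2) Rn_add Rn_unit_vec) auto
    then have "unit_vec k k + lim (\<lambda>j. w j k) = 0" by metis
    then show False using u(1) by (simp add: Rn_iff unit_vec_def)
  qed
  have IH: "\<exists>c>0. \<forall>v\<in>Rn n. c * l1norm n v \<le> N v"
    by (rule Suc.IH[OF norm_on_Rn_mono[OF Suc.prems]]) simp
  have "\<exists>d>0. \<forall>w\<in>Rn l. d \<le> N (\<lambda>i. unit_vec l i + w i)" if "l < Suc n" for l
  proof (rule gap)
    show "l \<le> n" using that by simp
    obtain c where c: "c > 0" "\<And>v. v \<in> Rn n \<Longrightarrow> c * l1norm n v \<le> N v" using IH by auto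
    have "c * l1norm l v \<le> N v" if v: "v \<in> Rn l" for v
    proof -
      have "l1norm l v \<le> l1norm n v" unfolding l1norm_def using \<open>l \<le> n\<close> by (intro sum_mono2) auto
      then have "c * l1norm l v \<le> c * l1norm n v" using c by simp
      also have "\<dots> \<le> N v" using c(2) v Rn_mono[OF \<open>l \<le> n\<close>] by auto
      finally show ?thesis .
    qed
    then show "\<exists>c>0. \<forall>v\<in>Rn l. c * l1norm l v \<le> N v" using c by blast
  qed
  then show ?case by (intro seminorm_dominates_l1norm[OF N(1)]) auto
qed

section \<open>Classes of measurable functions\<close>

lemma equiv_ae_rel: "equiv A (ae_rel m A)"
proof (rule equivI)
  show "refl_on A (ae_rel m A)" by (auto simp: ae_rel_def refl_on_def)
  show "sym (ae_rel m A)" by (auto simp: ae_rel_def sym_def)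
  show "trans (ae_rel m A)"
    unfolding trans_def ae_rel_def by clarsimp
qed (auto simp: ae_rel_def)

lemma rep_mem: "equiv A r \<Longrightarrow> C \<in> A // r \<Longrightarrow> rep C \<in> C"
  unfolding rep_def by (rule someI_ex) (metis in_quotient_imp_non_empty ex_in_conv)

lemma rep_quotient:
  assumes "equiv A r" "C \<in> A // r"
  shows "rep C \<in> A" "r `` {rep C} = C"
proof -
  show "rep C \<in> A" using rep_mem[OF assms] in_quotient_imp_subset[OF assms] by auto
  obtain a where a: "C = r `` {a}" using assms(2) by (rule quotientE)
  then have "(a, rep C) \<in> r" using rep_mem[OF assms] by simp
  then show "r `` {rep C} = C" using equiv_class_eq[OF assms(1)] a by metis
qed

lemma rep_related: "equiv A r \<Longrightarrow> f \<in> A \<Longrightarrow> (f, rep (r `` {f})) \<in> r"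
  using rep_mem[of A r "r `` {f}"] by (simp add: quotientI)

lemma ae_class_eq_iff:
  "f \<in> A \<Longrightarrow> g \<in> A \<Longrightarrow> ae_rel m A `` {f} = ae_rel m A `` {g} \<longleftrightarrow> (AE x in m. f x = g x)"
  by (subst eq_equiv_class_iff[OF equiv_ae_rel]) (auto simp: ae_rel_def)

lemma AE_rep_ae_class: "f \<in> A \<Longrightarrow> AE x in m. rep (ae_rel m A `` {f}) x = f x"
  using rep_related[OF equiv_ae_rel, of f A m] by (auto simp: ae_rel_def)

lemma L0_class_in: "f \<in> borel_measurable m \<Longrightarrow> L0_class m f \<in> carrier (L0 m)"
  by (simp add: L0_def L0_class_def quotientI)

lemma rep_L0_measurable: "F \<in> carrier (L0 m) \<Longrightarrow> rep F \<in> borel_measurable m"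
  using rep_quotient(1)[OF equiv_ae_rel] by (auto simp: L0_def)

lemma L0_class_rep: "F \<in> carrier (L0 m) \<Longrightarrow> L0_class m (rep F) = F"
  using rep_quotient(2)[OF equiv_ae_rel] by (auto simp: L0_def L0_class_def)

lemma L0_cases:
  assumes "F \<in> carrier (L0 m)"
  obtains f where "f \<in> borel_measurable m" "F = L0_class m f"
  using L0_class_rep[OF assms] rep_L0_measurable[OF assms] by metis

lemma L0_class_eq_iff:
  "f \<in> borel_measurable m \<Longrightarrow> g \<in> borel_measurable m \<Longrightarrow>
    L0_class m f = L0_class m g \<longleftrightarrow> (AE x in m. f x = g x)"
  unfolding L0_class_def by (rule ae_class_eq_iff)

lemma L0_class_cong:
  "f \<in> borel_measurable m \<Longrightarrow> g \<in> borel_measurable m \<Longrightarrow> AE x in m. f x = g x \<Longrightarrow>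
    L0_class m f = L0_class m g"
  by (simp add: L0_class_eq_iff)

lemma AE_rep_L0_class: "f \<in> borel_measurable m \<Longrightarrow> AE x in m. rep (L0_class m f) x = f x"
  unfolding L0_class_def by (rule AE_rep_ae_class)

lemma L0_sel:
  "mult (L0 m) F G = L0_class m (\<lambda>x. rep F x * rep G x)"
  "one (L0 m) = L0_class m (\<lambda>_. 1)"
  "zero (L0 m) = L0_class m (\<lambda>_. 0)"
  "add (L0 m) F G = L0_class m (\<lambda>x. rep F x + rep G x)"
  by (simp_all add: L0_def)

lemma L0_mult:
  assumes [measurable]: "f \<in> borel_measurable m" "g \<in> borel_measurable m"
  shows "L0_class m f \<otimes>\<^bsub>L0 m\<^esub> L0_class m g = L0_class m (\<lambda>x. f x * g x)"
proof -
  have [measurable]: "rep (L0_class m f) \<in> borel_measurable m" "rep (L0_class m g) \<in> borel_measurable m"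
    by (simp_all add: rep_L0_measurable L0_class_in)
  show ?thesis unfolding L0_sel
    by (rule L0_class_cong) (use AE_rep_L0_class[OF assms(1)] AE_rep_L0_class[OF assms(2)] in auto)
qed

lemma L0_add:
  assumes [measurable]: "f \<in> borel_measurable m" "g \<in> borel_measurable m"
  shows "L0_class m f \<oplus>\<^bsub>L0 m\<^esub> L0_class m g = L0_class m (\<lambda>x. f x + g x)"
proof -
  have [measurable]: "rep (L0_class m f) \<in> borel_measurable m" "rep (L0_class m g) \<in> borel_measurable m"
    by (simp_all add: rep_L0_measurable L0_class_in)
  show ?thesis unfolding L0_sel
    by (rule L0_class_cong) (use AE_rep_L0_class[OF assms(1)] AE_rep_L0_class[OF assms(2)] in auto)
qed

lemma L0_abs_class:
  assumes [measurable]: "f \<in> borel_measurable m"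
  shows "L0_abs m (L0_class m f) = L0_class m (\<lambda>x. \<bar>f x\<bar>)"
proof -
  have [measurable]: "rep (L0_class m f) \<in> borel_measurable m"
    by (simp add: rep_L0_measurable L0_class_in)
  show ?thesis unfolding L0_abs_def
    by (rule L0_class_cong) (use AE_rep_L0_class[OF assms(1)] in auto)
qed

lemma L0_le_class:
  assumes "f \<in> borel_measurable m" "g \<in> borel_measurable m"
  shows "L0_le m (L0_class m f) (L0_class m g) \<longleftrightarrow> (AE x in m. f x \<le> g x)"
  unfolding L0_le_def
proof (rule eventually_subst)
  show "AE x in m. (rep (L0_class m f) x \<le> rep (L0_class m g) x) = (f x \<le> g x)"
    using AE_rep_L0_class[OF assms(1)] AE_rep_L0_class[OF assms(2)] by eventually_elim simp
qed

lemma cring_L0: "cring (L0 m)"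
proof (rule cringI)
  show "abelian_group (L0 m)"
  proof (rule abelian_groupI)
    fix F assume "F \<in> carrier (L0 m)"
    then show "\<exists>G\<in>carrier (L0 m). G \<oplus>\<^bsub>L0 m\<^esub> F = \<zero>\<^bsub>L0 m\<^esub>"
    proof (rule L0_cases)
      fix f assume f: "f \<in> borel_measurable m" "F = L0_class m f"
      have "L0_class m (\<lambda>x. - f x) \<oplus>\<^bsub>L0 m\<^esub> F = \<zero>\<^bsub>L0 m\<^esub>"
        using f by (simp add: L0_add L0_sel(3))
      then show ?thesis using f L0_class_in[of "\<lambda>x. - f x" m] by auto
    qed
  qed (auto elim!: L0_cases simp: L0_add L0_sel(2,3) L0_class_in add_ac)
  show "comm_monoid (L0 m)"
    by (rule comm_monoidI)
      (auto elim!: L0_cases simp: L0_mult L0_sel(2) L0_class_in mult_ac)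
next
  fix F G H assume FGH: "F \<in> carrier (L0 m)" "G \<in> carrier (L0 m)" "H \<in> carrier (L0 m)"
  obtain f where f: "f \<in> borel_measurable m" "F = L0_class m f" using FGH(1) by (rule L0_cases)
  obtain g where g: "g \<in> borel_measurable m" "G = L0_class m g" using FGH(2) by (rule L0_cases)
  obtain h where h: "h \<in> borel_measurable m" "H = L0_class m h" using FGH(3) by (rule L0_cases)
  show "(F \<oplus>\<^bsub>L0 m\<^esub> G) \<otimes>\<^bsub>L0 m\<^esub> H = F \<otimes>\<^bsub>L0 m\<^esub> H \<oplus>\<^bsub>L0 m\<^esub> G \<otimes>\<^bsub>L0 m\<^esub> H"
    using f g h by (simp add: L0_mult L0_add distrib_right)
qed

lemma L0_a_minus:
  assumes "f \<in> borel_measurable m"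
  shows "\<ominus>\<^bsub>L0 m\<^esub> L0_class m f = L0_class m (\<lambda>x. - f x)"
proof -
  have "L0_class m (\<lambda>x. - f x) \<oplus>\<^bsub>L0 m\<^esub> L0_class m f = \<zero>\<^bsub>L0 m\<^esub>"
    using assms by (simp add: L0_add L0_sel(3))
  moreover have "L0_class m (\<lambda>x. - f x) \<in> carrier (L0 m)" "L0_class m f \<in> carrier (L0 m)"
    using assms by (simp_all add: L0_class_in)
  ultimately show ?thesis
    using abelian_group.minus_equality[OF ring.is_abelian_group[OF cring.axioms(1)[OF cring_L0]]] by metis
qed

section \<open>The base measure and its equivalent probability measures\<close>

locale mm_space =
  fixes m :: "'x::polish_space measure"
  assumes metric_measure_space: "metric_measure_space m"
begin

lemma sets_m [measurable_cong]: "sets m = sets borel"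
  and space_m [simp]: "space m = UNIV"
proof -
  show "sets m = sets borel" using metric_measure_space by (simp add: metric_measure_space_def)
  then show "space m = UNIV" by (auto dest: sets_eq_imp_space_eq)
qed

lemma measurable_m: "measurable m N = measurable borel N"
  by (rule measurable_cong_sets) (simp_all add: sets_m)

text \<open>Local finiteness covers the space by open sets of finite measure, and by second
  countability countably many of them suffice (Lindelof).\<close>

lemma sigma_finite_m: "sigma_finite_measure m"
proof
  define F where "F = {U. open U \<and> emeasure m U < \<infinity>}"
  have "\<Union>F = UNIV" using metric_measure_space unfolding metric_measure_space_def F_def by blast
  moreover obtain F' where "F' \<subseteq> F" "countable F'" "\<Union>F' = \<Union>F"
    by (rule Lindelof[of F]) (auto simp: F_def)
  moreover have "U \<in> sets m \<and> emeasure m U \<noteq> \<infinity>" if "U \<in> F" for U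
    using that by (auto simp: F_def sets_m)
  ultimately have "countable F' \<and> F' \<subseteq> sets m \<and> \<Union>F' = space m \<and> (\<forall>a\<in>F'. emeasure m a \<noteq> \<infinity>)"
    by (simp add: subset_iff)
  then show "\<exists>A. countable A \<and> A \<subseteq> sets m \<and> \<Union>A = space m \<and> (\<forall>a\<in>A. emeasure m a \<noteq> \<infinity>)"
    by blast
qed

text \<open>The purely measure-theoretic conditions that \<open>normed_L0_module\<close> places on
  its auxiliary measure.\<close>

definition equiv_prob :: "'x measure \<Rightarrow> bool" where
  "equiv_prob m' \<longleftrightarrow> prob_space m' \<and> sets m' = sets borel \<and>
     absolutely_continuous m m' \<and> absolutely_continuous m' m"

text \<open>Sigma-finiteness gives an integrable function that is positive everywhere. Normalised to
  integral 1 it is the density of \<open>m'\<close>, and its positivity makes the null sets of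
  \<open>m'\<close> and \<open>m\<close> the same.\<close>

lemma ex_equiv_prob: "\<exists>m'. equiv_prob m'"
proof -
  interpret sigma_finite_measure m by (rule sigma_finite_m)
  obtain h where h[measurable]: "h \<in> borel_measurable m" and fin: "integral\<^sup>N m h \<noteq> \<infinity>"
    and pos: "\<And>x. 0 < h x \<and> h x < \<infinity>" using Ex_finite_integrable_function by auto
  define I where "I = integral\<^sup>N m h"
  have "emeasure m (space m) \<noteq> 0"
    using metric_measure_space by (auto simp only: metric_measure_space_def space_m)
  \<comment> \<open>A positive function has integral 0 only for the zero measure; here the
    nontriviality of \<open>m\<close> enters.\<close>
  have I: "I \<noteq> 0"
  proof
    assume "I = 0"
    then have "AE x in m. h x = 0" by (simp add: I_def nn_integral_0_iff_AE)
    then have "AE x in m. False" by (rule AE_mp) (use pos in \<open>auto simp: less_le\<close>)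
    then show False using \<open>emeasure m (space m) \<noteq> 0\<close> by (simp add: AE_iff_null null_setsD1)
  qed
  define g where "g x = h x / I" for x
  have [measurable]: "g \<in> borel_measurable m" unfolding g_def by measurable
  have gpos: "0 < g x" for x
    using pos[of x] fin I by (auto simp: g_def I_def ennreal_zero_less_divide less_top)
  define m' where "m' = density m g"
  have "emeasure m' (space m') = (\<integral>\<^sup>+x. h x / I \<partial>m)"
    by (simp add: m'_def emeasure_density g_def)
  also have "\<dots> = I / I" unfolding I_def by (rule nn_integral_divide) (rule h)
  also have "\<dots> = 1" using I fin by (intro ennreal_divide_self) (simp_all add: I_def less_top)
  finally have "prob_space m'" by (rule prob_spaceI)
  moreover have "A \<in> null_sets m' \<longleftrightarrow> A \<in> null_sets m" for A
  proof -
    have "g x \<noteq> 0" for x using gpos[of x] by simp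
    then have "A \<in> null_sets m' \<longleftrightarrow> A \<in> sets m \<and> (AE x in m. x \<notin> A)"
      unfolding m'_def by (subst null_sets_density_iff) auto
    then show ?thesis using AE_iff_null_sets[of A m] null_setsD2[of A m] by blast
  qed
  ultimately have "equiv_prob m'"
    by (auto simp: equiv_prob_def absolutely_continuous_def m'_def sets_m)
  then show ?thesis by blast
qed

lemma AE_equiv_prob:
  assumes "equiv_prob m'" shows "(AE x in m'. P x) \<longleftrightarrow> (AE x in m. P x)"
proof -
  have "null_sets m' = null_sets m"
    using assms by (auto simp: equiv_prob_def absolutely_continuous_def)
  moreover have "space m' = UNIV" using assms by (auto simp: equiv_prob_def dest: sets_eq_imp_space_eq)
  ultimately show ?thesis by (simp add: eventually_ae_filter)
qed

end

section \<open>Section modules\<close>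

lemma coordinate_measurable [measurable]:
  "(\<lambda>v :: nat \<Rightarrow> real. v i) \<in> borel_measurable borel"
  by (rule borel_measurable_continuous_onI) (rule continuous_on_product_coordinates)

lemma borel_fst: "fst \<in> (borel :: ('a::second_countable_topology \<times> 'b::second_countable_topology) measure) \<rightarrow>\<^sub>M borel"
  and borel_snd: "snd \<in> (borel :: ('a \<times> 'b) measure) \<rightarrow>\<^sub>M borel"
  unfolding borel_prod[symmetric] by (rule measurable_fst measurable_snd)+

lemma measurable_fun_iff:
  fixes f :: "'a \<Rightarrow> nat \<Rightarrow> real"
  shows "f \<in> borel_measurable M \<longleftrightarrow> (\<forall>i. (\<lambda>x. f x i) \<in> borel_measurable M)"
  using measurable_coordinatewise_then_product[of f M] measurable_compose[OF _ coordinate_measurable]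
  by blast

lemma Rn_borel [measurable]: "Rn n \<in> sets borel"
proof -
  have "{v \<in> space borel. \<forall>i. n \<le> i \<longrightarrow> v i = (0::real)} \<in> sets (borel :: (nat \<Rightarrow> real) measure)"
    by measurable
  also have "{v \<in> space borel. \<forall>i. n \<le> i \<longrightarrow> v i = (0::real)} = Rn n" by (auto simp: Rn_iff)
  finally show ?thesis .
qed

text \<open>The partition as a function of the point: the fibre over \<open>x\<close> is
  \<open>Rn (bdim T x)\<close>, which spares case distinctions over the parts.\<close>

definition bdim :: "'x mbb \<Rightarrow> 'x \<Rightarrow> nat" where
  "bdim T x = (THE n. x \<in> part T n)"

text \<open>Sections are handled through their second components, which form the set \<open>msec T\<close>.\<close>

definition msec :: "'x::topological_space mbb \<Rightarrow> ('x \<Rightarrow> nat \<Rightarrow> real) set" where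
  "msec T = {f. f \<in> borel_measurable borel \<and> (\<forall>x. f x \<in> Rn (bdim T x))}"

definition sec_class ::
  "'x::topological_space measure \<Rightarrow> 'x mbb \<Rightarrow> ('x \<Rightarrow> nat \<Rightarrow> real) \<Rightarrow> ('x, 'u) melem" where
  "sec_class m T f = Inl (section_class m T (\<lambda>x. (x, f x)))"

context mm_space
begin

context
  fixes T assumes T: "is_mbb m T"
begin

lemma part_measurable [measurable]: "part T n \<in> sets borel"
  using T by (simp add: is_mbb_def)

lemma bdim_eq: "x \<in> part T n \<Longrightarrow> bdim T x = n"
  unfolding bdim_def using T
  by (intro the_equality) (auto simp: is_mbb_def disjoint_family_on_def)

lemma in_part_bdim: "x \<in> part T (bdim T x)"
proof -
  have "x \<in> (\<Union>n. part T n)" using T by (simp add: is_mbb_def)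
  then show ?thesis using bdim_eq by auto
qed

lemma in_part_iff: "x \<in> part T n \<longleftrightarrow> bdim T x = n"
  using bdim_eq in_part_bdim by metis

lemma bdim_measurable [measurable]: "bdim T \<in> borel \<rightarrow>\<^sub>M count_space UNIV"
proof -
  have "bdim T -` {n} = part T n" for n by (auto simp: in_part_iff)
  then show ?thesis by (auto simp: measurable_count_space_eq_countable)
qed

lemma total_set_iff: "z \<in> total_set T \<longleftrightarrow> snd z \<in> Rn (bdim T (fst z))"
  by (cases z) (auto simp: total_set_def in_part_iff)

lemma fiber_eq: "fiber T x = Rn (bdim T x)"
  by (simp add: fiber_def total_set_iff)

lemma total_set_borel: "total_set T \<in> sets borel"
  unfolding total_set_def by (intro sets.countable_UN'' borel_Times) auto

lemma space_total_space: "space (total_space T) = total_set T"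
  unfolding total_space_def by (rule space_measure_of) auto

text \<open>The pieces \<open>part T n \<times> Rn n\<close> are Borel and countable in number, so
  Borel on every piece means Borel. Measurability into and out of the total space thereby becomes
  ordinary Borel measurability.\<close>

lemma sets_total_space: "sets (total_space T) = sets (restrict_space borel (total_set T))"
proof -
  let ?S = "{S. S \<subseteq> total_set T \<and> (\<forall>n. S \<inter> (part T n \<times> Rn n) \<in> sets borel)}"
  have 1: "S \<in> sets borel" if "S \<in> ?S" for S
  proof -
    have "S = (\<Union>n. S \<inter> (part T n \<times> Rn n))" using that by (auto simp: total_set_def)
    also have "\<dots> \<in> sets borel" using that by (intro sets.countable_UN'') auto
    finally show ?thesis .
  qed
  have 2: "S \<in> ?S" if "S \<in> sets borel" "S \<subseteq> total_set T" for S
    using that by (auto intro!: sets.Int borel_Times)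
  have "S \<in> sets (restrict_space borel (total_set T)) \<longleftrightarrow> S \<subseteq> total_set T \<and> S \<in> sets borel" for S
    using total_set_borel by (simp add: sets_restrict_space_iff)
  then have S: "?S = sets (restrict_space borel (total_set T))"
    using 1 2 by blast
  have "sets (total_space T) = sigma_sets (total_set T) ?S"
    unfolding total_space_def by (rule sets_measure_of) auto
  also have "\<dots> = sets (restrict_space borel (total_set T))"
    unfolding S using sets.sigma_sets_eq[of "restrict_space borel (total_set T)"]
    by (simp add: space_restrict_space)
  finally show ?thesis .
qed

lemma measurable_total_space:
  "measurable (total_space T) N = measurable (restrict_space borel (total_set T)) N"
  by (rule measurable_cong_sets) (simp_all add: sets_total_space)

lemma measurable_into_total_space:
  "f \<in> M \<rightarrow>\<^sub>M total_space T \<longleftrightarrow> f \<in> M \<rightarrow>\<^sub>M borel \<and> (\<forall>x\<in>space M. f x \<in> total_set T)"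
proof -
  have "f \<in> M \<rightarrow>\<^sub>M total_space T \<longleftrightarrow> f \<in> M \<rightarrow>\<^sub>M restrict_space borel (total_set T)"
    by (simp only: measurable_cong_sets[OF refl sets_total_space])
  then show ?thesis by (auto simp: measurable_restrict_space2_iff)
qed

lemma msec_iff:
  "f \<in> msec T \<longleftrightarrow>
    (\<forall>i. (\<lambda>x. f x i) \<in> borel_measurable borel) \<and> (\<forall>x i. bdim T x \<le> i \<longrightarrow> f x i = 0)"
  by (simp add: msec_def Rn_iff measurable_fun_iff[of f])

lemma msec_measurable: "f \<in> msec T \<Longrightarrow> (\<lambda>x. f x i) \<in> borel_measurable borel"
  and msec_Rn: "f \<in> msec T \<Longrightarrow> f x \<in> Rn (bdim T x)"
  by (simp_all add: msec_iff Rn_iff)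

lemma bundle_sections_iff: "s \<in> bundle_sections T \<longleftrightarrow> (\<exists>f\<in>msec T. s = (\<lambda>x. (x, f x)))"
proof
  assume s: "s \<in> bundle_sections T"
  then have eq: "s = (\<lambda>x. (x, snd (s x)))" by (simp add: bundle_sections_def prod_eq_iff fun_eq_iff)
  have [measurable]: "s \<in> borel \<rightarrow>\<^sub>M borel \<Otimes>\<^sub>M borel" 
    using s by (simp add: bundle_sections_def measurable_into_total_space borel_prod)
  have "snd (s x) \<in> Rn (bdim T x)" for x
    using s total_set_iff[of "s x"] by (auto simp: bundle_sections_def measurable_into_total_space)
  then have "(\<lambda>x. snd (s x)) \<in> msec T" by (simp add: msec_def)
  then show "\<exists>f\<in>msec T. s = (\<lambda>x. (x, f x))"
    using eq by (intro bexI[where x = "\<lambda>x. snd (s x)"])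
next
  assume "\<exists>f\<in>msec T. s = (\<lambda>x. (x, f x))"
  then obtain f where f: "f \<in> msec T" "s = (\<lambda>x. (x, f x))" by blast
  then have [measurable]: "f \<in> borel_measurable borel" by (simp add: msec_def)
  have "s \<in> borel \<rightarrow>\<^sub>M borel" unfolding f borel_prod[symmetric] by measurable
  then show "s \<in> bundle_sections T"
    using f by (simp add: bundle_sections_def measurable_into_total_space total_set_iff msec_def)
qed

lemma bnorm_measurable:
  assumes "f \<in> msec T" shows "(\<lambda>x. bnorm T (x, f x)) \<in> borel_measurable borel"
proof -
  have "bnorm T \<in> borel_measurable (total_space T)" using T by (simp add: is_mbb_def)
  moreover have "(\<lambda>x. (x, f x)) \<in> borel \<rightarrow>\<^sub>M total_space T"
    using assms bundle_sections_iff by (auto simp: bundle_sections_def)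
  ultimately show ?thesis using measurable_compose by blast
qed

lemma bnorm_nonneg: "v \<in> Rn (bdim T x) \<Longrightarrow> 0 \<le> bnorm T (x, v)"
  using T total_set_iff[of "(x, v)"] by (simp add: is_mbb_def)

lemma AE_norm: "AE x in m. norm_on_Rn (bdim T x) (\<lambda>v. bnorm T (x, v))"
proof -
  have "AE x in m. \<forall>n. x \<in> part T n \<longrightarrow> norm_on_Rn n (\<lambda>v. bnorm T (x, v))"
    using T by (simp add: is_mbb_def AE_all_countable)
  then show ?thesis by eventually_elim (simp add: in_part_bdim)
qed

lemma AE_seminorm: "AE x in m. seminorm_on_Rn (bdim T x) (\<lambda>v. bnorm T (x, v))"
  using AE_norm by eventually_elim (simp add: norm_on_Rn_iff)

lemma msec_zero: "(\<lambda>x i. 0) \<in> msec T"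
  and msec_add: "f \<in> msec T \<Longrightarrow> g \<in> msec T \<Longrightarrow> (\<lambda>x i. f x i + g x i) \<in> msec T"
  and msec_diff: "f \<in> msec T \<Longrightarrow> g \<in> msec T \<Longrightarrow> (\<lambda>x i. f x i - g x i) \<in> msec T"
  and msec_uminus: "f \<in> msec T \<Longrightarrow> (\<lambda>x i. - f x i) \<in> msec T"
  and msec_scale: "c \<in> borel_measurable m \<Longrightarrow> f \<in> msec T \<Longrightarrow> (\<lambda>x i. c x * f x i) \<in> msec T"
  by (auto simp: msec_iff measurable_m
      intro!: borel_measurable_add borel_measurable_diff borel_measurable_uminus borel_measurable_times)

lemma msec_sum:
  "(\<And>i. i \<in> A \<Longrightarrow> c i \<in> borel_measurable m) \<Longrightarrow> (\<And>i. i \<in> A \<Longrightarrow> f i \<in> msec T) \<Longrightarrow>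
    (\<lambda>x j. \<Sum>i\<in>A. c i x * f i x j) \<in> msec T"
  by (auto simp: msec_iff measurable_m intro!: sum.neutral borel_measurable_sum borel_measurable_times)

lemma sec_class_eq_iff:
  assumes "f \<in> msec T" "g \<in> msec T"
  shows "sec_class m T f = sec_class m T g \<longleftrightarrow> (AE x in m. f x = g x)"
proof -
  have "(\<lambda>x. (x, f x)) \<in> bundle_sections T" "(\<lambda>x. (x, g x)) \<in> bundle_sections T"
    using assms bundle_sections_iff by auto
  then show ?thesis by (simp add: sec_class_def section_class_def ae_class_eq_iff)
qed

lemma sec_class_cong:
  "f \<in> msec T \<Longrightarrow> g \<in> msec T \<Longrightarrow> AE x in m. f x = g x \<Longrightarrow> sec_class m T f = sec_class m T g"
  by (simp add: sec_class_eq_iff)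

lemma carrier_section_module:
  "carrier (section_module m T) = sec_class m T ` msec T"
proof -
  have "bundle_sections T = (\<lambda>f x. (x, f x)) ` msec T"
    using bundle_sections_iff by auto
  then show ?thesis
    by (auto simp: section_module_def sec_class_def section_class_def quotient_def)
qed

lemma sec_class_in: "f \<in> msec T \<Longrightarrow> sec_class m T f \<in> carrier (section_module m T)"
  by (simp add: carrier_section_module)

text \<open>The operations of \<open>section_module\<close> work on an arbitrary representative. It
  is again a section, equal to \<open>f\<close> off a null set, and this is how the computation
  rules below get rid of it.\<close>

lemma rep_section:
  assumes "f \<in> msec T"
  shows "rep (projl (sec_class m T f :: ('x, 'u) melem)) =
      (\<lambda>x. (x, srep (sec_class m T f :: ('x, 'u) melem) x))"
    "srep (sec_class m T f :: ('x, 'u) melem) \<in> msec T"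
    "AE x in m. srep (sec_class m T f :: ('x, 'u) melem) x = f x"
proof -
  have s: "(\<lambda>x. (x, f x)) \<in> bundle_sections T" using assms bundle_sections_iff by auto
  have "rep (projl (sec_class m T f :: ('x, 'u) melem)) \<in> bundle_sections T"
    unfolding sec_class_def section_class_def sum.sel
    by (rule rep_quotient(1)[OF equiv_ae_rel quotientI[OF s]])
  then obtain g where g: "g \<in> msec T" "rep (projl (sec_class m T f :: ('x, 'u) melem)) = (\<lambda>x. (x, g x))"
    using bundle_sections_iff by blast
  then have "srep (sec_class m T f :: ('x, 'u) melem) = g" by (simp add: srep_def[abs_def])
  then show "rep (projl (sec_class m T f :: ('x, 'u) melem)) = (\<lambda>x. (x, srep (sec_class m T f :: ('x, 'u) melem) x))"
    "srep (sec_class m T f :: ('x, 'u) melem) \<in> msec T" using g by simp_all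
  have "AE x in m. rep (projl (sec_class m T f :: ('x, 'u) melem)) x = (x, f x)"
    unfolding sec_class_def section_class_def sum.sel by (rule AE_rep_ae_class[OF s])
  then show "AE x in m. srep (sec_class m T f :: ('x, 'u) melem) x = f x"
    by eventually_elim (simp add: srep_def)
qed

lemma srep_in: "S \<in> carrier (section_module m T) \<Longrightarrow> srep S \<in> msec T"
  using rep_section(2) by (auto simp: carrier_section_module)

lemma sec_class_srep: 
  fixes S :: "('x, 'u) melem"
  assumes "S \<in> carrier (section_module m T)" shows "sec_class m T (srep S) = S"
proof -
  obtain f where f: "f \<in> msec T" "S = sec_class m T f" using assms by (auto simp: carrier_section_module)
  show ?thesis unfolding f(2) by (rule sec_class_cong) (use f rep_section[OF f(1)] in auto)
qed

lemma section_cases: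
  assumes "S \<in> carrier (section_module m T)"
  obtains f where "f \<in> msec T" "S = sec_class m T f"
  using assms by (auto simp: carrier_section_module)

lemma section_zero: "zero (section_module m T) = sec_class m T (\<lambda>x i. 0)"
  by (simp add: section_module_def sec_class_def)

lemma section_add:
  assumes "f \<in> msec T" "g \<in> msec T"
  shows "(sec_class m T f :: ('x, 'u) melem) \<oplus>\<^bsub>section_module m T\<^esub> sec_class m T g =
    sec_class m T (\<lambda>x i. f x i + g x i)"
proof -
  let ?f = "srep (sec_class m T f :: ('x, 'u) melem)" and ?g = "srep (sec_class m T g :: ('x, 'u) melem)"
  have "sec_class m T (\<lambda>x i. ?f x i + ?g x i) = (sec_class m T (\<lambda>x i. f x i + g x i) :: ('x, 'u) melem)"
  proof (rule sec_class_cong)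
    show "AE x in m. (\<lambda>i. ?f x i + ?g x i) = (\<lambda>i. f x i + g x i)"
      using rep_section(3)[OF assms(1), where ?'u = 'u] rep_section(3)[OF assms(2), where ?'u = 'u]
      by eventually_elim simp
  qed (intro msec_add rep_section assms)+
  then show ?thesis by (simp add: section_module_def sec_class_def)
qed

lemma section_smult:
  assumes c: "c \<in> borel_measurable m" and f: "f \<in> msec T"
  shows "L0_class m c \<odot>\<^bsub>section_module m T\<^esub> (sec_class m T f :: ('x, 'u) melem) =
    sec_class m T (\<lambda>x i. c x * f x i)"
proof -
  let ?f = "srep (sec_class m T f :: ('x, 'u) melem)" and ?c = "rep (L0_class m c)"
  have "sec_class m T (\<lambda>x i. ?c x * ?f x i) = (sec_class m T (\<lambda>x i. c x * f x i) :: ('x, 'u) melem)"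
  proof (rule sec_class_cong)
    show "AE x in m. (\<lambda>i. ?c x * ?f x i) = (\<lambda>i. c x * f x i)"
      using rep_section(3)[OF f, where ?'u = 'u] AE_rep_L0_class[OF c] by eventually_elim simp
  qed (intro msec_scale rep_section assms rep_L0_measurable L0_class_in)+
  then show ?thesis by (simp add: section_module_def sec_class_def)
qed

lemma section_pnorm:
  assumes f: "f \<in> msec T"
  shows "pnorm (section_module m T) (sec_class m T f :: ('x, 'u) melem) =
    L0_class m (\<lambda>x. bnorm T (x, f x))"
proof -
  let ?f = "srep (sec_class m T f :: ('x, 'u) melem)"
  have "L0_class m (\<lambda>x. bnorm T (x, ?f x)) = L0_class m (\<lambda>x. bnorm T (x, f x))"
  proof (rule L0_class_cong)
    show "AE x in m. bnorm T (x, ?f x) = bnorm T (x, f x)"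
      using rep_section(3)[OF f, where ?'u = 'u] by eventually_elim simp
  qed (simp_all add: measurable_m bnorm_measurable rep_section f)
  then show ?thesis by (simp add: section_module_def)
qed

lemma abelian_group_section: "abelian_group (section_module m T :: ('x, ('x, 'u) melem) L0_nmodule)"
proof (rule abelian_groupI)
  show "\<zero>\<^bsub>section_module m T\<^esub> \<in> carrier (section_module m T)"
    by (simp add: section_zero sec_class_in msec_zero)
  fix S :: "('x, 'u) melem" assume "S \<in> carrier (section_module m T)"
  then obtain f where f: "f \<in> msec T" "S = sec_class m T f" by (rule section_cases)
  show "\<zero>\<^bsub>section_module m T\<^esub> \<oplus>\<^bsub>section_module m T\<^esub> S = S"
    using f by (simp add: section_add section_zero msec_zero)
  have "sec_class m T (\<lambda>x i. - f x i) \<oplus>\<^bsub>section_module m T\<^esub> S = \<zero>\<^bsub>section_module m T\<^esub>"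
    using f by (simp add: section_add section_zero msec_uminus)
  then show "\<exists>S'\<in>carrier (section_module m T). S' \<oplus>\<^bsub>section_module m T\<^esub> S = \<zero>\<^bsub>section_module m T\<^esub>"
    using sec_class_in[OF msec_uminus[OF f(1)]] by blast
  fix S' :: "('x, 'u) melem" assume "S' \<in> carrier (section_module m T)"
  then obtain f' where f': "f' \<in> msec T" "S' = sec_class m T f'" by (rule section_cases)
  show "S \<oplus>\<^bsub>section_module m T\<^esub> S' \<in> carrier (section_module m T)"
    "S \<oplus>\<^bsub>section_module m T\<^esub> S' = S' \<oplus>\<^bsub>section_module m T\<^esub> S"
    using f f' by (simp_all add: section_add msec_add sec_class_in add.commute)
  fix S'' :: "('x, 'u) melem" assume "S'' \<in> carrier (section_module m T)"
  then obtain f'' where f'': "f'' \<in> msec T" "S'' = sec_class m T f''" by (rule section_cases)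
  show "(S \<oplus>\<^bsub>section_module m T\<^esub> S') \<oplus>\<^bsub>section_module m T\<^esub> S'' =
      S \<oplus>\<^bsub>section_module m T\<^esub> (S' \<oplus>\<^bsub>section_module m T\<^esub> S'')"
    using f f' f'' by (simp add: section_add msec_add add.assoc)
qed

lemma section_uminus:
  assumes "f \<in> msec T"
  shows "\<ominus>\<^bsub>section_module m T\<^esub> (sec_class m T f :: ('x, 'u) melem) = sec_class m T (\<lambda>x i. - f x i)"
proof (rule abelian_group.minus_equality[OF abelian_group_section])
  show "sec_class m T (\<lambda>x i. - f x i) \<oplus>\<^bsub>section_module m T\<^esub> (sec_class m T f :: ('x, 'u) melem) =
      \<zero>\<^bsub>section_module m T\<^esub>"
    using assms by (simp add: section_add section_zero msec_uminus)
qed (intro sec_class_in msec_uminus assms)+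

lemma section_minus:
  assumes "f \<in> msec T" "g \<in> msec T"
  shows "(sec_class m T f :: ('x, 'u) melem) \<ominus>\<^bsub>section_module m T\<^esub> sec_class m T g =
    sec_class m T (\<lambda>x i. f x i - g x i)"
  using assms by (simp add: a_minus_def section_uminus section_add msec_uminus)

lemma module_section: "Module.module (L0 m) (section_module m T :: ('x, ('x, 'u) melem) L0_nmodule)"
proof (rule moduleI)
  fix S :: "('x, 'u) melem" assume "S \<in> carrier (section_module m T)"
  then show "\<one>\<^bsub>L0 m\<^esub> \<odot>\<^bsub>section_module m T\<^esub> S = S"
    by (rule section_cases) (simp add: L0_sel(2) section_smult)
next
  fix F and S :: "('x, 'u) melem"
  assume F: "F \<in> carrier (L0 m)" and S: "S \<in> carrier (section_module m T)"
  obtain f where f: "f \<in> borel_measurable m" "F = L0_class m f" using F by (rule L0_cases)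
  obtain s where s: "s \<in> msec T" "S = sec_class m T s" using S by (rule section_cases)
  show "F \<odot>\<^bsub>section_module m T\<^esub> S \<in> carrier (section_module m T)"
    using f s by (simp add: section_smult msec_scale sec_class_in)
  {
    fix G assume "G \<in> carrier (L0 m)"
    then obtain g where g: "g \<in> borel_measurable m" "G = L0_class m g" by (rule L0_cases)
    have fg: "(\<lambda>x. f x + g x) \<in> borel_measurable m" "(\<lambda>x. f x * g x) \<in> borel_measurable m"
      using f(1) g(1) by (auto intro: borel_measurable_add borel_measurable_times)
    show "(F \<oplus>\<^bsub>L0 m\<^esub> G) \<odot>\<^bsub>section_module m T\<^esub> S =
        F \<odot>\<^bsub>section_module m T\<^esub> S \<oplus>\<^bsub>section_module m T\<^esub> G \<odot>\<^bsub>section_module m T\<^esub> S"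
      unfolding f(2) g(2) s(2) L0_add[OF f(1) g(1)] section_smult[OF fg(1) s(1)]
        section_smult[OF f(1) s(1)] section_smult[OF g(1) s(1)]
        section_add[OF msec_scale[OF f(1) s(1)] msec_scale[OF g(1) s(1)]]
      by (simp only: distrib_right)
    show "(F \<otimes>\<^bsub>L0 m\<^esub> G) \<odot>\<^bsub>section_module m T\<^esub> S =
        F \<odot>\<^bsub>section_module m T\<^esub> (G \<odot>\<^bsub>section_module m T\<^esub> S)"
      unfolding f(2) g(2) s(2) L0_mult[OF f(1) g(1)] section_smult[OF fg(2) s(1)]
        section_smult[OF g(1) s(1)] section_smult[OF f(1) msec_scale[OF g(1) s(1)]]
      by (simp only: mult.assoc)
  }
  fix S' :: "('x, 'u) melem" assume "S' \<in> carrier (section_module m T)"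
  then obtain s' where s': "s' \<in> msec T" "S' = sec_class m T s'" by (rule section_cases)
  show "F \<odot>\<^bsub>section_module m T\<^esub> (S \<oplus>\<^bsub>section_module m T\<^esub> S') =
      F \<odot>\<^bsub>section_module m T\<^esub> S \<oplus>\<^bsub>section_module m T\<^esub> F \<odot>\<^bsub>section_module m T\<^esub> S'"
    unfolding f(2) s(2) s'(2) section_add[OF s(1) s'(1)] section_smult[OF f(1) msec_add[OF s(1) s'(1)]]
      section_smult[OF f(1) s(1)] section_smult[OF f(1) s'(1)]
      section_add[OF msec_scale[OF f(1) s(1)] msec_scale[OF f(1) s'(1)]]
    by (simp only: distrib_left)
qed (fact cring_L0, fact abelian_group_section)

end

end

section \<open>Completeness of section modules\<close>

lemma (in Metric_space) mcompleteI_fast: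
  assumes "\<And>\<sigma>. MCauchy \<sigma> \<Longrightarrow> (\<And>k. d (\<sigma> k) (\<sigma> (Suc k)) < (1 / 2) ^ k) \<Longrightarrow>
    \<exists>a. limitin mtopology \<sigma> a sequentially"
  shows mcomplete
  unfolding mcomplete_def
proof (intro allI impI)
  fix \<sigma> assume cauchy: "MCauchy \<sigma>"
  then have "\<forall>k. \<exists>N. \<forall>n n'. N \<le> n \<longrightarrow> N \<le> n' \<longrightarrow> d (\<sigma> n) (\<sigma> n') < (1 / 2) ^ k"
    unfolding MCauchy_def by simp
  then obtain N where N: "\<And>k n n'. N k \<le> n \<Longrightarrow> N k \<le> n' \<Longrightarrow> d (\<sigma> n) (\<sigma> n') < (1 / 2) ^ k"
    by metis
  \<comment> \<open>The summand \<open>k\<close> makes \<open>r\<close> strictly increasing, and the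
    sum gives \<open>N k \<le> r k\<close> although \<open>N\<close> need not be monotone.\<close>
  define r where "r k = k + (\<Sum>j\<le>k. N j)" for k
  have r: "strict_mono r" by (simp add: r_def strict_mono_Suc_iff)
  have "N k \<le> r k" for k
    using member_le_sum[of k "{..k}" N] by (simp add: r_def)
  moreover have "r k \<le> r (Suc k)" for k by (simp add: r_def)
  ultimately have "d ((\<sigma> \<circ> r) k) ((\<sigma> \<circ> r) (Suc k)) < (1 / 2) ^ k" for k
    using N[of k "r k" "r (Suc k)"] le_trans[of "N k" "r k" "r (Suc k)"] by simp
  moreover have "MCauchy (\<sigma> \<circ> r)" using cauchy r by (rule MCauchy_subsequence[rotated])
  ultimately obtain a where "limitin mtopology (\<sigma> \<circ> r) a sequentially"
    using assms by blast
  then show "\<exists>a. limitin mtopology \<sigma> a sequentially"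
    using MCauchy_convergent_subsequence[OF cauchy r] by blast
qed

text \<open>By monotone convergence the integral of the series is the series of the integrals. That
  is finite, so the series is finite almost everywhere.\<close>

lemma AE_summable_of_integrals:
  fixes a :: "nat \<Rightarrow> 'a \<Rightarrow> real"
  assumes a: "\<And>k. integrable M (a k)" "\<And>k x. 0 \<le> a k x"
    and b: "\<And>k. (\<integral>x. a k x \<partial>M) \<le> b k" "summable b"
  shows "AE x in M. summable (\<lambda>k. a k x)"
proof -
  have [measurable]: "a k \<in> borel_measurable M" for k using a(1) by auto
  have b0: "0 \<le> b k" for k using order_trans[OF Bochner_Integration.integral_nonneg b(1)] a(2) by blast
  have "(\<integral>\<^sup>+x. (\<Sum>k. ennreal (a k x)) \<partial>M) = (\<Sum>k. \<integral>\<^sup>+x. ennreal (a k x) \<partial>M)"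
    by (rule nn_integral_suminf) simp
  also have "\<dots> = (\<Sum>k. ennreal (\<integral>x. a k x \<partial>M))"
    using a by (simp add: nn_integral_eq_integral)
  also have "\<dots> \<le> (\<Sum>k. ennreal (b k))" by (intro suminf_le ennreal_leI b) auto
  also have "\<dots> = ennreal (\<Sum>k. b k)" using b0 b(2) by (rule suminf_ennreal2)
  also have "\<dots> < \<infinity>" by simp
  finally have "(\<integral>\<^sup>+x. (\<Sum>k. ennreal (a k x)) \<partial>M) \<noteq> \<infinity>" by simp
  then have "AE x in M. (\<Sum>k. ennreal (a k x)) \<noteq> \<infinity>"
    by (intro nn_integral_PInf_AE) auto
  then show ?thesis
    by eventually_elim (auto intro!: summable_suminf_not_top a(2))
qed

lemma convergent_of_summable_steps:
  fixes u :: "nat \<Rightarrow> real"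
  assumes "summable (\<lambda>k. u (Suc k) - u k)" shows "convergent u"
proof -
  have "convergent (\<lambda>n. \<Sum>k<n. u (Suc k) - u k)"
    using assms by (simp add: summable_iff_convergent)
  then have "convergent (\<lambda>n. u n - u 0)" by (simp add: sum_lessThan_telescope)
  from convergent_add[OF this convergent_const[of "u 0"]] show ?thesis by simp
qed

text \<open>Summable terms tend to 0, so the truncation at 1 is eventually inactive. Domination of
  \<open>l1norm\<close> by \<open>N\<close> then makes the steps of each coordinate summable, and
  coordinatewise convergence implies convergence in \<open>N\<close>.\<close>

lemma norm_on_Rn_cauchy_limit:
  assumes N: "norm_on_Rn n N" and g: "\<And>k. g k \<in> Rn n"
    and sum: "summable (\<lambda>k. min (N (\<lambda>i. g k i - g (Suc k) i)) 1)"
  shows "(\<lambda>k. N (\<lambda>i. g k i - lim (\<lambda>j. g j i))) \<longlonglongrightarrow> 0"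
proof -
  let ?h = "\<lambda>i. lim (\<lambda>j. g j i)"
  have semi: "seminorm_on_Rn n N" using N by (simp add: norm_on_Rn_iff)
  obtain c where c: "c > 0" "\<And>v. v \<in> Rn n \<Longrightarrow> c * l1norm n v \<le> N v"
    using norm_dominates_l1norm[OF N] by blast
  have "(\<lambda>k. min (N (\<lambda>i. g k i - g (Suc k) i)) 1) \<longlonglongrightarrow> 0" by (rule summable_LIMSEQ_zero[OF sum])
  then have ev: "eventually (\<lambda>k. min (N (\<lambda>i. g k i - g (Suc k) i)) 1 < 1) sequentially"
    by (rule order_tendstoD) simp
  have conv: "(\<lambda>k. g k i) \<longlonglongrightarrow> ?h i" for i
  proof (cases "i < n")
    case True
    have "summable (\<lambda>k. g (Suc k) i - g k i)"
    proof (rule summable_comparison_test_ev)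
      show "summable (\<lambda>k. inverse c * min (N (\<lambda>i. g k i - g (Suc k) i)) 1)"
        using sum by (rule summable_mult)
      show "eventually (\<lambda>k. norm (g (Suc k) i - g k i) \<le>
          inverse c * min (N (\<lambda>i. g k i - g (Suc k) i)) 1) sequentially"
        using ev
      proof eventually_elim
        case (elim k)
        have "c * \<bar>g (Suc k) i - g k i\<bar> \<le> c * l1norm n (\<lambda>i. g k i - g (Suc k) i)"
          using l1norm_coord[OF True, of "\<lambda>i. g k i - g (Suc k) i"] c(1)
          by (simp add: abs_minus_commute)
        also have "\<dots> \<le> N (\<lambda>i. g k i - g (Suc k) i)" by (intro c Rn_diff g)
        finally show ?case using elim c(1) by (simp add: field_simps)
      qed
    qed
    then show ?thesis by (rule convergent_of_summable_steps[unfolded convergent_LIMSEQ_iff])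
  next
    case False
    then have "g k i = 0" for k using g by (simp add: Rn_iff)
    then show ?thesis by simp
  qed
  have h: "?h \<in> Rn n"
  proof -
    have "lim (\<lambda>j. g j i) = 0" if "n \<le> i" for i
    proof -
      have "(\<lambda>j. g j i) = (\<lambda>j. 0)" using g that by (simp add: Rn_iff)
      then show ?thesis by simp
    qed
    then show ?thesis by (simp add: Rn_iff)
  qed
  have "(\<lambda>k. \<Sum>i<n. \<bar>g k i - ?h i\<bar>) \<longlonglongrightarrow> (\<Sum>i<n. \<bar>?h i - ?h i\<bar>)"
    by (intro tendsto_intros conv)
  then have "(\<lambda>k. l1norm n (\<lambda>i. g k i - ?h i)) \<longlonglongrightarrow> 0" by (simp add: l1norm_def)
  then have lim: "(\<lambda>k. (\<Sum>i<n. N (unit_vec i)) * l1norm n (\<lambda>i. g k i - ?h i)) \<longlonglongrightarrow> 0"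
    by (rule tendsto_mult_right_zero)
  have diff: "(\<lambda>i. g k i - ?h i) \<in> Rn n" for k by (intro Rn_diff g h)
  show ?thesis
    by (rule tendsto_sandwich[OF _ _ tendsto_const lim])
      (auto intro!: always_eventually seminorm_nonneg[OF semi] seminorm_le_l1norm[OF semi] diff)
qed

context mm_space
begin

lemma equiv_prob_facts:
  assumes "equiv_prob m'"
  shows "prob_space m'" "sets m' = sets borel" "measurable m' N = measurable borel N"
    "space m' = UNIV"
proof -
  show "prob_space m'" and s: "sets m' = sets borel" using assms by (simp_all add: equiv_prob_def)
  then show "measurable m' N = measurable borel N" by (intro measurable_cong_sets) simp_all
  show "space m' = UNIV" using sets_eq_imp_space_eq[OF s] by simp
qed

lemma integrable_min:
  fixes f :: "'x \<Rightarrow> real"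
  assumes m': "equiv_prob m'" and f: "f \<in> borel_measurable m" "AE x in m. 0 \<le> f x"
  shows "integrable m' (\<lambda>x. min (f x) 1)"
proof -
  interpret prob_space m' using equiv_prob_facts(1)[OF m'] .
  have "(\<lambda>x. min (f x) 1) \<in> borel_measurable m'"
    using f(1) unfolding measurable_m equiv_prob_facts(3)[OF m']
    by (intro borel_measurable_min borel_measurable_const)
  moreover have "AE x in m'. norm (min (f x) 1) \<le> 1"
    using f(2) unfolding AE_equiv_prob[OF m'] by eventually_elim auto
  ultimately show ?thesis by (intro integrable_const_bound[where B = 1])
qed

lemma integral_min_eq_0_iff:
  fixes f :: "'x \<Rightarrow> real"
  assumes m': "equiv_prob m'" and f: "f \<in> borel_measurable m" "AE x in m. 0 \<le> f x"
  shows "(\<integral>x. min (f x) 1 \<partial>m') = 0 \<longleftrightarrow> (AE x in m. f x = 0)"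
proof -
  have nn: "AE x in m'. 0 \<le> min (f x) 1"
    using f(2) unfolding AE_equiv_prob[OF m'] by eventually_elim simp
  have "(\<integral>x. min (f x) 1 \<partial>m') = 0 \<longleftrightarrow> (AE x in m. min (f x) 1 = 0)"
    using integral_nonneg_eq_0_iff_AE[OF integrable_min[OF assms] nn]
    by (simp only: AE_equiv_prob[OF m'])
  also have "\<dots> \<longleftrightarrow> (AE x in m. f x = 0)"
    by (rule AE_cong) (simp add: min_def)
  finally show ?thesis .
qed

context
  fixes T assumes T: "is_mbb m T"
begin

lemma section_dist:
  assumes m': "equiv_prob m'" and f: "f \<in> msec T" and g: "g \<in> msec T"
  shows "nmod_dist m' (section_module m T) (sec_class m T f :: ('x, 'u) melem) (sec_class m T g) =
    (\<integral>x. min (bnorm T (x, \<lambda>i. f x i - g x i)) 1 \<partial>m')"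
proof -
  let ?h = "\<lambda>x. bnorm T (x, \<lambda>i. f x i - g x i)"
  have h: "?h \<in> borel_measurable m"
    using bnorm_measurable[OF T msec_diff[OF T f g]] by (simp add: measurable_m)
  have r: "rep (L0_class m ?h) \<in> borel_measurable m"
    by (intro rep_L0_measurable L0_class_in h)
  have "(\<integral>x. min (rep (L0_class m ?h) x) 1 \<partial>m') = (\<integral>x. min (?h x) 1 \<partial>m')"
  proof (rule integral_cong_AE)
    show "AE x in m'. min (rep (L0_class m ?h) x) 1 = min (?h x) 1"
      using AE_rep_L0_class[OF h] unfolding AE_equiv_prob[OF m'] by eventually_elim simp
  qed (use h r in \<open>auto simp: measurable_m equiv_prob_facts[OF m'] intro!: borel_measurable_min\<close>)
  then show ?thesis
    unfolding nmod_dist_def by (simp add: section_minus section_pnorm msec_diff T f g sec_class_in)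
qed

lemma section_Metric_space:
  assumes m': "equiv_prob m'"
  shows "Metric_space (carrier (section_module m T))
    (nmod_dist m' (section_module m T :: ('x, ('x, 'u) melem) L0_nmodule))" (is "Metric_space ?C ?d")
proof
  have meas: "(\<lambda>x. bnorm T (x, \<lambda>i. f x i - g x i)) \<in> borel_measurable m"
    if "f \<in> msec T" "g \<in> msec T" for f g
    using bnorm_measurable[OF T msec_diff[OF T that]] by (simp add: measurable_m)
  have nn: "0 \<le> bnorm T (x, \<lambda>i. f x i - g x i)" if "f \<in> msec T" "g \<in> msec T" for f g x
    by (intro bnorm_nonneg[OF T] Rn_diff msec_Rn[OF T] that)
  have out: "?d S S' = 0" if "S \<notin> ?C \<or> S' \<notin> ?C" for S S'
    using that by (auto simp: nmod_dist_def)
  show "0 \<le> ?d S S'" for S S'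
  proof (cases "S \<in> ?C \<and> S' \<in> ?C")
    case True
    then obtain f g where f: "f \<in> msec T" "S = sec_class m T f" and g: "g \<in> msec T" "S' = sec_class m T g"
      by (auto elim!: section_cases[OF T])
    show ?thesis unfolding f(2) g(2) section_dist[OF m' f(1) g(1)]
      by (rule integral_nonneg_AE) (auto simp: nn f g)
  qed (use out in auto)
  show "?d S S' = ?d S' S" for S S'
  proof (cases "S \<in> ?C \<and> S' \<in> ?C")
    case True
    then obtain f g where f: "f \<in> msec T" "S = sec_class m T f" and g: "g \<in> msec T" "S' = sec_class m T g"
      by (auto elim!: section_cases[OF T])
    show ?thesis unfolding f(2) g(2) section_dist[OF m' f(1) g(1)] section_dist[OF m' g(1) f(1)]
    proof (rule integral_cong_AE)
      show "AE x in m'. min (bnorm T (x, \<lambda>i. f x i - g x i)) 1 = min (bnorm T (x, \<lambda>i. g x i - f x i)) 1"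
        using AE_seminorm[OF T] unfolding AE_equiv_prob[OF m']
      proof eventually_elim
        case (elim x)
        show ?case by (simp only: seminorm_minus[OF elim msec_Rn[OF T f(1)] msec_Rn[OF T g(1)]])
      qed
    qed (use meas f g in \<open>auto simp: measurable_m equiv_prob_facts[OF m'] intro!: borel_measurable_min\<close>)
  next
    case False
    then show ?thesis using out[of S S'] out[of S' S] by auto
  qed
  fix S S' S'' assume S: "S \<in> ?C" "S' \<in> ?C"
  obtain f where f: "f \<in> msec T" "S = sec_class m T f" using S(1) by (rule section_cases[OF T])
  obtain g where g: "g \<in> msec T" "S' = sec_class m T g" using S(2) by (rule section_cases[OF T])
  have "?d S S' = 0 \<longleftrightarrow> (AE x in m. bnorm T (x, \<lambda>i. f x i - g x i) = 0)"
    unfolding f(2) g(2) section_dist[OF m' f(1) g(1)]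
    by (rule integral_min_eq_0_iff[OF m' meas[OF f(1) g(1)]]) (simp add: nn f g)
  also have "\<dots> \<longleftrightarrow> (AE x in m. f x = g x)"
  proof (rule eventually_subst)
    show "AE x in m. (bnorm T (x, \<lambda>i. f x i - g x i) = 0) = (f x = g x)"
      using AE_norm[OF T]
    proof eventually_elim
      case (elim x)
      have "(\<lambda>i. f x i - g x i) \<in> Rn (bdim T x)" by (intro Rn_diff msec_Rn[OF T] f g)
      then have "bnorm T (x, \<lambda>i. f x i - g x i) = 0 \<longleftrightarrow> (\<lambda>i. f x i - g x i) = (\<lambda>i. 0)"
        using elim unfolding norm_on_Rn_def by blast
      then show ?case by (simp add: fun_eq_iff)
    qed
  qed
  also have "\<dots> \<longleftrightarrow> S = S'" unfolding f(2) g(2) by (rule sec_class_eq_iff[OF T f(1) g(1), symmetric])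
  finally show "?d S S' = 0 \<longleftrightarrow> S = S'" .
  assume "S'' \<in> ?C"
  then obtain h where h: "h \<in> msec T" "S'' = sec_class m T h" by (rule section_cases[OF T])
  let ?N = "\<lambda>f g x. min (bnorm T (x, \<lambda>i. f x i - g x i)) 1"
  have int: "integrable m' (?N f g)" if "f \<in> msec T" "g \<in> msec T" for f g
    by (intro integrable_min[OF m'] meas that) (simp add: nn that)
  have "(\<integral>x. ?N f h x \<partial>m') \<le> (\<integral>x. ?N f g x + ?N g h x \<partial>m')"
  proof (rule integral_mono_AE)
    show "AE x in m'. ?N f h x \<le> ?N f g x + ?N g h x"
      using AE_seminorm[OF T] unfolding AE_equiv_prob[OF m']
    proof eventually_elim
      case (elim x)
      have "bnorm T (x, \<lambda>i. f x i - h x i) \<le> bnorm T (x, \<lambda>i. f x i - g x i) + bnorm T (x, \<lambda>i. g x i - h x i)"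
        by (intro seminorm_triangle_diff[OF elim] msec_Rn[OF T] f g h)
      then show ?case using nn[OF f(1) g(1), of x] nn[OF g(1) h(1), of x] by (auto simp: min_def)
    qed
  qed (intro int f g h Bochner_Integration.integrable_add)+
  also have "\<dots> = (\<integral>x. ?N f g x \<partial>m') + (\<integral>x. ?N g h x \<partial>m')"
    by (intro Bochner_Integration.integral_add int f g h)
  finally show "?d S S'' \<le> ?d S S' + ?d S' S''"
    unfolding f(2) g(2) h(2) section_dist[OF m' f(1) g(1)] section_dist[OF m' f(1) h(1)]
      section_dist[OF m' g(1) h(1)] .
qed

text \<open>Along a fast Cauchy sequence the truncated norms of the steps are summable at almost
  every point, so the sections converge fibrewise there. Dominated convergence, with the bound 1
  coming from the truncation, turns this into convergence in the distance.\<close>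

lemma section_mcomplete:
  assumes m': "equiv_prob m'"
  shows "Metric_space.mcomplete (carrier (section_module m T))
    (nmod_dist m' (section_module m T :: ('x, ('x, 'u) melem) L0_nmodule))" 
proof -
  let ?\<Gamma> = "section_module m T :: ('x, ('x, 'u) melem) L0_nmodule"
  interpret Metric_space "carrier ?\<Gamma>" "nmod_dist m' ?\<Gamma>" by (rule section_Metric_space[OF m'])
  show ?thesis
  proof (rule mcompleteI_fast)
    fix \<sigma> assume cauchy: "MCauchy \<sigma>"
      and fast: "\<And>k. nmod_dist m' ?\<Gamma> (\<sigma> k) (\<sigma> (Suc k)) < (1 / 2) ^ k"
    define g where "g k = srep (\<sigma> k)" for k
    have \<sigma>: "\<sigma> k \<in> carrier ?\<Gamma>" for k using cauchy by (auto simp: MCauchy_def)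
    have g: "g k \<in> msec T" "\<sigma> k = sec_class m T (g k)" for k
      unfolding g_def using srep_in[OF T \<sigma>] sec_class_srep[OF T \<sigma>] by auto
    \<comment> \<open>\<open>lim\<close> is total, so \<open>h\<close> is measurable without
      removing the null set where the coordinates diverge, and it still vanishes beyond the
      dimension of the fibre.\<close>
    define h where "h x i = lim (\<lambda>k. g k x i)" for x i
    have h: "h \<in> msec T"
      unfolding msec_iff[OF T] h_def
    proof (intro conjI allI impI)
      show "(\<lambda>x. lim (\<lambda>k. g k x i)) \<in> borel_measurable borel" for i
        by (intro borel_measurable_lim_metric msec_measurable[OF T] g)
      show "lim (\<lambda>k. g k x i) = 0" if "bdim T x \<le> i" for x i
      proof -
        have "(\<lambda>k. g k x i) = (\<lambda>k. 0)" using g(1) that by (simp add: msec_iff[OF T])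
        then show ?thesis by simp
      qed
    qed
    let ?N = "\<lambda>f g x. min (bnorm T (x, \<lambda>i. f x i - g x i)) 1"
    have nn: "0 \<le> bnorm T (x, \<lambda>i. f x i - g x i)" if "f \<in> msec T" "g \<in> msec T" for f g x
      by (intro bnorm_nonneg[OF T] Rn_diff msec_Rn[OF T] that)
    have int: "integrable m' (?N f g)" if "f \<in> msec T" "g \<in> msec T" for f g
      using bnorm_measurable[OF T msec_diff[OF T that]]
      by (intro integrable_min[OF m']) (simp_all add: nn that measurable_m)
    have "AE x in m'. summable (\<lambda>k. ?N (g k) (g (Suc k)) x)"
    proof (rule AE_summable_of_integrals)
      show "(\<integral>x. ?N (g k) (g (Suc k)) x \<partial>m') \<le> (1 / 2) ^ k" for k
        using fast[of k] unfolding g(2) section_dist[OF m' g(1) g(1)] by simp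
      show "summable (\<lambda>k. (1 / 2 :: real) ^ k)" by simp
    qed (auto intro!: int g simp: nn g)
    then have "AE x in m. summable (\<lambda>k. ?N (g k) (g (Suc k)) x)" by (simp only: AE_equiv_prob[OF m'])
    then have "AE x in m. (\<lambda>k. bnorm T (x, \<lambda>i. g k x i - h x i)) \<longlonglongrightarrow> 0"
      using AE_norm[OF T] unfolding h_def
      by eventually_elim (rule norm_on_Rn_cauchy_limit, auto intro: msec_Rn[OF T g(1)])
    then have lim: "AE x in m'. (\<lambda>k. ?N (g k) h x) \<longlonglongrightarrow> 0"
      unfolding AE_equiv_prob[OF m']
    proof eventually_elim
      case (elim x)
      from tendsto_min[OF elim tendsto_const[of 1]] show ?case by simp
    qed
    have "(\<lambda>k. \<integral>x. ?N (g k) h x \<partial>m') \<longlonglongrightarrow> (\<integral>x. 0 \<partial>m')"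
    proof (rule integral_dominated_convergence[where w = "\<lambda>_. 1", OF _ _ _ lim])
      interpret prob_space m' using equiv_prob_facts(1)[OF m'] .
      show "integrable m' (\<lambda>_. 1 :: real)" by simp
      show "?N (g k) h \<in> borel_measurable m'" for k using int[OF g(1) h] by auto
      show "AE x in m'. norm (?N (g k) h x) \<le> 1" for k using nn[OF g(1) h] by auto
    qed simp
    then have "(\<lambda>k. nmod_dist m' ?\<Gamma> (\<sigma> k) (sec_class m T h)) \<longlonglongrightarrow> 0"
      unfolding g(2) section_dist[OF m' g(1) h] by simp
    then have "limitin mtopology \<sigma> (sec_class m T h) sequentially"
      unfolding limit_metric_sequentially using \<sigma> sec_class_in[OF T h] nonneg
      by (auto simp: lim_sequentially dist_real_def)
    then show "\<exists>a. limitin mtopology \<sigma> a sequentially" ..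
  qed
qed

lemma normed_section_module: "normed_L0_module m (section_module m T :: ('x, ('x, 'u) melem) L0_nmodule)"
proof -
  let ?\<Gamma> = "section_module m T :: ('x, ('x, 'u) melem) L0_nmodule"
  have b: "(\<lambda>x. bnorm T (x, f x)) \<in> borel_measurable m" if "f \<in> msec T" for f
    using bnorm_measurable[OF T that] by (simp add: measurable_m)
  show ?thesis
    unfolding normed_L0_module_def
  proof (intro conjI ballI)
    show "Module.module (L0 m) ?\<Gamma>" by (rule module_section[OF T])
    show "pnorm ?\<Gamma> \<in> carrier ?\<Gamma> \<rightarrow> carrier (L0 m)"
      by (auto elim!: section_cases[OF T] simp: section_pnorm[OF T] intro!: L0_class_in b)
    obtain m' where m': "equiv_prob m'" using ex_equiv_prob by blast
    then show "\<exists>m'. prob_space m' \<and> sets m' = sets borel \<and>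
       absolutely_continuous m m' \<and> absolutely_continuous m' m \<and>
       Metric_space (carrier ?\<Gamma>) (nmod_dist m' ?\<Gamma>) \<and>
       Metric_space.mcomplete (carrier ?\<Gamma>) (nmod_dist m' ?\<Gamma>)"
      using section_Metric_space[OF m'] section_mcomplete[OF m'] unfolding equiv_prob_def by blast
  next
    fix S assume "S \<in> carrier ?\<Gamma>"
    then obtain s where s: "s \<in> msec T" "S = sec_class m T s" by (rule section_cases[OF T])
    show "L0_le m \<zero>\<^bsub>L0 m\<^esub> (pnorm ?\<Gamma> S)"
      unfolding s(2) section_pnorm[OF T s(1)] L0_sel
      using bnorm_nonneg[OF T msec_Rn[OF T s(1)]] by (subst L0_le_class) (auto intro: b s)
    fix F assume "F \<in> carrier (L0 m)"
    then obtain f where f: "f \<in> borel_measurable m" "F = L0_class m f" by (rule L0_cases)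
    have abs: "(\<lambda>x. \<bar>f x\<bar>) \<in> borel_measurable m" using f(1) by (rule borel_measurable_abs)
    have "pnorm ?\<Gamma> (F \<odot>\<^bsub>?\<Gamma>\<^esub> S) = L0_class m (\<lambda>x. bnorm T (x, \<lambda>i. f x * s x i))"
      unfolding s(2) f(2) section_smult[OF T f(1) s(1)] by (rule section_pnorm[OF T msec_scale[OF T f(1) s(1)]])
    also have "\<dots> = L0_class m (\<lambda>x. \<bar>f x\<bar> * bnorm T (x, s x))"
    proof (rule L0_class_cong)
      show "AE x in m. bnorm T (x, \<lambda>i. f x * s x i) = \<bar>f x\<bar> * bnorm T (x, s x)"
        using AE_seminorm[OF T]
      proof eventually_elim
        case (elim x)
        show ?case by (rule seminorm_scale[OF elim msec_Rn[OF T s(1)]])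
      qed
    qed (intro b msec_scale[OF T] borel_measurable_times abs f s)+
    also have "\<dots> = L0_abs m F \<otimes>\<^bsub>L0 m\<^esub> pnorm ?\<Gamma> S"
      unfolding s(2) f(2) section_pnorm[OF T s(1)] L0_abs_class[OF f(1)] L0_mult[OF abs b[OF s(1)]] ..
    finally show "pnorm ?\<Gamma> (F \<odot>\<^bsub>?\<Gamma>\<^esub> S) = L0_abs m F \<otimes>\<^bsub>L0 m\<^esub> pnorm ?\<Gamma> S" .
  qed
qed

end

end

section \<open>Local bases\<close>

text \<open>\<open>finsum\<close> refers to the carrier, so the sums of a restricted module are not
  by definition those of the whole module.\<close>

lemma finsum_carrier_update:
  assumes M: "abelian_monoid M" and H: "abelian_monoid (M\<lparr>carrier := H\<rparr>)" and sub: "H \<subseteq> carrier M"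
    and A: "finite A" and f: "f \<in> A \<rightarrow> H"
  shows "finsum (M\<lparr>carrier := H\<rparr>) f A = finsum M f A"
  using A f
proof (induction A rule: finite_induct)
  case empty
  show ?case by (simp add: abelian_monoid.finsum_empty[OF M] abelian_monoid.finsum_empty[OF H])
next
  case (insert a A)
  have "finsum (M\<lparr>carrier := H\<rparr>) f (insert a A) = f a \<oplus>\<^bsub>M\<^esub> finsum (M\<lparr>carrier := H\<rparr>) f A"
    using insert by (subst abelian_monoid.finsum_insert[OF H]) auto
  also have "\<dots> = f a \<oplus>\<^bsub>M\<^esub> finsum M f A" using insert by simp
  also have "\<dots> = finsum M f (insert a A)"
    using insert sub by (subst abelian_monoid.finsum_insert[OF M]) auto
  finally show ?case .
qed

lemma chi_in: "A \<in> sets m \<Longrightarrow> chi m A \<in> carrier (L0 m)"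
  unfolding chi_def by (intro L0_class_in borel_measurable_indicator)

lemma chi_mult_class:
  assumes "A \<in> sets m" "f \<in> borel_measurable m"
  shows "chi m A \<otimes>\<^bsub>L0 m\<^esub> L0_class m f = L0_class m (\<lambda>x. indicator A x * f x)"
  unfolding chi_def by (intro L0_mult borel_measurable_indicator assms)

lemma chi_idem: "A \<in> sets m \<Longrightarrow> chi m A \<otimes>\<^bsub>L0 m\<^esub> chi m A = chi m A"
  using chi_mult_class[of A m "indicator A"]
  by (simp add: chi_def borel_measurable_indicator indicator_inter_arith[symmetric])

lemma chi_disjoint:
  assumes "A \<in> sets m" "B \<in> sets m" "A \<inter> B = {}"
  shows "chi m A \<otimes>\<^bsub>L0 m\<^esub> chi m B = \<zero>\<^bsub>L0 m\<^esub>"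
  using chi_mult_class[OF assms(1), of "indicator B"] assms
  by (simp add: chi_def borel_measurable_indicator indicator_inter_arith[symmetric] L0_sel(3))

text \<open>Coefficients are functions rather than classes, so that pointwise statements about them
  make sense; only those of index below \<open>n\<close> count.\<close>

definition lincomb :: "'x measure \<Rightarrow> (('x \<Rightarrow> real) set, 'v, 'z) module_scheme \<Rightarrow> nat \<Rightarrow>
    (nat \<Rightarrow> 'v) \<Rightarrow> ('x \<Rightarrow> nat \<Rightarrow> real) \<Rightarrow> 'v" where
  "lincomb m M n a f = (\<Oplus>\<^bsub>M\<^esub>i\<in>{..<n}. L0_class m (\<lambda>x. f x i) \<odot>\<^bsub>M\<^esub> a i)"

text \<open>Removes the restricted ring and module from the notion of a local basis. Since
  \<open>chi m A\<close> is idempotent and already a factor of every \<open>a i\<close>, multiplying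
  coefficients by it does not change a combination; so coefficients may be arbitrary measurable
  functions on the whole space, and their vanishing in the restricted ring means vanishing almost
  everywhere on \<open>A\<close>.\<close>

lemma local_basis_iff:
  assumes module: "Module.module (L0 m) M" and A: "A \<in> sets m" and b: "b \<in> {..<n} \<rightarrow> carrier M"
  defines "a \<equiv> \<lambda>i. chi m A \<odot>\<^bsub>M\<^esub> b i"
  shows "local_basis m M A n b \<longleftrightarrow>
    (\<forall>f. (\<forall>i. (\<lambda>x. f x i) \<in> borel_measurable m) \<longrightarrow> lincomb m M n a f = \<zero>\<^bsub>M\<^esub> \<longrightarrow>
      (\<forall>i<n. AE x in m. x \<in> A \<longrightarrow> f x i = 0)) \<and>
    (\<forall>w\<in>carrier M. \<exists>f. (\<forall>i. (\<lambda>x. f x i) \<in> borel_measurable m) \<and>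
      chi m A \<odot>\<^bsub>M\<^esub> w = lincomb m M n a f)"
proof -
  interpret module "L0 m" M by (rule module)
  let ?R = "L0 m" and ?e = "chi m A"
  have e: "?e \<in> carrier ?R" by (rule chi_in[OF A])
  have a: "a i \<in> carrier M" if "i < n" for i using b that e unfolding a_def by auto
  let ?H = "(\<lambda>v. ?e \<odot>\<^bsub>M\<^esub> v) ` carrier M"
  have H: "?H \<subseteq> carrier M" using e by auto
  have monoid: "abelian_monoid (mod_restrict m M A)"
  proof (rule abelian_monoidI)
    fix x y assume "x \<in> carrier (mod_restrict m M A)" "y \<in> carrier (mod_restrict m M A)"
    then obtain v w where "v \<in> carrier M" "x = ?e \<odot>\<^bsub>M\<^esub> v" "w \<in> carrier M" "y = ?e \<odot>\<^bsub>M\<^esub> w"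
      by (auto simp: mod_restrict_def)
    moreover from this have "x \<oplus>\<^bsub>M\<^esub> y = ?e \<odot>\<^bsub>M\<^esub> (v \<oplus>\<^bsub>M\<^esub> w)"
      using e by (simp add: smult_r_distr)
    ultimately show "x \<oplus>\<^bsub>mod_restrict m M A\<^esub> y \<in> carrier (mod_restrict m M A)"
      by (simp add: mod_restrict_def)
  next
    have "\<zero>\<^bsub>M\<^esub> = ?e \<odot>\<^bsub>M\<^esub> \<zero>\<^bsub>M\<^esub>" using e by simp
    then show "\<zero>\<^bsub>mod_restrict m M A\<^esub> \<in> carrier (mod_restrict m M A)"
      by (simp add: mod_restrict_def)
  qed (use H in \<open>auto simp: mod_restrict_def subset_iff M.a_ac\<close>)
  have sum_restrict: "(\<Oplus>\<^bsub>mod_restrict m M A\<^esub>i\<in>{..<n}. g i) = (\<Oplus>\<^bsub>M\<^esub>i\<in>{..<n}. g i)"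
    if "g \<in> {..<n} \<rightarrow> ?H" for g
    using finsum_carrier_update[OF M.abelian_monoid_axioms _ H _ that] monoid
    by (simp add: mod_restrict_def)
  have absorb: "(?e \<otimes>\<^bsub>?R\<^esub> F) \<odot>\<^bsub>M\<^esub> a i = F \<odot>\<^bsub>M\<^esub> a i" and
    in_H: "F \<odot>\<^bsub>M\<^esub> a i \<in> ?H" if "F \<in> carrier ?R" "i < n" for F i
  proof -
    have bi: "b i \<in> carrier M" using b that by auto
    have 1: "F \<odot>\<^bsub>M\<^esub> a i = ?e \<odot>\<^bsub>M\<^esub> (F \<odot>\<^bsub>M\<^esub> b i)"
      using that e bi by (simp add: a_def smult_assoc1[symmetric] R.m_comm)
    then show "F \<odot>\<^bsub>M\<^esub> a i \<in> ?H" using bi that by auto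
    have "(?e \<otimes>\<^bsub>?R\<^esub> F) \<odot>\<^bsub>M\<^esub> a i = ?e \<odot>\<^bsub>M\<^esub> (?e \<odot>\<^bsub>M\<^esub> (F \<odot>\<^bsub>M\<^esub> b i))"
      using that e bi a[OF that(2)] 1 by (simp add: smult_assoc1)
    also have "\<dots> = ?e \<odot>\<^bsub>M\<^esub> (F \<odot>\<^bsub>M\<^esub> b i)"
      using that e bi smult_assoc1[of ?e ?e "F \<odot>\<^bsub>M\<^esub> b i"] by (simp add: chi_idem[OF A])
    finally show "(?e \<otimes>\<^bsub>?R\<^esub> F) \<odot>\<^bsub>M\<^esub> a i = F \<odot>\<^bsub>M\<^esub> a i" using 1 by simp
  qed
  have sum_eq: "(\<Oplus>\<^bsub>mod_restrict m M A\<^esub>i\<in>{..<n}. (?e \<otimes>\<^bsub>?R\<^esub> F i) \<odot>\<^bsub>mod_restrict m M A\<^esub> a i) =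
      (\<Oplus>\<^bsub>M\<^esub>i\<in>{..<n}. F i \<odot>\<^bsub>M\<^esub> a i)" if F: "F \<in> {..<n} \<rightarrow> carrier ?R" for F
  proof -
    have "(\<Oplus>\<^bsub>mod_restrict m M A\<^esub>i\<in>{..<n}. (?e \<otimes>\<^bsub>?R\<^esub> F i) \<odot>\<^bsub>mod_restrict m M A\<^esub> a i) =
        (\<Oplus>\<^bsub>M\<^esub>i\<in>{..<n}. (?e \<otimes>\<^bsub>?R\<^esub> F i) \<odot>\<^bsub>M\<^esub> a i)"
    proof -
      have "(\<lambda>i. (?e \<otimes>\<^bsub>?R\<^esub> F i) \<odot>\<^bsub>M\<^esub> a i) \<in> {..<n} \<rightarrow> ?H"
        using F e by (intro Pi_I in_H) auto
      from sum_restrict[OF this] show ?thesis by (simp add: mod_restrict_def)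
    qed
    also have "\<dots> = (\<Oplus>\<^bsub>M\<^esub>i\<in>{..<n}. F i \<odot>\<^bsub>M\<^esub> a i)"
      using F a by (intro M.finsum_cong') (auto simp: absorb Pi_def)
    finally show ?thesis .
  qed
  have class_in: "(\<lambda>i. L0_class m (\<lambda>x. f x i)) \<in> {..<n} \<rightarrow> carrier ?R"
    if "\<forall>i. (\<lambda>x. f x i) \<in> borel_measurable m" for f :: "_ \<Rightarrow> nat \<Rightarrow> real"
    using that by (auto intro: L0_class_in)
  have zero_iff: "?e \<otimes>\<^bsub>?R\<^esub> L0_class m g = \<zero>\<^bsub>?R\<^esub> \<longleftrightarrow> (AE x in m. x \<in> A \<longrightarrow> g x = 0)"
    if "g \<in> borel_measurable m" for g
  proof -
    have "?e \<otimes>\<^bsub>?R\<^esub> L0_class m g = \<zero>\<^bsub>?R\<^esub> \<longleftrightarrow> (AE x in m. indicator A x * g x = 0)"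
      unfolding chi_mult_class[OF A that] L0_sel(3)
      using A that by (intro L0_class_eq_iff borel_measurable_times borel_measurable_indicator) auto
    also have "\<dots> \<longleftrightarrow> (AE x in m. x \<in> A \<longrightarrow> g x = 0)"
      by (rule AE_cong) (auto simp: indicator_def)
    finally show ?thesis .
  qed
  have repr: "\<exists>f. (\<forall>i. (\<lambda>x. f x i) \<in> borel_measurable m) \<and> (\<forall>i<n. L0_class m (\<lambda>x. f x i) = F i)"
    if F: "F \<in> {..<n} \<rightarrow> carrier ?R" for F
  proof (intro exI[of _ "\<lambda>x i. if i < n then rep (F i) x else 0"] conjI allI impI)
    fix i
    show "(\<lambda>x. if i < n then rep (F i) x else 0) \<in> borel_measurable m"
      using F by (cases "i < n") (auto intro!: rep_L0_measurable)
    show "L0_class m (\<lambda>x. if i < n then rep (F i) x else 0) = F i" if "i < n"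
      using F that L0_class_rep[of "F i" m] by auto
  qed
  have c_repr: "\<exists>F\<in>{..<n} \<rightarrow> carrier ?R. \<forall>i<n. c i = ?e \<otimes>\<^bsub>?R\<^esub> F i"
    if c: "c \<in> {..<n} \<rightarrow> carrier (L0_restrict m A)" for c
  proof -
    have "\<forall>i. \<exists>F. i < n \<longrightarrow> F \<in> carrier ?R \<and> c i = ?e \<otimes>\<^bsub>?R\<^esub> F"
      using c by (auto simp: L0_restrict_def Pi_def)
    then obtain F where "\<And>i. i < n \<Longrightarrow> F i \<in> carrier ?R \<and> c i = ?e \<otimes>\<^bsub>?R\<^esub> F i" by metis
    then show ?thesis by (intro bexI[of _ F]) auto
  qed
  have sum_c: "(\<Oplus>\<^bsub>mod_restrict m M A\<^esub>i\<in>{..<n}. c i \<odot>\<^bsub>mod_restrict m M A\<^esub> a i) =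
      (\<Oplus>\<^bsub>M\<^esub>i\<in>{..<n}. F i \<odot>\<^bsub>M\<^esub> a i)"
    if F: "F \<in> {..<n} \<rightarrow> carrier ?R" and c: "\<forall>i<n. c i = ?e \<otimes>\<^bsub>?R\<^esub> F i" for c F
  proof -
    have "(\<Oplus>\<^bsub>mod_restrict m M A\<^esub>i\<in>{..<n}. c i \<odot>\<^bsub>mod_restrict m M A\<^esub> a i) =
        (\<Oplus>\<^bsub>mod_restrict m M A\<^esub>i\<in>{..<n}. (?e \<otimes>\<^bsub>?R\<^esub> F i) \<odot>\<^bsub>mod_restrict m M A\<^esub> a i)"
    proof (intro abelian_monoid.finsum_cong'[OF monoid] refl Pi_I)
      fix i assume i: "i \<in> {..<n}"
      then show "c i \<odot>\<^bsub>mod_restrict m M A\<^esub> a i = (?e \<otimes>\<^bsub>?R\<^esub> F i) \<odot>\<^bsub>mod_restrict m M A\<^esub> a i"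
        using c by simp
      have "(?e \<otimes>\<^bsub>?R\<^esub> F i) \<odot>\<^bsub>M\<^esub> a i \<in> ?H" using i F e by (intro in_H) auto
      then show "(?e \<otimes>\<^bsub>?R\<^esub> F i) \<odot>\<^bsub>mod_restrict m M A\<^esub> a i \<in> carrier (mod_restrict m M A)"
        by (simp add: mod_restrict_def)
    qed
    then show ?thesis using sum_eq[OF F] by simp
  qed
  have lin: "lincomb m M n a f = (\<Oplus>\<^bsub>M\<^esub>i\<in>{..<n}. F i \<odot>\<^bsub>M\<^esub> a i)"
    if F: "F \<in> {..<n} \<rightarrow> carrier ?R" and f: "\<forall>i<n. L0_class m (\<lambda>x. f x i) = F i" for F f
    unfolding lincomb_def using F f a by (intro M.finsum_cong') (auto simp: Pi_def)
  let ?indep = "\<forall>c \<in> {..<n} \<rightarrow> carrier (L0_restrict m A).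
       (\<Oplus>\<^bsub>mod_restrict m M A\<^esub>i\<in>{..<n}. c i \<odot>\<^bsub>mod_restrict m M A\<^esub> a i) = \<zero>\<^bsub>mod_restrict m M A\<^esub> \<longrightarrow>
         (\<forall>i<n. c i = \<zero>\<^bsub>L0_restrict m A\<^esub>)"
  let ?span = "\<forall>w \<in> carrier (mod_restrict m M A). \<exists>c \<in> {..<n} \<rightarrow> carrier (L0_restrict m A).
      w = (\<Oplus>\<^bsub>mod_restrict m M A\<^esub>i\<in>{..<n}. c i \<odot>\<^bsub>mod_restrict m M A\<^esub> a i)"
  have zeros: "\<zero>\<^bsub>mod_restrict m M A\<^esub> = \<zero>\<^bsub>M\<^esub>" "\<zero>\<^bsub>L0_restrict m A\<^esub> = \<zero>\<^bsub>?R\<^esub>"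
    by (simp_all add: mod_restrict_def L0_restrict_def)
  have "local_basis m M A n b \<longleftrightarrow> ?indep \<and> ?span"
  proof -
    have "a \<in> {..<n} \<rightarrow> carrier (mod_restrict m M A)"
      using b by (auto simp: a_def mod_restrict_def)
    then show ?thesis using b unfolding local_basis_def module_basis_def a_def[symmetric] by simp
  qed
  also have "?indep \<longleftrightarrow> (\<forall>f. (\<forall>i. (\<lambda>x. f x i) \<in> borel_measurable m) \<longrightarrow>
      lincomb m M n a f = \<zero>\<^bsub>M\<^esub> \<longrightarrow> (\<forall>i<n. AE x in m. x \<in> A \<longrightarrow> f x i = 0))"
  proof (intro iffI allI impI ballI)
    fix f i assume indep: ?indep and f: "\<forall>i. (\<lambda>x. f x i) \<in> borel_measurable m"
      and 0: "lincomb m M n a f = \<zero>\<^bsub>M\<^esub>" and i: "i < n"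
    let ?c = "\<lambda>i. ?e \<otimes>\<^bsub>?R\<^esub> L0_class m (\<lambda>x. f x i)"
    have c: "?c \<in> {..<n} \<rightarrow> carrier (L0_restrict m A)"
      using f by (auto simp: L0_restrict_def intro!: imageI L0_class_in)
    have "(\<Oplus>\<^bsub>mod_restrict m M A\<^esub>i\<in>{..<n}. ?c i \<odot>\<^bsub>mod_restrict m M A\<^esub> a i) = \<zero>\<^bsub>M\<^esub>"
      using sum_eq[OF class_in[OF f]] 0 unfolding lincomb_def by simp
    with bspec[OF indep c] i have "?c i = \<zero>\<^bsub>?R\<^esub>" unfolding zeros by simp
    then show "AE x in m. x \<in> A \<longrightarrow> f x i = 0" using zero_iff f by simp
  next
    fix c i assume indep: "\<forall>f. (\<forall>i. (\<lambda>x. f x i) \<in> borel_measurable m) \<longrightarrow>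
        lincomb m M n a f = \<zero>\<^bsub>M\<^esub> \<longrightarrow> (\<forall>i<n. AE x in m. x \<in> A \<longrightarrow> f x i = 0)"
      and c: "c \<in> {..<n} \<rightarrow> carrier (L0_restrict m A)"
      and 0: "(\<Oplus>\<^bsub>mod_restrict m M A\<^esub>i\<in>{..<n}. c i \<odot>\<^bsub>mod_restrict m M A\<^esub> a i) = \<zero>\<^bsub>mod_restrict m M A\<^esub>"
      and i: "i < n"
    obtain F where F: "F \<in> {..<n} \<rightarrow> carrier ?R" "\<forall>i<n. c i = ?e \<otimes>\<^bsub>?R\<^esub> F i"
      using c_repr[OF c] by blast
    obtain f where f: "\<forall>i. (\<lambda>x. f x i) \<in> borel_measurable m" "\<forall>i<n. L0_class m (\<lambda>x. f x i) = F i"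
      using repr[OF F(1)] by blast
    have "lincomb m M n a f = \<zero>\<^bsub>M\<^esub>" using lin[OF F(1) f(2)] sum_c[OF F] 0 zeros by simp
    then have "AE x in m. x \<in> A \<longrightarrow> f x i = 0" using indep f(1) i by blast
    then have "?e \<otimes>\<^bsub>?R\<^esub> L0_class m (\<lambda>x. f x i) = \<zero>\<^bsub>?R\<^esub>" using zero_iff f(1) by simp
    then show "c i = \<zero>\<^bsub>L0_restrict m A\<^esub>" using F(2) f(2) i zeros by simp
  qed
  also have "?span \<longleftrightarrow> (\<forall>w\<in>carrier M. \<exists>f. (\<forall>i. (\<lambda>x. f x i) \<in> borel_measurable m) \<and>
      ?e \<odot>\<^bsub>M\<^esub> w = lincomb m M n a f)"
  proof (intro iffI ballI)
    fix w assume span: ?span and w: "w \<in> carrier M"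
    have "?e \<odot>\<^bsub>M\<^esub> w \<in> carrier (mod_restrict m M A)" using w by (simp add: mod_restrict_def)
    then obtain c where c: "c \<in> {..<n} \<rightarrow> carrier (L0_restrict m A)"
      "?e \<odot>\<^bsub>M\<^esub> w = (\<Oplus>\<^bsub>mod_restrict m M A\<^esub>i\<in>{..<n}. c i \<odot>\<^bsub>mod_restrict m M A\<^esub> a i)"
      using span by blast
    obtain F where F: "F \<in> {..<n} \<rightarrow> carrier ?R" "\<forall>i<n. c i = ?e \<otimes>\<^bsub>?R\<^esub> F i"
      using c_repr[OF c(1)] by blast
    obtain f where f: "\<forall>i. (\<lambda>x. f x i) \<in> borel_measurable m" "\<forall>i<n. L0_class m (\<lambda>x. f x i) = F i"
      using repr[OF F(1)] by blast
    have "?e \<odot>\<^bsub>M\<^esub> w = lincomb m M n a f" using lin[OF F(1) f(2)] sum_c[OF F] c(2) by simp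
    then show "\<exists>f. (\<forall>i. (\<lambda>x. f x i) \<in> borel_measurable m) \<and> ?e \<odot>\<^bsub>M\<^esub> w = lincomb m M n a f"
      using f(1) by blast
  next
    fix w assume span: "\<forall>w\<in>carrier M. \<exists>f. (\<forall>i. (\<lambda>x. f x i) \<in> borel_measurable m) \<and>
        ?e \<odot>\<^bsub>M\<^esub> w = lincomb m M n a f"
      and "w \<in> carrier (mod_restrict m M A)"
    then obtain v where v: "v \<in> carrier M" "w = ?e \<odot>\<^bsub>M\<^esub> v" by (auto simp: mod_restrict_def)
    obtain f where f: "\<forall>i. (\<lambda>x. f x i) \<in> borel_measurable m" "?e \<odot>\<^bsub>M\<^esub> v = lincomb m M n a f"
      using span v(1) by blast
    let ?c = "\<lambda>i. ?e \<otimes>\<^bsub>?R\<^esub> L0_class m (\<lambda>x. f x i)"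
    have "?c \<in> {..<n} \<rightarrow> carrier (L0_restrict m A)"
      using f(1) by (auto simp: L0_restrict_def intro!: imageI L0_class_in)
    moreover have "w = (\<Oplus>\<^bsub>mod_restrict m M A\<^esub>i\<in>{..<n}. ?c i \<odot>\<^bsub>mod_restrict m M A\<^esub> a i)"
      using sum_eq[OF class_in[OF f(1)]] f(2) v(2) unfolding lincomb_def by simp
    ultimately show "\<exists>c \<in> {..<n} \<rightarrow> carrier (L0_restrict m A).
        w = (\<Oplus>\<^bsub>mod_restrict m M A\<^esub>i\<in>{..<n}. c i \<odot>\<^bsub>mod_restrict m M A\<^esub> a i)"
      by (intro bexI[where x = ?c])
  qed
  finally show ?thesis .
qed

context mm_space
begin

context
  fixes T assumes T: "is_mbb m T"
begin

text \<open>The coordinate sections. The value 0 over fibres of dimension at most \<open>i\<close>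
  makes each one a section over the whole base, so one sequence serves all parts.\<close>

definition frame :: "nat \<Rightarrow> 'x \<Rightarrow> nat \<Rightarrow> real" where
  "frame i x = (if i < bdim T x then unit_vec i else (\<lambda>_. 0))"

lemma frame_msec: "frame i \<in> msec T"
  unfolding msec_iff[OF T]
proof (intro conjI allI impI)
  fix j
  have [measurable]: "bdim T \<in> borel \<rightarrow>\<^sub>M count_space UNIV" by (rule bdim_measurable[OF T])
  have "(\<lambda>x. if i < bdim T x then unit_vec i j else 0) \<in> borel_measurable borel" by measurable
  then show "(\<lambda>x. frame i x j) \<in> borel_measurable borel"
    by (simp add: frame_def if_distrib[of "\<lambda>f. f j"])
qed (auto simp: frame_def unit_vec_def)

lemma frame_expand:
  assumes "f \<in> msec T" shows "(\<lambda>j. \<Sum>i<bdim T x. f x i * frame i x j) = f x"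
  using Rn_expand[OF msec_Rn[OF T assms, of x]] by (simp add: frame_def)

lemma section_finsum:
  assumes "finite A" "\<And>i. i \<in> A \<Longrightarrow> c i \<in> borel_measurable m" "\<And>i. i \<in> A \<Longrightarrow> f i \<in> msec T"
  shows "(\<Oplus>\<^bsub>section_module m T\<^esub>i\<in>A. L0_class m (c i) \<odot>\<^bsub>section_module m T\<^esub>
      (sec_class m T (f i) :: ('x, 'u) melem)) = sec_class m T (\<lambda>x j. \<Sum>i\<in>A. c i x * f i x j)"
  using assms
proof (induction A rule: finite_induct)
  case empty
  show ?case
    using abelian_monoid.finsum_empty[OF abelian_group.axioms(1)[OF abelian_group_section[OF T]]]
    by (simp add: section_zero[OF T])
next
  case (insert a A)
  let ?\<Gamma> = "section_module m T :: ('x, ('x, 'u) melem) L0_nmodule"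
  have monoid: "abelian_monoid ?\<Gamma>" by (rule abelian_group.axioms(1)[OF abelian_group_section[OF T]])
  have in_C: "L0_class m (c i) \<odot>\<^bsub>?\<Gamma>\<^esub> sec_class m T (f i) \<in> carrier ?\<Gamma>" if "i \<in> insert a A" for i
    using insert.prems[OF that] by (simp add: section_smult[OF T] sec_class_in[OF T] msec_scale[OF T])
  have "(\<Oplus>\<^bsub>?\<Gamma>\<^esub>i\<in>insert a A. L0_class m (c i) \<odot>\<^bsub>?\<Gamma>\<^esub> sec_class m T (f i)) =
      L0_class m (c a) \<odot>\<^bsub>?\<Gamma>\<^esub> sec_class m T (f a) \<oplus>\<^bsub>?\<Gamma>\<^esub>
      (\<Oplus>\<^bsub>?\<Gamma>\<^esub>i\<in>A. L0_class m (c i) \<odot>\<^bsub>?\<Gamma>\<^esub> sec_class m T (f i))"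
    using insert.hyps in_C by (intro abelian_monoid.finsum_insert[OF monoid]) auto
  also have "\<dots> = sec_class m T (\<lambda>x j. c a x * f a x j) \<oplus>\<^bsub>?\<Gamma>\<^esub>
      sec_class m T (\<lambda>x j. \<Sum>i\<in>A. c i x * f i x j)"
    using insert by (simp add: section_smult[OF T])
  also have "\<dots> = sec_class m T (\<lambda>x j. c a x * f a x j + (\<Sum>i\<in>A. c i x * f i x j))"
    using insert.prems by (intro section_add[OF T] msec_scale[OF T] msec_sum[OF T]) auto
  also have "\<dots> = sec_class m T (\<lambda>x j. \<Sum>i\<in>insert a A. c i x * f i x j)"
    using insert.hyps by simp
  finally show ?case .
qed

text \<open>Over \<open>part T n\<close> the coefficients of a combination of the frame are the
  coordinates of the resulting section, so independence and spanning can both be read off.\<close>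

lemma local_basis_section:
  "local_basis m (section_module m T :: ('x, ('x, 'u) melem) L0_nmodule) (part T n) n
    (\<lambda>i. sec_class m T (frame i))"
proof -
  let ?\<Gamma> = "section_module m T :: ('x, ('x, 'u) melem) L0_nmodule" and ?A = "part T n"
  have A: "?A \<in> sets m" using part_measurable[OF T] by (simp add: sets_m)
  have ind: "indicator ?A \<in> borel_measurable m" using A by (rule borel_measurable_indicator)
  have chi: "chi m ?A \<odot>\<^bsub>?\<Gamma>\<^esub> sec_class m T f = sec_class m T (\<lambda>x j. indicator ?A x * f x j)"
    if "f \<in> msec T" for f
    unfolding chi_def by (rule section_smult[OF T ind that])
  have lin: "lincomb m ?\<Gamma> n (\<lambda>i. chi m ?A \<odot>\<^bsub>?\<Gamma>\<^esub> sec_class m T (frame i)) f =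
      sec_class m T (\<lambda>x j. \<Sum>i<n. f x i * (indicator ?A x * frame i x j))"
    if "\<forall>i. (\<lambda>x. f x i) \<in> borel_measurable m" for f
    unfolding lincomb_def chi[OF frame_msec] using that
    by (intro section_finsum msec_scale[OF T] ind frame_msec) auto
  have msec: "(\<lambda>x j. \<Sum>i<n. f x i * (indicator ?A x * frame i x j)) \<in> msec T"
    if "\<forall>i. (\<lambda>x. f x i) \<in> borel_measurable m" for f
    using that by (intro msec_sum[OF T] msec_scale[OF T] ind frame_msec) auto
  have b: "(\<lambda>i. sec_class m T (frame i)) \<in> {..<n} \<rightarrow> carrier ?\<Gamma>"
    using sec_class_in[OF T frame_msec] by auto
  show ?thesis
    unfolding local_basis_iff[OF module_section[OF T] A b]
  proof (intro conjI allI impI ballI)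
    fix f i assume f: "\<forall>i. (\<lambda>x. f x i) \<in> borel_measurable m" and i: "i < n"
      and 0: "lincomb m ?\<Gamma> n (\<lambda>i. chi m ?A \<odot>\<^bsub>?\<Gamma>\<^esub> sec_class m T (frame i)) f = \<zero>\<^bsub>?\<Gamma>\<^esub>"
    have "AE x in m. (\<lambda>j. \<Sum>i<n. f x i * (indicator ?A x * frame i x j)) = (\<lambda>j. 0)"
      using 0 unfolding lin[OF f] section_zero[OF T] sec_class_eq_iff[OF T msec[OF f] msec_zero[OF T]] .
    then show "AE x in m. x \<in> ?A \<longrightarrow> f x i = 0"
    proof eventually_elim
      case (elim x)
      show ?case
      proof
        assume x: "x \<in> ?A"
        have "0 = (\<Sum>l<n. f x l * (indicator ?A x * frame l x i))" using fun_cong[OF elim, of i] by simp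
        also have "\<dots> = (\<Sum>l<n. if l = i then f x i else 0)"
          using x in_part_iff[OF T] by (intro sum.cong) (auto simp: frame_def unit_vec_def)
        also have "\<dots> = f x i" using i by simp
        finally show "f x i = 0" by simp
      qed
    qed
  next
    fix w assume "w \<in> carrier ?\<Gamma>"
    then obtain s where s: "s \<in> msec T" "w = sec_class m T s" by (rule section_cases[OF T])
    have f: "\<forall>i. (\<lambda>x. s x i) \<in> borel_measurable m" using msec_measurable[OF T s(1)] by (simp add: measurable_m)
    have "(\<lambda>x j. indicator ?A x * s x j) = (\<lambda>x j. \<Sum>i<n. s x i * (indicator ?A x * frame i x j))"
    proof (intro ext)
      fix x j
      show "indicator ?A x * s x j = (\<Sum>i<n. s x i * (indicator ?A x * frame i x j))"
      proof (cases "x \<in> ?A")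
        case True
        then show ?thesis using fun_cong[OF frame_expand[OF s(1), of x], of j] in_part_iff[OF T] by simp
      qed simp
    qed
    then show "\<exists>f. (\<forall>i. (\<lambda>x. f x i) \<in> borel_measurable m) \<and> chi m ?A \<odot>\<^bsub>?\<Gamma>\<^esub> w =
        lincomb m ?\<Gamma> n (\<lambda>i. chi m ?A \<odot>\<^bsub>?\<Gamma>\<^esub> sec_class m T (frame i)) f"
      using f lin[OF f] chi[OF s(1)] s(2) by (intro exI[of _ s]) simp
  qed
qed

lemma proper_section_module:
  "proper_module m (section_module m T :: ('x, ('x, 'u) melem) L0_nmodule)"
  unfolding proper_module_def dimensional_decomposition_def
proof (intro exI[of _ "case_enat (part T) {}"] conjI allI impI ballI)
  show "case_enat (part T) {} k \<in> sets borel" for k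
    using part_measurable[OF T] by (cases k) auto
  show "disjoint_family (case_enat (part T) {})"
    using in_part_iff[OF T] by (auto simp: disjoint_family_on_def split: enat.splits)
  show "(\<Union>k. case_enat (part T) {} k) = UNIV"
  proof -
    have "x \<in> case_enat (part T) {} (enat (bdim T x))" for x using in_part_bdim[OF T] by simp
    then show ?thesis by blast
  qed
  show "has_dim m (section_module m T :: ('x, ('x, 'u) melem) L0_nmodule) (case_enat (part T) {} (enat n)) n" for n
    using local_basis_section by (auto simp: has_dim_def)
qed auto

end

end

section \<open>The section functor is faithful\<close>

lemma section_functor_obj: "fobj (section_functor m) = section_module m"
  by (simp add: section_functor_def)

section \<open>The two categories and the action of the functor on arrows\<close>

context mm_space
begin

lemma category_NMod: "category (NMod_pr m :: (('x, 'v) L0_nmodule, 'v \<Rightarrow> 'v) precat)"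
  unfolding category_def
proof (intro conjI ballI)
  let ?C = "NMod_pr m :: (('x, 'v) L0_nmodule, 'v \<Rightarrow> 'v) precat"
  fix M assume "M \<in> Obj ?C"
  then interpret M: module "L0 m" M by (simp add: NMod_pr_def normed_L0_module_def)
  show "Ident ?C M \<in> Hom ?C M M"
    by (simp add: NMod_pr_def nmod_hom_def L0_le_def)
  fix N assume N: "N \<in> Obj ?C"
  fix \<Phi> assume \<Phi>: "\<Phi> \<in> Hom ?C M N"
  then have "\<Phi> \<in> carrier M \<rightarrow>\<^sub>E carrier N" by (simp add: NMod_pr_def nmod_hom_def)
  then show "Comp ?C M M N \<Phi> (Ident ?C M) = \<Phi>" "Comp ?C M N N (Ident ?C N) \<Phi> = \<Phi>"
    by (auto simp: NMod_pr_def compose_def fun_eq_iff PiE_def extensional_def Pi_def)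
  fix P assume "P \<in> Obj ?C"
  fix \<Psi> assume \<Psi>: "\<Psi> \<in> Hom ?C N P"
  have hom: "\<Phi> v \<in> carrier N" "L0_le m (pnorm N (\<Phi> v)) (pnorm M v)" if "v \<in> carrier M" for v
    using \<Phi> that by (auto simp: NMod_pr_def nmod_hom_def)
  have hom': "\<Psi> v \<in> carrier P" "L0_le m (pnorm P (\<Psi> v)) (pnorm N v)" if "v \<in> carrier N" for v
    using \<Psi> that by (auto simp: NMod_pr_def nmod_hom_def)
  have le: "L0_le m (pnorm P (\<Psi> (\<Phi> v))) (pnorm M v)" if "v \<in> carrier M" for v
    using hom(2)[OF that] hom'(2)[OF hom(1)[OF that]] unfolding L0_le_def
    by eventually_elim (rule order_trans)
  show "Comp ?C M N P \<Psi> \<Phi> \<in> Hom ?C M P"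
    using \<Phi> \<Psi> le by (auto simp: NMod_pr_def nmod_hom_def compose_def hom(1) hom'(1))
  fix Q \<Theta> assume "Q \<in> Obj ?C" "\<Theta> \<in> Hom ?C P Q"
  show "Comp ?C M P Q \<Theta> (Comp ?C M N P \<Psi> \<Phi>) = Comp ?C M N Q (Comp ?C N P Q \<Theta> \<Psi>) \<Phi>"
    by (auto simp: NMod_pr_def compose_def fun_eq_iff hom(1))
qed

lemma premorphism_total:
  assumes "is_mbb m T1" "is_mbb m T2" "\<phi> \<in> premorphisms m T1 T2" "v \<in> Rn (bdim T1 x)"
  shows "\<phi> (x, v) = (x, snd (\<phi> (x, v)))" "snd (\<phi> (x, v)) \<in> Rn (bdim T2 x)"
proof -
  have z: "(x, v) \<in> total_set T1" using assms by (simp add: total_set_iff)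
  have "fst (\<phi> (x, v)) = x" using assms(3) z by (auto simp: premorphisms_def)
  moreover have "\<phi> (x, v) \<in> total_set T2"
    using assms(3) measurable_space[of \<phi> "total_space T1" "total_space T2" "(x, v)"] z
    by (simp add: premorphisms_def space_total_space assms)
  ultimately show "\<phi> (x, v) = (x, snd (\<phi> (x, v)))" "snd (\<phi> (x, v)) \<in> Rn (bdim T2 x)"
    using assms by (auto simp: total_set_iff prod_eq_iff)
qed

lemma ident_premorphism: "is_mbb m T \<Longrightarrow> (\<lambda>z. z) \<in> premorphisms m T T"
  by (auto simp: premorphisms_def linear_on_fiber_def lipschitz_on_fiber_def)

context
  fixes T assumes T: "is_mbb m T"
begin

lemma linear_on_fiberI:
  assumes "\<And>v w. v \<in> Rn (bdim T x) \<Longrightarrow> w \<in> Rn (bdim T x) \<Longrightarrow>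
      snd (\<phi> (x, \<lambda>i. v i + w i)) = (\<lambda>i. snd (\<phi> (x, v)) i + snd (\<phi> (x, w)) i)"
    and "\<And>c v. v \<in> Rn (bdim T x) \<Longrightarrow> snd (\<phi> (x, \<lambda>i. c * v i)) = (\<lambda>i. c * snd (\<phi> (x, v)) i)"
  shows "linear_on_fiber T \<phi> x"
  unfolding linear_on_fiber_def fiber_eq[OF T]
  by (intro conjI ballI allI assms)

context
  fixes \<phi> x assumes lin: "linear_on_fiber T \<phi> x"
begin

lemma linear_on_fiber_add:
  assumes "v \<in> Rn (bdim T x)" "w \<in> Rn (bdim T x)"
  shows "snd (\<phi> (x, \<lambda>i. v i + w i)) = (\<lambda>i. snd (\<phi> (x, v)) i + snd (\<phi> (x, w)) i)"
  using bspec[OF bspec[OF conjunct1[OF lin[unfolded linear_on_fiber_def fiber_eq[OF T]]] assms(1)] assms(2)] .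

lemma linear_on_fiber_scale:
  assumes "v \<in> Rn (bdim T x)"
  shows "snd (\<phi> (x, \<lambda>i. c * v i)) = (\<lambda>i. c * snd (\<phi> (x, v)) i)"
  using bspec[OF spec[OF conjunct2[OF lin[unfolded linear_on_fiber_def fiber_eq[OF T]]]] assms] .

lemma linear_on_fiber_zero: "snd (\<phi> (x, \<lambda>i. 0)) = (\<lambda>i. 0)"
  using linear_on_fiber_scale[OF Rn_zero, of 0] by simp

lemma linear_on_fiber_diff:
  assumes "v \<in> Rn (bdim T x)" "w \<in> Rn (bdim T x)"
  shows "snd (\<phi> (x, \<lambda>i. v i - w i)) = (\<lambda>i. snd (\<phi> (x, v)) i - snd (\<phi> (x, w)) i)"
  using linear_on_fiber_add[OF assms(1) Rn_scale[OF assms(2), of "- 1"]]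
    linear_on_fiber_scale[OF assms(2), of "- 1"] by simp

lemma linear_on_fiber_sum:
  assumes "finite A" "\<And>i. i \<in> A \<Longrightarrow> f i \<in> Rn (bdim T x)"
  shows "snd (\<phi> (x, \<lambda>j. \<Sum>i\<in>A. c i * f i j)) = (\<lambda>j. \<Sum>i\<in>A. c i * snd (\<phi> (x, f i)) j)"
  using assms
proof (induction A rule: finite_induct)
  case empty
  then show ?case using linear_on_fiber_zero by simp
next
  case (insert k A)
  have "snd (\<phi> (x, \<lambda>j. c k * f k j + (\<Sum>i\<in>A. c i * f i j))) =
      (\<lambda>j. snd (\<phi> (x, \<lambda>j. c k * f k j)) j + snd (\<phi> (x, \<lambda>j. \<Sum>i\<in>A. c i * f i j)) j)"
    using insert.prems by (intro linear_on_fiber_add Rn_scale Rn_sum) auto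
  also have "snd (\<phi> (x, \<lambda>j. c k * f k j)) = (\<lambda>j. c k * snd (\<phi> (x, f k)) j)"
    using insert.prems by (intro linear_on_fiber_scale) auto
  finally show ?case using insert by simp
qed

end

lemma lipschitz_on_fiberD:
  assumes "lipschitz_on_fiber T T2 \<phi> x" "v \<in> Rn (bdim T x)" "w \<in> Rn (bdim T x)"
  shows "bnorm T2 (x, \<lambda>i. snd (\<phi> (x, v)) i - snd (\<phi> (x, w)) i) \<le> bnorm T (x, \<lambda>i. v i - w i)"
  using bspec[OF bspec[OF assms(1)[unfolded lipschitz_on_fiber_def fiber_eq[OF T]] assms(2)] assms(3)] .

end

lemma comp_premorphism:
  assumes T: "is_mbb m T1" "is_mbb m T2" "is_mbb m T3"
    and \<phi>: "\<phi> \<in> premorphisms m T1 T2" and \<psi>: "\<psi> \<in> premorphisms m T2 T3"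
  shows "\<psi> \<circ> \<phi> \<in> premorphisms m T1 T3"
  unfolding premorphisms_def
proof (intro CollectI conjI ballI)
  note \<phi>_total = premorphism_total[OF T(1,2) \<phi>] and \<psi>_total = premorphism_total[OF T(2,3) \<psi>]
  show "\<psi> \<circ> \<phi> \<in> total_space T1 \<rightarrow>\<^sub>M total_space T3"
    using \<phi> \<psi> by (auto simp: premorphisms_def intro: measurable_comp)
  fix z assume "z \<in> total_set T1"
  then obtain x v where "z = (x, v)" "v \<in> Rn (bdim T1 x)" by (cases z) (auto simp: total_set_iff[OF T(1)])
  then show "fst ((\<psi> \<circ> \<phi>) z) = fst z"
    using \<phi>_total[of v x] \<psi>_total[of "snd (\<phi> (x, v))" x] by (metis comp_apply fst_conv)
next
  have "AE x in m. linear_on_fiber T1 \<phi> x \<and> lipschitz_on_fiber T1 T2 \<phi> x"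
    "AE x in m. linear_on_fiber T2 \<psi> x \<and> lipschitz_on_fiber T2 T3 \<psi> x"
    using \<phi> \<psi> by (auto simp: premorphisms_def)
  then show "AE x in m. linear_on_fiber T1 (\<psi> \<circ> \<phi>) x \<and> lipschitz_on_fiber T1 T3 (\<psi> \<circ> \<phi>) x"
  proof eventually_elim
    case (elim x)
    then have 1: "linear_on_fiber T1 \<phi> x" "lipschitz_on_fiber T1 T2 \<phi> x"
      and 2: "linear_on_fiber T2 \<psi> x" "lipschitz_on_fiber T2 T3 \<psi> x" by auto
    define p where "p v = snd (\<phi> (x, v))" for v
    have p: "p v \<in> Rn (bdim T2 x)" if "v \<in> Rn (bdim T1 x)" for v
      using premorphism_total[OF T(1,2) \<phi> that] by (simp add: p_def)
    have comp: "snd ((\<psi> \<circ> \<phi>) (x, v)) = snd (\<psi> (x, p v))" if "v \<in> Rn (bdim T1 x)" for v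
      using premorphism_total(1)[OF T(1,2) \<phi> that] by (simp add: p_def)
    have "linear_on_fiber T1 (\<psi> \<circ> \<phi>) x"
    proof (rule linear_on_fiberI[OF T(1)])
      fix v w c assume v: "v \<in> Rn (bdim T1 x)"
      show "snd ((\<psi> \<circ> \<phi>) (x, \<lambda>i. c * v i)) = (\<lambda>i. c * snd ((\<psi> \<circ> \<phi>) (x, v)) i)"
        unfolding comp[OF v] comp[OF Rn_scale[OF v]]
        using linear_on_fiber_scale[OF T(1) 1(1) v] linear_on_fiber_scale[OF T(2) 2(1) p[OF v]]
        by (simp add: p_def)
      assume w: "w \<in> Rn (bdim T1 x)"
      show "snd ((\<psi> \<circ> \<phi>) (x, \<lambda>i. v i + w i)) =
          (\<lambda>i. snd ((\<psi> \<circ> \<phi>) (x, v)) i + snd ((\<psi> \<circ> \<phi>) (x, w)) i)"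
        unfolding comp[OF v] comp[OF w] comp[OF Rn_add[OF v w]]
        using linear_on_fiber_add[OF T(1) 1(1) v w] linear_on_fiber_add[OF T(2) 2(1) p[OF v] p[OF w]]
        by (simp add: p_def)
    qed
    moreover have "lipschitz_on_fiber T1 T3 (\<psi> \<circ> \<phi>) x"
      unfolding lipschitz_on_fiber_def fiber_eq[OF T(1)]
    proof (intro ballI)
      fix v w assume v: "v \<in> Rn (bdim T1 x)" "w \<in> Rn (bdim T1 x)"
      show "bnorm T3 (x, \<lambda>i. snd ((\<psi> \<circ> \<phi>) (x, v)) i - snd ((\<psi> \<circ> \<phi>) (x, w)) i)
          \<le> bnorm T1 (x, \<lambda>i. v i - w i)"
        unfolding comp[OF v(1)] comp[OF v(2)]
        using lipschitz_on_fiberD[OF T(2) 2(2) p[OF v(1)] p[OF v(2)]]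
          lipschitz_on_fiberD[OF T(1) 1(2) v] unfolding p_def by (rule order_trans)
    qed
    ultimately show ?case ..
  qed
qed

lemma equiv_premorphism_rel: "equiv (premorphisms m T1 T2) (premorphism_rel m T1 T2)"
proof (rule equivI)
  show "refl_on (premorphisms m T1 T2) (premorphism_rel m T1 T2)"
    by (auto simp: premorphism_rel_def refl_on_def)
  show "sym (premorphism_rel m T1 T2)"
    by (auto simp: premorphism_rel_def sym_def elim: eventually_mono)
  show "trans (premorphism_rel m T1 T2)"
    unfolding trans_def
  proof (intro allI impI)
    fix \<phi> \<psi> \<theta>
    assume "(\<phi>, \<psi>) \<in> premorphism_rel m T1 T2" "(\<psi>, \<theta>) \<in> premorphism_rel m T1 T2"
    moreover from this have "AE x in m. \<forall>v\<in>fiber T1 x. \<phi> (x, v) = \<psi> (x, v)"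
      "AE x in m. \<forall>v\<in>fiber T1 x. \<psi> (x, v) = \<theta> (x, v)"
      by (auto simp: premorphism_rel_def)
    then have "AE x in m. \<forall>v\<in>fiber T1 x. \<phi> (x, v) = \<theta> (x, v)" by eventually_elim simp
    ultimately show "(\<phi>, \<theta>) \<in> premorphism_rel m T1 T2" by (simp add: premorphism_rel_def)
  qed
qed (auto simp: premorphism_rel_def)

definition bundle_arrow where
  "bundle_arrow T1 T2 \<phi> = premorphism_rel m T1 T2 `` {\<phi>}"

lemma bundle_arrow_eq_iff:
  "\<phi> \<in> premorphisms m T1 T2 \<Longrightarrow> \<psi> \<in> premorphisms m T1 T2 \<Longrightarrow>
    bundle_arrow T1 T2 \<phi> = bundle_arrow T1 T2 \<psi> \<longleftrightarrow> (AE x in m. \<forall>v\<in>fiber T1 x. \<phi> (x, v) = \<psi> (x, v))"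
  unfolding bundle_arrow_def
  by (subst eq_equiv_class_iff[OF equiv_premorphism_rel]) (auto simp: premorphism_rel_def)

lemma Hom_MBB: "Hom (MBB m) T1 T2 = bundle_arrow T1 T2 ` premorphisms m T1 T2"
  by (auto simp: MBB_def bundle_arrow_def quotient_def)

lemma Ident_MBB: "Ident (MBB m) T = bundle_arrow T T (\<lambda>z. z)"
  by (simp add: MBB_def bundle_arrow_def)

lemma Obj_MBB: "T \<in> Obj (MBB m) \<longleftrightarrow> is_mbb m T"
  by (simp add: MBB_def)

lemma rep_bundle_arrow:
  assumes "\<phi> \<in> premorphisms m T1 T2"
  shows "rep (bundle_arrow T1 T2 \<phi>) \<in> premorphisms m T1 T2"
    "AE x in m. \<forall>v\<in>fiber T1 x. rep (bundle_arrow T1 T2 \<phi>) (x, v) = \<phi> (x, v)"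
  using rep_related[OF equiv_premorphism_rel assms]
  by (auto simp: bundle_arrow_def premorphism_rel_def elim: eventually_mono)

lemma Comp_MBB:
  assumes T: "is_mbb m T1" "is_mbb m T2" "is_mbb m T3"
    and \<phi>: "\<phi> \<in> premorphisms m T1 T2" and \<psi>: "\<psi> \<in> premorphisms m T2 T3"
  shows "Comp (MBB m) T1 T2 T3 (bundle_arrow T2 T3 \<psi>) (bundle_arrow T1 T2 \<phi>) =
    bundle_arrow T1 T3 (\<psi> \<circ> \<phi>)"
proof -
  let ?\<phi> = "rep (bundle_arrow T1 T2 \<phi>)" and ?\<psi> = "rep (bundle_arrow T2 T3 \<psi>)"
  have "bundle_arrow T1 T3 (?\<psi> \<circ> ?\<phi>) = bundle_arrow T1 T3 (\<psi> \<circ> \<phi>)"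
  proof (subst bundle_arrow_eq_iff)
    show "AE x in m. \<forall>v\<in>fiber T1 x. (?\<psi> \<circ> ?\<phi>) (x, v) = (\<psi> \<circ> \<phi>) (x, v)"
      using rep_bundle_arrow(2)[OF \<phi>] rep_bundle_arrow(2)[OF \<psi>]
    proof eventually_elim
      case (elim x)
      show ?case
      proof
        fix v assume v: "v \<in> fiber T1 x"
        then have "\<phi> (x, v) = (x, snd (\<phi> (x, v)))" "snd (\<phi> (x, v)) \<in> fiber T2 x"
          using premorphism_total[OF T(1,2) \<phi>, of v x] by (auto simp: fiber_eq T)
        then have "?\<psi> (\<phi> (x, v)) = \<psi> (\<phi> (x, v))" using elim(2) by metis
        then show "(?\<psi> \<circ> ?\<phi>) (x, v) = (\<psi> \<circ> \<phi>) (x, v)" using elim(1) v by simp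
      qed
    qed
  qed (intro comp_premorphism[OF T] rep_bundle_arrow \<phi> \<psi>)+
  then show ?thesis by (simp add: MBB_def bundle_arrow_def)
qed

lemma category_MBB: "category (MBB m)"
  unfolding category_def
proof (intro conjI ballI)
  fix T1 assume "T1 \<in> Obj (MBB m)"
  then have T1: "is_mbb m T1" by (simp add: Obj_MBB)
  show "Ident (MBB m) T1 \<in> Hom (MBB m) T1 T1"
    by (simp add: Hom_MBB Ident_MBB ident_premorphism T1)
  fix T2 f assume "T2 \<in> Obj (MBB m)" and "f \<in> Hom (MBB m) T1 T2"
  then obtain \<phi> where T2: "is_mbb m T2" and \<phi>: "\<phi> \<in> premorphisms m T1 T2" "f = bundle_arrow T1 T2 \<phi>"
    by (auto simp: Obj_MBB Hom_MBB)
  have "\<phi> \<circ> (\<lambda>z. z) = \<phi>" "(\<lambda>z. z) \<circ> \<phi> = \<phi>" by auto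
  then show "Comp (MBB m) T1 T1 T2 f (Ident (MBB m) T1) = f"
    "Comp (MBB m) T1 T2 T2 (Ident (MBB m) T2) f = f"
    using \<phi> T1 T2 by (simp_all add: Ident_MBB Comp_MBB ident_premorphism)
  fix T3 g assume "T3 \<in> Obj (MBB m)" "g \<in> Hom (MBB m) T2 T3"
  then obtain \<psi> where T3: "is_mbb m T3" and \<psi>: "\<psi> \<in> premorphisms m T2 T3" "g = bundle_arrow T2 T3 \<psi>"
    by (auto simp: Obj_MBB Hom_MBB)
  show "Comp (MBB m) T1 T2 T3 g f \<in> Hom (MBB m) T1 T3"
    unfolding \<phi>(2) \<psi>(2) Comp_MBB[OF T1 T2 T3 \<phi>(1) \<psi>(1)] Hom_MBB
    by (intro imageI comp_premorphism[OF T1 T2 T3] \<phi> \<psi>)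
  fix T4 h assume "T4 \<in> Obj (MBB m)" "h \<in> Hom (MBB m) T3 T4"
  then obtain \<theta> where T4: "is_mbb m T4" and \<theta>: "\<theta> \<in> premorphisms m T3 T4" "h = bundle_arrow T3 T4 \<theta>"
    by (auto simp: Obj_MBB Hom_MBB)
  show "Comp (MBB m) T1 T3 T4 h (Comp (MBB m) T1 T2 T3 g f) =
      Comp (MBB m) T1 T2 T4 (Comp (MBB m) T2 T3 T4 h g) f"
    unfolding \<phi>(2) \<psi>(2) \<theta>(2) Comp_MBB[OF T1 T2 T3 \<phi>(1) \<psi>(1)] Comp_MBB[OF T2 T3 T4 \<psi>(1) \<theta>(1)]
      Comp_MBB[OF T1 T3 T4 comp_premorphism[OF T1 T2 T3 \<phi>(1) \<psi>(1)] \<theta>(1)]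
      Comp_MBB[OF T1 T2 T4 \<phi>(1) comp_premorphism[OF T2 T3 T4 \<psi>(1) \<theta>(1)]]
    by (simp only: comp_assoc)
qed

definition push :: "('x \<times> (nat \<Rightarrow> real) \<Rightarrow> 'x \<times> (nat \<Rightarrow> real)) \<Rightarrow> ('x \<Rightarrow> nat \<Rightarrow> real) \<Rightarrow> 'x \<Rightarrow> nat \<Rightarrow> real"
  where "push \<phi> f = (\<lambda>x. snd (\<phi> (x, f x)))"

context
  fixes T1 T2 assumes T1: "is_mbb m T1" and T2: "is_mbb m T2"
begin

lemma push_eq:
  assumes "\<phi> \<in> premorphisms m T1 T2" "f \<in> msec T1"
  shows "\<phi> (x, f x) = (x, push \<phi> f x)"
  using premorphism_total(1)[OF T1 T2 assms(1) msec_Rn[OF T1 assms(2)]] by (simp add: push_def)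

lemma push_msec:
  assumes \<phi>: "\<phi> \<in> premorphisms m T1 T2" and f: "f \<in> msec T1"
  shows "push \<phi> f \<in> msec T2"
proof -
  have "(\<lambda>x. (x, f x)) \<in> borel \<rightarrow>\<^sub>M total_space T1"
    using bundle_sections_iff[OF T1, of "\<lambda>x. (x, f x)"] f by (auto simp: bundle_sections_def)
  moreover have "\<phi> \<in> total_space T1 \<rightarrow>\<^sub>M total_space T2" using \<phi> by (simp add: premorphisms_def)
  ultimately have "(\<lambda>x. \<phi> (x, f x)) \<in> borel \<rightarrow>\<^sub>M total_space T2" by (rule measurable_compose)
  then have "(\<lambda>x. (x, push \<phi> f x)) \<in> borel \<rightarrow>\<^sub>M total_space T2" using push_eq[OF assms] by simp
  then have "(\<lambda>x. (x, push \<phi> f x)) \<in> bundle_sections T2" by (simp add: bundle_sections_def)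
  then obtain g where "g \<in> msec T2" "(\<lambda>x. (x, push \<phi> f x)) = (\<lambda>x. (x, g x))"
    using bundle_sections_iff[OF T2] by auto
  then show ?thesis by (simp add: fun_eq_iff[of "\<lambda>x. (x, push \<phi> f x)"] fun_eq_iff[symmetric])
qed

text \<open>The functor evaluates a chosen premorphism on a chosen section. Off one null set these
  agree with \<open>\<phi>\<close> and \<open>f\<close>: the premorphisms agree on whole fibres
  there, hence also at the values of the section.\<close>

lemma farr_section_functor:
  assumes \<phi>: "\<phi> \<in> premorphisms m T1 T2" and f: "f \<in> msec T1"
  shows "farr (section_functor m) T1 T2 (bundle_arrow T1 T2 \<phi>) (sec_class m T1 f :: ('x, 'u) melem) =
    sec_class m T2 (push \<phi> f)"
proof -
  let ?\<phi> = "rep (bundle_arrow T1 T2 \<phi>)" and ?f = "srep (sec_class m T1 f :: ('x, 'u) melem)"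
  have f': "?f \<in> msec T1" by (rule rep_section[OF T1 f])
  have in_C: "(sec_class m T1 f :: ('x, 'u) melem) \<in> carrier (section_module m T1)"
    by (rule sec_class_in[OF T1 f])
  have "farr (section_functor m) T1 T2 (bundle_arrow T1 T2 \<phi>) (sec_class m T1 f :: ('x, 'u) melem) =
      Inl (section_class m T2 (?\<phi> \<circ> (\<lambda>x. (x, ?f x))))"
    using in_C rep_section(1)[OF T1 f, where ?'u = 'u]
    by (simp add: section_functor_def)
  also have "?\<phi> \<circ> (\<lambda>x. (x, ?f x)) = (\<lambda>x. (x, push ?\<phi> ?f x))"
    using push_eq[OF rep_bundle_arrow(1)[OF \<phi>] f'] by (simp add: fun_eq_iff)
  also have "Inl (section_class m T2 \<dots>) = (sec_class m T2 (push ?\<phi> ?f) :: ('x, 'u) melem)"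
    by (simp add: sec_class_def)
  also have "\<dots> = sec_class m T2 (push \<phi> f)"
  proof (rule sec_class_cong[OF T2])
    show "AE x in m. push ?\<phi> ?f x = push \<phi> f x"
      using rep_bundle_arrow(2)[OF \<phi>] rep_section(3)[OF T1 f, where ?'u = 'u]
      by eventually_elim (simp add: push_def fiber_eq[OF T1] msec_Rn[OF T1 f])
  qed (intro push_msec rep_bundle_arrow \<phi> f f')+
  finally show ?thesis .
qed

lemma farr_section_functor_hom:
  assumes \<phi>: "\<phi> \<in> premorphisms m T1 T2"
  shows "farr (section_functor m) T1 T2 (bundle_arrow T1 T2 \<phi>) \<in>
    nmod_hom m (section_module m T1 :: ('x, ('x, 'u) melem) L0_nmodule) (section_module m T2)"
proof -
  let ?F = "farr (section_functor m) T1 T2 (bundle_arrow T1 T2 \<phi>) :: ('x, 'u) melem \<Rightarrow> ('x, 'u) melem"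
  have AE: "AE x in m. linear_on_fiber T1 \<phi> x \<and> lipschitz_on_fiber T1 T2 \<phi> x"
    using \<phi> by (simp add: premorphisms_def)
  show ?thesis
    unfolding nmod_hom_def
  proof (intro CollectI conjI ballI PiE_I)
    fix S :: "('x, 'u) melem" assume "S \<in> carrier (section_module m T1)"
    then obtain f where f: "f \<in> msec T1" "S = sec_class m T1 f" by (rule section_cases[OF T1])
    note fR = msec_Rn[OF T1 f(1)]
    show "?F S \<in> carrier (section_module m T2)"
      unfolding f(2) farr_section_functor[OF \<phi> f(1)] by (intro sec_class_in[OF T2] push_msec \<phi> f)
    have "AE x in m. bnorm T2 (x, push \<phi> f x) \<le> bnorm T1 (x, f x)"
      using AE
    proof eventually_elim
      case (elim x)
      then have lin: "linear_on_fiber T1 \<phi> x" and lip: "lipschitz_on_fiber T1 T2 \<phi> x" by auto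
      show ?case
        using lipschitz_on_fiberD[OF T1 lip fR Rn_zero] linear_on_fiber_zero[OF T1 lin]
        by (simp add: push_def)
    qed
    then show "L0_le m (pnorm (section_module m T2) (?F S)) (pnorm (section_module m T1) S)"
      unfolding f(2) farr_section_functor[OF \<phi> f(1)] section_pnorm[OF T1 f(1)]
        section_pnorm[OF T2 push_msec[OF \<phi> f(1)]]
      using bnorm_measurable[OF T1 f(1)] bnorm_measurable[OF T2 push_msec[OF \<phi> f(1)]]
      by (subst L0_le_class) (simp_all add: measurable_m)
    fix S' :: "('x, 'u) melem" assume "S' \<in> carrier (section_module m T1)"
    then obtain g where g: "g \<in> msec T1" "S' = sec_class m T1 g" by (rule section_cases[OF T1])
    have "AE x in m. push \<phi> (\<lambda>x i. f x i + g x i) x = (\<lambda>i. push \<phi> f x i + push \<phi> g x i)"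
      using AE
    proof eventually_elim
      case (elim x)
      then show ?case
        unfolding push_def using linear_on_fiber_add[OF T1 _ fR msec_Rn[OF T1 g(1)]] by simp
    qed
    then show "?F (S \<oplus>\<^bsub>section_module m T1\<^esub> S') = ?F S \<oplus>\<^bsub>section_module m T2\<^esub> ?F S'"
      unfolding f(2) g(2) section_add[OF T1 f(1) g(1)] farr_section_functor[OF \<phi> f(1)]
        farr_section_functor[OF \<phi> g(1)] farr_section_functor[OF \<phi> msec_add[OF T1 f(1) g(1)]]
        section_add[OF T2 push_msec[OF \<phi> f(1)] push_msec[OF \<phi> g(1)]]
      by (intro sec_class_cong[OF T2] push_msec \<phi> msec_add[OF T1] msec_add[OF T2] f g)
  next
    fix F and S :: "('x, 'u) melem" assume "F \<in> carrier (L0 m)" "S \<in> carrier (section_module m T1)"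
    then obtain f c where f: "f \<in> msec T1" "S = sec_class m T1 f"
      and c: "c \<in> borel_measurable m" "F = L0_class m c"
      by (auto elim!: section_cases[OF T1] L0_cases)
    have "AE x in m. push \<phi> (\<lambda>x i. c x * f x i) x = (\<lambda>i. c x * push \<phi> f x i)"
      using AE
    proof eventually_elim
      case (elim x)
      then show ?case
        unfolding push_def using linear_on_fiber_scale[OF T1 _ msec_Rn[OF T1 f(1)]] by simp
    qed
    then show "?F (F \<odot>\<^bsub>section_module m T1\<^esub> S) = F \<odot>\<^bsub>section_module m T2\<^esub> ?F S"
      unfolding f(2) c(2) section_smult[OF T1 c(1) f(1)] farr_section_functor[OF \<phi> f(1)]
        farr_section_functor[OF \<phi> msec_scale[OF T1 c(1) f(1)]]
        section_smult[OF T2 c(1) push_msec[OF \<phi> f(1)]]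
      by (intro sec_class_cong[OF T2] push_msec \<phi> msec_scale[OF T1] msec_scale[OF T2] f c)
  qed (simp add: section_functor_def)
qed

lemma section_functor_faithful:
  assumes \<phi>: "\<phi> \<in> premorphisms m T1 T2" and \<psi>: "\<psi> \<in> premorphisms m T1 T2"
    and eq: "farr (section_functor m) T1 T2 (bundle_arrow T1 T2 \<phi>) =
      (farr (section_functor m) T1 T2 (bundle_arrow T1 T2 \<psi>) :: ('x, 'u) melem \<Rightarrow> ('x, 'u) melem)"
  shows "bundle_arrow T1 T2 \<phi> = bundle_arrow T1 T2 \<psi>"
proof -
  have "AE x in m. push \<phi> (frame T1 i) x = push \<psi> (frame T1 i) x" for i
  proof -
    note i = frame_msec[OF T1, of i]
    have "(sec_class m T2 (push \<phi> (frame T1 i)) :: ('x, 'u) melem) = sec_class m T2 (push \<psi> (frame T1 i))"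
      using fun_cong[OF eq, of "sec_class m T1 (frame T1 i)"]
      unfolding farr_section_functor[OF \<phi> i] farr_section_functor[OF \<psi> i] .
    then show ?thesis unfolding sec_class_eq_iff[OF T2 push_msec[OF \<phi> i] push_msec[OF \<psi> i]] .
  qed
  \<comment> \<open>The frame is countable, so one null set serves for all its members; linearity
    then extends the equality to every vector of the fibre.\<close>
  then have "AE x in m. \<forall>i. push \<phi> (frame T1 i) x = push \<psi> (frame T1 i) x" by (simp add: AE_all_countable)
  moreover have "AE x in m. linear_on_fiber T1 \<phi> x" "AE x in m. linear_on_fiber T1 \<psi> x"
    using \<phi> \<psi> by (auto simp: premorphisms_def)
  ultimately have "AE x in m. \<forall>v\<in>fiber T1 x. \<phi> (x, v) = \<psi> (x, v)"
  proof eventually_elim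
    case (elim x)
    have e: "frame T1 i x \<in> Rn (bdim T1 x)" for i by (rule msec_Rn[OF T1 frame_msec[OF T1]])
    have lin: "snd (\<theta> (x, \<lambda>j. \<Sum>i<k. v i * frame T1 i x j)) =
        (\<lambda>j. \<Sum>i<k. v i * push \<theta> (frame T1 i) x j)"
      if \<theta>: "linear_on_fiber T1 \<theta> x" for \<theta> v k
      unfolding push_def by (rule linear_on_fiber_sum[OF T1 \<theta>]) (auto intro: e)
    show ?case
    proof
      fix v assume "v \<in> fiber T1 x"
      then have v: "v \<in> Rn (bdim T1 x)" by (simp add: fiber_eq[OF T1])
      have "(\<lambda>j. \<Sum>i<bdim T1 x. v i * frame T1 i x j) = v"
        using Rn_expand[OF v] by (simp add: frame_def[OF T1])
      then have "snd (\<phi> (x, v)) = snd (\<psi> (x, v))"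
        using lin[of \<phi> v "bdim T1 x"] lin[of \<psi> v "bdim T1 x"] elim by simp
      then show "\<phi> (x, v) = \<psi> (x, v)"
        using premorphism_total(1)[OF T1 T2 \<phi> v] premorphism_total(1)[OF T1 T2 \<psi> v] by simp
    qed
  qed
  then show ?thesis using bundle_arrow_eq_iff[OF \<phi> \<psi>] by simp
qed

end

lemma is_functor_section_functor:
  "is_functor (MBB m) (NMod_pr m :: (('x, ('x, 'u) melem) L0_nmodule, ('x, 'u) melem \<Rightarrow> ('x, 'u) melem) precat)
    (section_functor m)"
  unfolding is_functor_def section_functor_obj
proof (intro conjI ballI)
  let ?D = "NMod_pr m :: (('x, ('x, 'u) melem) L0_nmodule, ('x, 'u) melem \<Rightarrow> ('x, 'u) melem) precat"
  let ?F = "farr (section_functor m) :: _ \<Rightarrow> _ \<Rightarrow> _ \<Rightarrow> ('x, 'u) melem \<Rightarrow> ('x, 'u) melem"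
  show "category (MBB m)" "category ?D" by (rule category_MBB category_NMod)+
  fix T1 assume "T1 \<in> Obj (MBB m)"
  then have T1: "is_mbb m T1" by (simp add: Obj_MBB)
  show "section_module m T1 \<in> Obj ?D"
    using normed_section_module[OF T1] proper_section_module[OF T1] by (simp add: NMod_pr_def)
  have ext: "\<Phi> = \<Psi>" if "\<And>f. f \<in> msec T1 \<Longrightarrow> \<Phi> (sec_class m T1 f) = \<Psi> (sec_class m T1 f)"
    "\<Phi> \<in> extensional (carrier (section_module m T1))" "\<Psi> \<in> extensional (carrier (section_module m T1))"
    for \<Phi> \<Psi> :: "('x, 'u) melem \<Rightarrow> ('x, 'u) melem"
  proof (rule extensionalityI[OF that(2,3)])
    fix S :: "('x, 'u) melem" assume "S \<in> carrier (section_module m T1)"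
    then obtain f where "f \<in> msec T1" "S = sec_class m T1 f" by (rule section_cases[OF T1])
    then show "\<Phi> S = \<Psi> S" using that(1) by simp
  qed
  show "?F T1 T1 (Ident (MBB m) T1) = Ident ?D (section_module m T1)"
  proof (rule ext)
    fix f assume f: "f \<in> msec T1"
    have "push (\<lambda>z. z) f = f" by (simp add: push_def)
    moreover have "(sec_class m T1 f :: ('x, 'u) melem) \<in> carrier (section_module m T1)"
      by (rule sec_class_in[OF T1 f])
    ultimately show "?F T1 T1 (Ident (MBB m) T1) (sec_class m T1 f) = Ident ?D (section_module m T1) (sec_class m T1 f)"
      unfolding Ident_MBB farr_section_functor[OF T1 T1 ident_premorphism[OF T1] f]
      by (simp add: NMod_pr_def)
  qed (simp_all add: section_functor_def NMod_pr_def)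
  fix T2 f assume "T2 \<in> Obj (MBB m)" and "f \<in> Hom (MBB m) T1 T2"
  then obtain \<phi> where T2: "is_mbb m T2" and \<phi>: "\<phi> \<in> premorphisms m T1 T2" "f = bundle_arrow T1 T2 \<phi>"
    by (auto simp: Obj_MBB Hom_MBB)
  show "?F T1 T2 f \<in> Hom ?D (section_module m T1) (section_module m T2)"
    using farr_section_functor_hom[OF T1 T2 \<phi>(1)] \<phi>(2) by (simp add: NMod_pr_def)
  fix T3 g assume "T3 \<in> Obj (MBB m)" "g \<in> Hom (MBB m) T2 T3"
  then obtain \<psi> where T3: "is_mbb m T3" and \<psi>: "\<psi> \<in> premorphisms m T2 T3" "g = bundle_arrow T2 T3 \<psi>"
    by (auto simp: Obj_MBB Hom_MBB)
  note comp = comp_premorphism[OF T1 T2 T3 \<phi>(1) \<psi>(1)]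
  show "?F T1 T3 (Comp (MBB m) T1 T2 T3 g f) =
      Comp ?D (section_module m T1) (section_module m T2) (section_module m T3) (?F T2 T3 g) (?F T1 T2 f)"
    unfolding \<phi>(2) \<psi>(2) Comp_MBB[OF T1 T2 T3 \<phi>(1) \<psi>(1)]
  proof (rule ext)
    fix s assume s: "s \<in> msec T1"
    have "push \<psi> (push \<phi> s) = push (\<psi> \<circ> \<phi>) s"
      unfolding push_def[of \<psi>] push_def[of "\<psi> \<circ> \<phi>"] using push_eq[OF T1 T2 \<phi>(1) s] by simp
    moreover have "(sec_class m T1 s :: ('x, 'u) melem) \<in> carrier (section_module m T1)"
      by (rule sec_class_in[OF T1 s])
    ultimately show "?F T1 T3 (bundle_arrow T1 T3 (\<psi> \<circ> \<phi>)) (sec_class m T1 s) =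
        Comp ?D (section_module m T1) (section_module m T2) (section_module m T3)
          (?F T2 T3 (bundle_arrow T2 T3 \<psi>)) (?F T1 T2 (bundle_arrow T1 T2 \<phi>)) (sec_class m T1 s)"
      by (simp add: NMod_pr_def compose_def farr_section_functor[OF T1 T3 comp s]
          farr_section_functor[OF T1 T2 \<phi>(1) s]
          farr_section_functor[OF T2 T3 \<psi>(1) push_msec[OF T1 T2 \<phi>(1) s]])
  qed (simp_all add: section_functor_def NMod_pr_def compose_def)
qed

end

section \<open>The section functor is full\<close>

text \<open>The pullback of a seminorm along the linear map with columns \<open>F i\<close>.\<close>

lemma seminorm_on_Rn_linear:
  assumes N: "seminorm_on_Rn k N" and F: "\<And>i. i < n \<Longrightarrow> F i \<in> Rn k"
  shows "seminorm_on_Rn n (\<lambda>v. N (\<lambda>j. \<Sum>i<n. v i * F i j))"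
proof -
  have R: "(\<lambda>j. \<Sum>i<n. v i * F i j) \<in> Rn k" for v using F by (intro Rn_sum) auto
  have add: "(\<lambda>j. \<Sum>i<n. (v i + w i) * F i j) = (\<lambda>j. (\<Sum>i<n. v i * F i j) + (\<Sum>i<n. w i * F i j))" for v w
    by (simp add: distrib_right sum.distrib)
  have scale: "(\<lambda>j. \<Sum>i<n. (c * v i) * F i j) = (\<lambda>j. c * (\<Sum>i<n. v i * F i j))" for c v
    by (simp add: sum_distrib_left mult.assoc)
  show ?thesis
    unfolding seminorm_on_Rn_def add scale
    by (intro conjI ballI allI seminorm_nonneg[OF N] seminorm_scale[OF N] seminorm_triangle[OF N] R)
qed

lemma seminorm_le_of_le_on_Qn:
  assumes N: "seminorm_on_Rn n N" and N': "seminorm_on_Rn n N'"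
    and le: "\<And>q. q \<in> Qn n \<Longrightarrow> N q \<le> N' q" and v: "v \<in> Rn n"
  shows "N v \<le> N' v"
proof -
  obtain q where q: "\<And>j. q j \<in> Qn n" "(\<lambda>j. l1norm n (\<lambda>i. v i - q j i)) \<longlonglongrightarrow> 0"
    using Qn_approx[OF v] by blast
  have qR: "q j \<in> Rn n" for j using q(1) Qn_subset by blast
  show ?thesis
    by (rule LIMSEQ_le[OF seminorm_tendsto[OF N v qR q(2)] seminorm_tendsto[OF N' v qR q(2)]])
      (auto intro: le q(1))
qed

context mm_space
begin

context
  fixes T1 T2 and \<Phi> :: "('x, 'u) melem \<Rightarrow> ('x, 'u) melem"
  assumes T1: "is_mbb m T1" and T2: "is_mbb m T2"
    and \<Phi>: "\<Phi> \<in> nmod_hom m (section_module m T1) (section_module m T2)"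
begin

text \<open>The morphism on representatives. It respects sums and multiples only off null sets that
  depend on the arguments, which is why the algebraic rules below are stated for classes.\<close>

private definition \<Psi> :: "('x \<Rightarrow> nat \<Rightarrow> real) \<Rightarrow> 'x \<Rightarrow> nat \<Rightarrow> real" where
  "\<Psi> f = srep (\<Phi> (sec_class m T1 f))"

private lemma hom_facts:
  assumes f: "f \<in> msec T1"
  shows "\<Psi> f \<in> msec T2" "\<Phi> (sec_class m T1 f) = sec_class m T2 (\<Psi> f)"
    "AE x in m. bnorm T2 (x, \<Psi> f x) \<le> bnorm T1 (x, f x)"
proof -
  have in_C: "(sec_class m T1 f :: ('x, 'u) melem) \<in> carrier (section_module m T1)"
    by (rule sec_class_in[OF T1 f])
  then have im: "\<Phi> (sec_class m T1 f) \<in> carrier (section_module m T2)"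
    using \<Phi> by (auto simp: nmod_hom_def)
  show 1: "\<Psi> f \<in> msec T2" unfolding \<Psi>_def by (rule srep_in[OF T2 im])
  show 2: "\<Phi> (sec_class m T1 f) = sec_class m T2 (\<Psi> f)"
    unfolding \<Psi>_def by (rule sec_class_srep[OF T2 im, symmetric])
  have "L0_le m (pnorm (section_module m T2) (\<Phi> (sec_class m T1 f)))
      (pnorm (section_module m T1) (sec_class m T1 f :: ('x, 'u) melem))"
    using \<Phi> in_C by (auto simp: nmod_hom_def)
  then show "AE x in m. bnorm T2 (x, \<Psi> f x) \<le> bnorm T1 (x, f x)"
    unfolding 2 section_pnorm[OF T1 f] section_pnorm[OF T2 1]
    using bnorm_measurable[OF T1 f] bnorm_measurable[OF T2 1]
    by (subst (asm) L0_le_class) (simp_all add: measurable_m)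
qed

private lemma hom_add:
  assumes f: "f \<in> msec T1" and g: "g \<in> msec T1"
  shows "\<Phi> (sec_class m T1 (\<lambda>x i. f x i + g x i)) = sec_class m T2 (\<lambda>x i. \<Psi> f x i + \<Psi> g x i)"
proof -
  have in_C: "(sec_class m T1 f :: ('x, 'u) melem) \<in> carrier (section_module m T1)"
    "(sec_class m T1 g :: ('x, 'u) melem) \<in> carrier (section_module m T1)"
    by (intro sec_class_in[OF T1] f g)+
  have "\<Phi> (sec_class m T1 f \<oplus>\<^bsub>section_module m T1\<^esub> sec_class m T1 g) =
      \<Phi> (sec_class m T1 f) \<oplus>\<^bsub>section_module m T2\<^esub> \<Phi> (sec_class m T1 g)"
    using \<Phi> in_C unfolding nmod_hom_def by simp
  then show ?thesis
    unfolding section_add[OF T1 f g] hom_facts(2)[OF f] hom_facts(2)[OF g]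
      section_add[OF T2 hom_facts(1)[OF f] hom_facts(1)[OF g]] .
qed

private lemma hom_scale:
  assumes c: "c \<in> borel_measurable m" and f: "f \<in> msec T1"
  shows "\<Phi> (sec_class m T1 (\<lambda>x i. c x * f x i)) = sec_class m T2 (\<lambda>x i. c x * \<Psi> f x i)"
proof -
  have in_C: "(sec_class m T1 f :: ('x, 'u) melem) \<in> carrier (section_module m T1)"
    by (intro sec_class_in[OF T1] f)
  have "\<Phi> (L0_class m c \<odot>\<^bsub>section_module m T1\<^esub> sec_class m T1 f) =
      L0_class m c \<odot>\<^bsub>section_module m T2\<^esub> \<Phi> (sec_class m T1 f)"
    using \<Phi> in_C L0_class_in[OF c] unfolding nmod_hom_def by simp
  then show ?thesis
    unfolding section_smult[OF T1 c f] hom_facts(2)[OF f] section_smult[OF T2 c hom_facts(1)[OF f]] .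
qed

private lemma hom_sum:
  assumes "finite A" "\<And>i. i \<in> A \<Longrightarrow> c i \<in> borel_measurable m" "\<And>i. i \<in> A \<Longrightarrow> f i \<in> msec T1"
  shows "\<Phi> (sec_class m T1 (\<lambda>x j. \<Sum>i\<in>A. c i x * f i x j)) =
    sec_class m T2 (\<lambda>x j. \<Sum>i\<in>A. c i x * \<Psi> (f i) x j)"
  using assms
proof (induction A rule: finite_induct)
  case empty
  show ?case using hom_scale[of "\<lambda>_. 0" "\<lambda>x i. 0"] msec_zero[OF T1] by simp
next
  case (insert k A)
  let ?g = "\<lambda>x j. \<Sum>i\<in>A. c i x * f i x j" and ?h = "\<lambda>x j. c k x * f k x j"
  have g: "?g \<in> msec T1" and h: "?h \<in> msec T1"
    using insert.prems by (auto intro!: msec_sum[OF T1] msec_scale[OF T1])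
  have "\<Phi> (sec_class m T1 ?g) = sec_class m T2 (\<lambda>x j. \<Sum>i\<in>A. c i x * \<Psi> (f i) x j)"
    using insert by simp
  then have "(sec_class m T2 (\<Psi> ?g) :: ('x, 'u) melem) = sec_class m T2 (\<lambda>x j. \<Sum>i\<in>A. c i x * \<Psi> (f i) x j)"
    unfolding hom_facts(2)[OF g] .
  moreover have g': "(\<lambda>x j. \<Sum>i\<in>A. c i x * \<Psi> (f i) x j) \<in> msec T2"
    using insert.prems by (intro msec_sum[OF T2] hom_facts) auto
  ultimately have AEg: "AE x in m. \<Psi> ?g x = (\<lambda>j. \<Sum>i\<in>A. c i x * \<Psi> (f i) x j)"
    using sec_class_eq_iff[OF T2 hom_facts(1)[OF g] g'] by blast
  have ck: "c k \<in> borel_measurable m" and fk: "f k \<in> msec T1" using insert.prems by auto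
  have "(sec_class m T2 (\<Psi> ?h) :: ('x, 'u) melem) = sec_class m T2 (\<lambda>x j. c k x * \<Psi> (f k) x j)"
    using hom_scale[OF ck fk] unfolding hom_facts(2)[OF h] .
  then have AEh: "AE x in m. \<Psi> ?h x = (\<lambda>j. c k x * \<Psi> (f k) x j)"
    using sec_class_eq_iff[OF T2 hom_facts(1)[OF h] msec_scale[OF T2 ck hom_facts(1)[OF fk]]] by blast
  have "\<Phi> (sec_class m T1 (\<lambda>x j. ?h x j + ?g x j)) = sec_class m T2 (\<lambda>x j. \<Psi> ?h x j + \<Psi> ?g x j)"
    by (rule hom_add[OF h g])
  also have "\<dots> = sec_class m T2 (\<lambda>x j. \<Sum>i\<in>insert k A. c i x * \<Psi> (f i) x j)"
  proof (rule sec_class_cong[OF T2])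
    show "AE x in m. (\<lambda>j. \<Psi> ?h x j + \<Psi> ?g x j) = (\<lambda>j. \<Sum>i\<in>insert k A. c i x * \<Psi> (f i) x j)"
      using AEg AEh by eventually_elim (simp add: insert.hyps)
    show "(\<lambda>x j. \<Psi> ?h x j + \<Psi> ?g x j) \<in> msec T2" by (intro msec_add[OF T2] hom_facts g h)
    show "(\<lambda>x j. \<Sum>i\<in>insert k A. c i x * \<Psi> (f i) x j) \<in> msec T2"
      using insert.prems by (intro msec_sum[OF T2] hom_facts) auto
  qed
  finally show ?case using insert.hyps by simp
qed

text \<open>With unbounded dimension \<open>f\<close> need not be a finite combination of the frame.
  Multiplied by the indicator of \<open>part T1 n\<close> it is one with \<open>n\<close> terms, to
  which linearity applies; the null sets of the countably many \<open>n\<close> are then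
  united.\<close>

private lemma hom_frame:
  assumes f: "f \<in> msec T1"
  shows "AE x in m. \<Psi> f x = (\<lambda>j. \<Sum>i<bdim T1 x. f x i * \<Psi> (frame T1 i) x j)"
proof -
  have "AE x in m. \<forall>n. bdim T1 x = n \<longrightarrow> \<Psi> f x = (\<lambda>j. \<Sum>i<n. f x i * \<Psi> (frame T1 i) x j)"
    unfolding AE_all_countable
  proof
    fix n
    let ?\<chi> = "indicator (part T1 n) :: 'x \<Rightarrow> real"
    have \<chi>: "?\<chi> \<in> borel_measurable m"
      using part_measurable[OF T1] by (intro borel_measurable_indicator) (simp add: sets_m)
    have c: "(\<lambda>x. ?\<chi> x * f x i) \<in> borel_measurable m" for i
      using \<chi> msec_measurable[OF T1 f] unfolding measurable_m by (intro borel_measurable_times) auto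
    have eq: "(\<lambda>x j. ?\<chi> x * f x j) = (\<lambda>x j. \<Sum>i<n. (?\<chi> x * f x i) * frame T1 i x j)"
    proof (intro ext)
      fix x j
      show "?\<chi> x * f x j = (\<Sum>i<n. (?\<chi> x * f x i) * frame T1 i x j)"
      proof (cases "x \<in> part T1 n")
        case True
        then show ?thesis
          using fun_cong[OF frame_expand[OF T1 f, of x], of j] in_part_iff[OF T1] by simp
      qed simp
    qed
    have "(sec_class m T2 (\<lambda>x j. ?\<chi> x * \<Psi> f x j) :: ('x, 'u) melem) =
        sec_class m T2 (\<lambda>x j. \<Sum>i<n. (?\<chi> x * f x i) * \<Psi> (frame T1 i) x j)"
      unfolding hom_scale[OF \<chi> f, symmetric] eq
      by (rule hom_sum) (auto intro: c frame_msec[OF T1])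
    then have "AE x in m. (\<lambda>j. ?\<chi> x * \<Psi> f x j) = (\<lambda>j. \<Sum>i<n. (?\<chi> x * f x i) * \<Psi> (frame T1 i) x j)"
      by (subst (asm) sec_class_eq_iff[OF T2])
        (auto intro!: msec_scale[OF T2] msec_sum[OF T2] hom_facts \<chi> c f frame_msec[OF T1])
    then show "AE x in m. bdim T1 x = n \<longrightarrow> \<Psi> f x = (\<lambda>j. \<Sum>i<n. f x i * \<Psi> (frame T1 i) x j)"
    proof eventually_elim
      case (elim x)
      show ?case
      proof
        assume "bdim T1 x = n"
        then have "x \<in> part T1 n" by (simp add: in_part_iff[OF T1])
        then show "\<Psi> f x = (\<lambda>j. \<Sum>i<n. f x i * \<Psi> (frame T1 i) x j)" using elim by simp
      qed
    qed
  qed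
  then show ?thesis by eventually_elim simp
qed

private definition \<phi> :: "'x \<times> (nat \<Rightarrow> real) \<Rightarrow> 'x \<times> (nat \<Rightarrow> real)" where
  "\<phi> z = (fst z, \<lambda>j. \<Sum>i<bdim T1 (fst z). snd z i * \<Psi> (frame T1 i) (fst z) j)"

private lemma frame_image: "\<Psi> (frame T1 i) \<in> msec T2"
  by (intro hom_facts frame_msec[OF T1])

private lemma \<phi>_measurable: "\<phi> \<in> total_space T1 \<rightarrow>\<^sub>M total_space T2"
  unfolding measurable_into_total_space[OF T2]
proof (intro conjI ballI)
  have "\<phi> \<in> borel \<rightarrow>\<^sub>M borel \<Otimes>\<^sub>M borel"
    unfolding \<phi>_def[abs_def]
  proof (rule measurable_Pair)
    show "fst \<in> (borel :: ('x \<times> (nat \<Rightarrow> real)) measure) \<rightarrow>\<^sub>M borel" by (rule borel_fst)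
    show "(\<lambda>z. \<lambda>j. \<Sum>i<bdim T1 (fst z). snd z i * \<Psi> (frame T1 i) (fst z) j) \<in>
        (borel :: ('x \<times> (nat \<Rightarrow> real)) measure) \<rightarrow>\<^sub>M borel"
    proof (subst measurable_fun_iff, intro allI)
      fix j
      have 1: "(\<lambda>z. \<Sum>i<n. snd z i * \<Psi> (frame T1 i) (fst z) j) \<in>
          (borel :: ('x \<times> (nat \<Rightarrow> real)) measure) \<rightarrow>\<^sub>M borel" for n
        using measurable_compose[OF borel_snd coordinate_measurable]
          measurable_compose[OF borel_fst msec_measurable[OF T2 frame_image]]
        by (intro borel_measurable_sum borel_measurable_times) auto
      show "(\<lambda>z. \<Sum>i<bdim T1 (fst z). snd z i * \<Psi> (frame T1 i) (fst z) j) \<in>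
          (borel :: ('x \<times> (nat \<Rightarrow> real)) measure) \<rightarrow>\<^sub>M borel"
        by (rule measurable_compose_countable[OF 1 measurable_compose[OF borel_fst bdim_measurable[OF T1]]])
    qed
  qed
  then show "\<phi> \<in> total_space T1 \<rightarrow>\<^sub>M borel"
    unfolding measurable_total_space[OF T1] borel_prod by (rule measurable_restrict_space1)
  fix z
  show "\<phi> z \<in> total_set T2"
    unfolding total_set_iff[OF T2] \<phi>_def using msec_Rn[OF T2 frame_image] by (auto intro!: Rn_sum)
qed

private lemma \<phi>_contraction:
  "AE x in m. \<forall>v\<in>Rn (bdim T1 x). bnorm T2 (x, snd (\<phi> (x, v))) \<le> bnorm T1 (x, v)"
proof -
  have "AE x in m. \<forall>n. \<forall>q\<in>Qn n. bdim T1 x = n \<longrightarrow> bnorm T2 (x, snd (\<phi> (x, q))) \<le> bnorm T1 (x, q)"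
    unfolding AE_all_countable AE_ball_countable[OF countable_Qn]
  proof (intro allI ballI)
    fix n q assume q: "q \<in> Qn n"
    \<comment> \<open>The constant section \<open>q\<close>, cut off outside
      \<open>part T1 n\<close> because \<open>q\<close> need not belong to the other fibres.\<close>
    define f where "f x j = indicator (part T1 n) x * q j" for x j
    have f: "f \<in> msec T1"
      unfolding msec_iff[OF T1]
    proof (intro conjI allI impI)
      show "(\<lambda>x. f x j) \<in> borel_measurable borel" for j
        unfolding f_def using part_measurable[OF T1] by measurable
      show "f x j = 0" if "bdim T1 x \<le> j" for x j
        using that q in_part_iff[OF T1, of x n] by (auto simp: f_def Qn_def Rn_iff indicator_def)
    qed
    show "AE x in m. bdim T1 x = n \<longrightarrow> bnorm T2 (x, snd (\<phi> (x, q))) \<le> bnorm T1 (x, q)"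
      using hom_facts(3)[OF f] hom_frame[OF f]
    proof eventually_elim
      case (elim x)
      show ?case
      proof
        assume "bdim T1 x = n"
        then have fx: "f x = q" using in_part_iff[OF T1, of x n] by (auto simp: f_def)
        have "\<Psi> f x = snd (\<phi> (x, q))" unfolding elim(2) \<phi>_def by (simp add: fx)
        then show "bnorm T2 (x, snd (\<phi> (x, q))) \<le> bnorm T1 (x, q)" using elim(1) fx by simp
      qed
    qed
  qed
  then show ?thesis using AE_seminorm[OF T1] AE_seminorm[OF T2]
  proof eventually_elim
    case (elim x)
    show ?case
    proof
      fix v assume v: "v \<in> Rn (bdim T1 x)"
      have N: "seminorm_on_Rn (bdim T1 x) (\<lambda>v. bnorm T2 (x, \<lambda>j. \<Sum>i<bdim T1 x. v i * \<Psi> (frame T1 i) x j))"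
        using elim(3) msec_Rn[OF T2 frame_image] by (rule seminorm_on_Rn_linear)
      have "bnorm T2 (x, \<lambda>j. \<Sum>i<bdim T1 x. v i * \<Psi> (frame T1 i) x j) \<le> bnorm T1 (x, v)"
        by (rule seminorm_le_of_le_on_Qn[OF N elim(2) _ v]) (use elim(1) in \<open>simp add: \<phi>_def\<close>)
      then show "bnorm T2 (x, snd (\<phi> (x, v))) \<le> bnorm T1 (x, v)" by (simp add: \<phi>_def)
    qed
  qed
qed

private lemma \<phi>_premorphism: "\<phi> \<in> premorphisms m T1 T2"
  unfolding premorphisms_def
proof (intro CollectI conjI ballI)
  show "\<phi> \<in> total_space T1 \<rightarrow>\<^sub>M total_space T2" by (rule \<phi>_measurable)
  show "fst (\<phi> z) = fst z" for z by (simp add: \<phi>_def)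
  \<comment> \<open>The matrix formula is linear on every fibre, without exception; only the
    contraction property costs a null set.\<close>
  have lin: "linear_on_fiber T1 \<phi> x" for x
    by (rule linear_on_fiberI[OF T1])
      (simp_all add: \<phi>_def distrib_right sum.distrib sum_distrib_left mult.assoc)
  show "AE x in m. linear_on_fiber T1 \<phi> x \<and> lipschitz_on_fiber T1 T2 \<phi> x"
    using \<phi>_contraction
  proof eventually_elim
    case (elim x)
    have "bnorm T2 (x, \<lambda>i. snd (\<phi> (x, v)) i - snd (\<phi> (x, w)) i) \<le> bnorm T1 (x, \<lambda>i. v i - w i)"
      if "v \<in> Rn (bdim T1 x)" "w \<in> Rn (bdim T1 x)" for v w
      using bspec[OF elim Rn_diff[OF that]] unfolding linear_on_fiber_diff[OF T1 lin that] .
    then show ?case using lin unfolding lipschitz_on_fiber_def fiber_eq[OF T1] by blast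
  qed
qed

lemma section_functor_full:
  "\<exists>\<phi>\<in>premorphisms m T1 T2. farr (section_functor m) T1 T2 (bundle_arrow T1 T2 \<phi>) = \<Phi>"
proof (rule bexI[OF _ \<phi>_premorphism], rule extensionalityI)
  show "farr (section_functor m) T1 T2 (bundle_arrow T1 T2 \<phi>) \<in> extensional (carrier (section_module m T1))"
    by (simp add: section_functor_def)
  show "\<Phi> \<in> extensional (carrier (section_module m T1))"
    using \<Phi> by (auto simp: nmod_hom_def PiE_def)
  fix S :: "('x, 'u) melem" assume "S \<in> carrier (section_module m T1)"
  then obtain f where f: "f \<in> msec T1" "S = sec_class m T1 f" by (rule section_cases[OF T1])
  have "AE x in m. push \<phi> f x = \<Psi> f x"
    using hom_frame[OF f(1)] by eventually_elim (simp add: push_def \<phi>_def)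
  then show "farr (section_functor m) T1 T2 (bundle_arrow T1 T2 \<phi>) S = \<Phi> S"
    unfolding f(2) farr_section_functor[OF T1 T2 \<phi>_premorphism f(1)] hom_facts(2)[OF f(1)]
    by (intro sec_class_cong[OF T2] push_msec[OF T1 T2 \<phi>_premorphism] hom_facts f)
qed

end

end

section \<open>Abstract normed modules\<close>

lemma (in abelian_group) minus_eq_zero_iff:
  assumes "v \<in> carrier G" "w \<in> carrier G" shows "v \<ominus> w = \<zero> \<longleftrightarrow> v = w"
proof
  assume "v \<ominus> w = \<zero>"
  moreover have "(v \<ominus> w) \<oplus> w = v" using assms by (simp add: a_minus_def a_assoc l_neg)
  ultimately show "v = w" using assms by simp
qed (use assms in \<open>simp add: a_minus_def r_neg\<close>)

lemma (in abelian_group) minus_zero_right: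
  assumes "v \<in> carrier G" shows "v \<ominus> \<zero> = v"
proof -
  have "\<ominus> \<zero> = \<zero>" by (rule minus_equality) simp_all
  then show ?thesis using assms by (simp add: a_minus_def)
qed

abbreviation nrm :: "('x, 'v) L0_nmodule \<Rightarrow> 'v \<Rightarrow> 'x \<Rightarrow> real" where
  "nrm M v \<equiv> rep (pnorm M v)"

context mm_space
begin

context
  fixes M :: "('x, 'v) L0_nmodule"
  assumes M: "normed_L0_module m M"
begin

lemma normed_module: "Module.module (L0 m) M"
  using M by (simp add: normed_L0_module_def)

lemma pnorm_in: "v \<in> carrier M \<Longrightarrow> pnorm M v \<in> carrier (L0 m)"
  using M by (auto simp: normed_L0_module_def)

lemma nrm_measurable: "v \<in> carrier M \<Longrightarrow> nrm M v \<in> borel_measurable m"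
  by (intro rep_L0_measurable pnorm_in)

lemma nrm_nonneg:
  assumes "v \<in> carrier M" shows "AE x in m. 0 \<le> nrm M v x"
proof -
  have "L0_le m \<zero>\<^bsub>L0 m\<^esub> (pnorm M v)" using M assms by (simp add: normed_L0_module_def)
  moreover have "AE x in m. rep (\<zero>\<^bsub>L0 m\<^esub>) x = 0" unfolding L0_sel by (rule AE_rep_L0_class) simp
  ultimately show ?thesis unfolding L0_le_def by eventually_elim simp
qed

lemma nrm_smult:
  assumes f: "f \<in> borel_measurable m" and v: "v \<in> carrier M"
  shows "AE x in m. nrm M (L0_class m f \<odot>\<^bsub>M\<^esub> v) x = \<bar>f x\<bar> * nrm M v x"
proof -
  have "pnorm M (L0_class m f \<odot>\<^bsub>M\<^esub> v) = L0_abs m (L0_class m f) \<otimes>\<^bsub>L0 m\<^esub> pnorm M v"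
    using M v L0_class_in[OF f] unfolding normed_L0_module_def by simp
  also have "\<dots> = L0_class m (\<lambda>x. \<bar>f x\<bar>) \<otimes>\<^bsub>L0 m\<^esub> L0_class m (nrm M v)"
    using f v by (simp add: L0_abs_class L0_class_rep pnorm_in)
  also have "\<dots> = L0_class m (\<lambda>x. \<bar>f x\<bar> * nrm M v x)"
    by (intro L0_mult borel_measurable_abs f nrm_measurable v)
  finally show ?thesis
    using AE_rep_L0_class[OF borel_measurable_times[OF borel_measurable_abs[OF f] nrm_measurable[OF v]]]
    by simp
qed

lemma ex_metric_prob:
  obtains m' where "equiv_prob m'" "Metric_space (carrier M) (nmod_dist m' M)"
    "Metric_space.mcomplete (carrier M) (nmod_dist m' M)"
  using M unfolding normed_L0_module_def equiv_prob_def by blast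

lemma smult_in: "f \<in> borel_measurable m \<Longrightarrow> v \<in> carrier M \<Longrightarrow> L0_class m f \<odot>\<^bsub>M\<^esub> v \<in> carrier M"
  using module.smult_closed[OF normed_module] L0_class_in by blast

lemma abelian_group_normed: "abelian_group M"
  using normed_module by (simp add: module_def)

lemma uminus_eq_smult:
  assumes "v \<in> carrier M" shows "\<ominus>\<^bsub>M\<^esub> v = L0_class m (\<lambda>_. - 1) \<odot>\<^bsub>M\<^esub> v"
proof -
  have "L0_class m (\<lambda>_. - 1) = \<ominus>\<^bsub>L0 m\<^esub> \<one>\<^bsub>L0 m\<^esub>" by (simp add: L0_sel(2) L0_a_minus)
  then have "L0_class m (\<lambda>_. - 1) \<odot>\<^bsub>M\<^esub> v = \<ominus>\<^bsub>M\<^esub> (\<one>\<^bsub>L0 m\<^esub> \<odot>\<^bsub>M\<^esub> v)"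
    using module.smult_l_minus[OF normed_module _ assms, of "\<one>\<^bsub>L0 m\<^esub>"] L0_class_in[of "\<lambda>_. 1" m]
    by (simp add: L0_sel(2))
  then show ?thesis using module.smult_one[OF normed_module assms] by simp
qed

lemma nrm_uminus:
  assumes "v \<in> carrier M" shows "AE x in m. nrm M (\<ominus>\<^bsub>M\<^esub> v) x = nrm M v x"
  unfolding uminus_eq_smult[OF assms] using nrm_smult[of "\<lambda>_. - 1", OF _ assms] by simp

text \<open>Definiteness of the pointwise norm is not an axiom either. The distance of
  \<open>v\<close> from zero is the integral of the truncated norm, and the distance separates
  points.\<close>

lemma nrm_eq_0_iff:
  assumes v: "v \<in> carrier M" shows "(AE x in m. nrm M v x = 0) \<longleftrightarrow> v = \<zero>\<^bsub>M\<^esub>"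
proof -
  interpret abelian_group M by (rule abelian_group_normed)
  obtain m' where m': "equiv_prob m'" "Metric_space (carrier M) (nmod_dist m' M)"
    by (rule ex_metric_prob)
  have "v = \<zero>\<^bsub>M\<^esub> \<longleftrightarrow> nmod_dist m' M v \<zero>\<^bsub>M\<^esub> = 0"
    using Metric_space.zero[OF m'(2) v zero_closed] by simp
  also have "\<dots> \<longleftrightarrow> (\<integral>x. min (nrm M v x) 1 \<partial>m') = 0"
    using v by (simp add: nmod_dist_def minus_zero_right)
  also have "\<dots> \<longleftrightarrow> (AE x in m. nrm M v x = 0)"
    by (intro integral_min_eq_0_iff m' nrm_measurable nrm_nonneg v)
  finally show ?thesis by simp
qed

lemma chi_smult_in: "A \<in> sets m \<Longrightarrow> v \<in> carrier M \<Longrightarrow> chi m A \<odot>\<^bsub>M\<^esub> v \<in> carrier M"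
  unfolding chi_def by (intro smult_in borel_measurable_indicator)

lemma nrm_chi:
  assumes "A \<in> sets m" "v \<in> carrier M"
  shows "AE x in m. nrm M (chi m A \<odot>\<^bsub>M\<^esub> v) x = indicator A x * nrm M v x"
  using nrm_smult[OF borel_measurable_indicator[OF assms(1)] assms(2)] unfolding chi_def
  by eventually_elim (simp add: indicator_def)

text \<open>The pointwise triangle inequality is not an axiom: it comes from the triangle inequality for
  the distance, tested on all multiples by \<open>t * indicator A\<close>, with \<open>t\<close> small enough that the
  truncation at \<open>1\<close> does not matter.\<close>

lemma nrm_triangle:
  assumes v: "v \<in> carrier M" and w: "w \<in> carrier M"
  shows "AE x in m. nrm M (v \<oplus>\<^bsub>M\<^esub> w) x \<le> nrm M v x + nrm M w x"
proof -
  interpret abelian_group M by (rule abelian_group_normed)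
  obtain m' where m': "equiv_prob m'" "Metric_space (carrier M) (nmod_dist m' M)"
    by (rule ex_metric_prob)
  interpret Metric_space "carrier M" "nmod_dist m' M" by (rule m'(2))
  have vw: "v \<oplus>\<^bsub>M\<^esub> w \<in> carrier M" using v w by simp
  have meas: "nrm M u \<in> borel_measurable m'" if "u \<in> carrier M" for u
    using nrm_measurable[OF that] unfolding measurable_m equiv_prob_facts(3)[OF m'(1)] .
  \<comment> \<open>The triangle inequality of the distance for the points \<open>c (v + w)\<close>,
    \<open>c w\<close> and zero.\<close>
  have key: "(\<integral>x. min (\<bar>c x\<bar> * nrm M (v \<oplus>\<^bsub>M\<^esub> w) x) 1 \<partial>m') \<le>
      (\<integral>x. min (\<bar>c x\<bar> * nrm M v x) 1 \<partial>m') + (\<integral>x. min (\<bar>c x\<bar> * nrm M w x) 1 \<partial>m')"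
    if c: "c \<in> borel_measurable m" for c
  proof -
    let ?C = "L0_class m c"
    have cm: "c \<in> borel_measurable m'" using c unfolding measurable_m equiv_prob_facts(3)[OF m'(1)] .
    have in_M: "?C \<odot>\<^bsub>M\<^esub> v \<in> carrier M" "?C \<odot>\<^bsub>M\<^esub> w \<in> carrier M" by (intro smult_in c v w)+
    have add: "?C \<odot>\<^bsub>M\<^esub> (v \<oplus>\<^bsub>M\<^esub> w) = ?C \<odot>\<^bsub>M\<^esub> v \<oplus>\<^bsub>M\<^esub> ?C \<odot>\<^bsub>M\<^esub> w"
      by (intro module.smult_r_distr[OF normed_module] L0_class_in c v w)
    have int: "(\<integral>x. min (nrm M (?C \<odot>\<^bsub>M\<^esub> u) x) 1 \<partial>m') = (\<integral>x. min (\<bar>c x\<bar> * nrm M u x) 1 \<partial>m')"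
      if u: "u \<in> carrier M" for u
    proof (rule integral_cong_AE)
      show "AE x in m'. min (nrm M (?C \<odot>\<^bsub>M\<^esub> u) x) 1 = min (\<bar>c x\<bar> * nrm M u x) 1"
        using nrm_smult[OF c u] unfolding AE_equiv_prob[OF m'(1)] by eventually_elim simp
    qed (intro borel_measurable_min borel_measurable_times borel_measurable_abs borel_measurable_const
        meas smult_in c cm u)+
    have "nmod_dist m' M (?C \<odot>\<^bsub>M\<^esub> (v \<oplus>\<^bsub>M\<^esub> w)) \<zero>\<^bsub>M\<^esub> \<le>
        nmod_dist m' M (?C \<odot>\<^bsub>M\<^esub> (v \<oplus>\<^bsub>M\<^esub> w)) (?C \<odot>\<^bsub>M\<^esub> w) + nmod_dist m' M (?C \<odot>\<^bsub>M\<^esub> w) \<zero>\<^bsub>M\<^esub>"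
      by (intro triangle smult_in c vw w zero_closed)
    moreover have "nmod_dist m' M u \<zero>\<^bsub>M\<^esub> = (\<integral>x. min (nrm M u x) 1 \<partial>m')" if "u \<in> carrier M" for u
      using that by (simp add: nmod_dist_def minus_zero_right)
    moreover have "nmod_dist m' M (?C \<odot>\<^bsub>M\<^esub> (v \<oplus>\<^bsub>M\<^esub> w)) (?C \<odot>\<^bsub>M\<^esub> w) =
        (\<integral>x. min (nrm M (?C \<odot>\<^bsub>M\<^esub> v) x) 1 \<partial>m')"
      using in_M smult_in[OF c vw] by (simp add: nmod_dist_def add a_minus_def a_assoc r_neg)
    ultimately show ?thesis using int v w vw smult_in[OF c] by simp
  qed
  have "AE x in m. \<forall>k. min (nrm M (v \<oplus>\<^bsub>M\<^esub> w) x / real (Suc k)) 1 \<le>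
      min (nrm M v x / real (Suc k)) 1 + min (nrm M w x / real (Suc k)) 1"
    unfolding AE_all_countable
  proof
    fix k
    define F where "F u x = min (nrm M u x / real (Suc k)) 1" for u x
    \<comment> \<open>The set where the truncated inequality fails at scale
      \<open>1 / (k + 1)\<close>. Tested with a multiplier supported on it, \<open>key\<close>
      bounds the integral of the nonnegative function \<open>?h\<close> by 0. So \<open>?h\<close>
      vanishes almost everywhere, while it is positive on \<open>A\<close>.\<close>
    define A where "A = {x. F v x + F w x < F (v \<oplus>\<^bsub>M\<^esub> w) x}"
    have F_meas: "F u \<in> borel_measurable borel" if "u \<in> carrier M" for u
      using nrm_measurable[OF that] unfolding measurable_m F_def
      by (intro borel_measurable_min borel_measurable_divide borel_measurable_const)
    have "{x \<in> space borel. F v x + F w x < F (v \<oplus>\<^bsub>M\<^esub> w) x} \<in> sets borel"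
      by (intro borel_measurable_less borel_measurable_add F_meas v w vw)
    then have A: "A \<in> sets borel" by (simp add: A_def)
    define c where "c x = 1 / real (Suc k) * indicator A x" for x
    have c: "c \<in> borel_measurable m" unfolding measurable_m c_def using A by measurable
    have cF: "min (\<bar>c x\<bar> * nrm M u x) 1 = indicator A x * F u x" for u x
      by (simp add: c_def F_def indicator_def)
    have int: "integrable m' (\<lambda>x. indicator A x * F u x)" if "u \<in> carrier M" for u
    proof -
      have "AE x in m. 0 \<le> nrm M u x / real (Suc k)"
        using nrm_nonneg[OF that] by eventually_elim simp
      then have "integrable m' (F u)"
        using nrm_measurable[OF that] unfolding F_def
        by (intro integrable_min[OF m'(1)] borel_measurable_divide borel_measurable_const)
      moreover have "A \<in> sets m'" using A by (simp add: equiv_prob_facts(2)[OF m'(1)])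
      ultimately have "integrable m' (\<lambda>x. indicator A x *\<^sub>R F u x)"
        by (intro integrable_mult_indicator)
      then show ?thesis by simp
    qed
    let ?h = "\<lambda>x. indicator A x * F (v \<oplus>\<^bsub>M\<^esub> w) x - (indicator A x * F v x + indicator A x * F w x)"
    have int_h: "integrable m' ?h"
      by (intro Bochner_Integration.integrable_diff Bochner_Integration.integrable_add int v w vw)
    have h_nn: "0 \<le> ?h x" for x by (auto simp: A_def indicator_def)
    have "(\<integral>x. ?h x \<partial>m') = (\<integral>x. indicator A x * F (v \<oplus>\<^bsub>M\<^esub> w) x \<partial>m') -
        ((\<integral>x. indicator A x * F v x \<partial>m') + (\<integral>x. indicator A x * F w x \<partial>m'))"
      using int v w vw by simp
    also have "\<dots> \<le> 0" using key[OF c] unfolding cF by simp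
    finally have "(\<integral>x. ?h x \<partial>m') = 0"
      using integral_nonneg_AE[of ?h m'] h_nn by (intro antisym) auto
    then have "AE x in m'. ?h x = 0"
      using integral_nonneg_eq_0_iff_AE[OF int_h] h_nn by simp
    then have "AE x in m. ?h x = 0" by (simp only: AE_equiv_prob[OF m'(1)])
    then have "AE x in m. F (v \<oplus>\<^bsub>M\<^esub> w) x \<le> F v x + F w x"
    proof eventually_elim
      case (elim x)
      show ?case
      proof (rule ccontr)
        assume *: "\<not> F (v \<oplus>\<^bsub>M\<^esub> w) x \<le> F v x + F w x"
        then have "x \<in> A" by (simp add: A_def)
        then show False using elim * by simp
      qed
    qed
    then show "AE x in m. min (nrm M (v \<oplus>\<^bsub>M\<^esub> w) x / real (Suc k)) 1 \<le>
        min (nrm M v x / real (Suc k)) 1 + min (nrm M w x / real (Suc k)) 1"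
      by (simp only: F_def)
  qed
  then show ?thesis using nrm_nonneg[OF v] nrm_nonneg[OF w]
  proof eventually_elim
    case (elim x)
    \<comment> \<open>For this \<open>k\<close> the truncation is inactive on the left, and on the
      right it may simply be dropped since it only decreases the terms.\<close>
    obtain k where k: "nrm M (v \<oplus>\<^bsub>M\<^esub> w) x < real k" using reals_Archimedean2 by blast
    have "nrm M (v \<oplus>\<^bsub>M\<^esub> w) x / real (Suc k) \<le> 1" using k by (simp add: field_simps)
    then have "nrm M (v \<oplus>\<^bsub>M\<^esub> w) x / real (Suc k) =
        min (nrm M (v \<oplus>\<^bsub>M\<^esub> w) x / real (Suc k)) 1" by (simp only: min_absorb1)
    also have "\<dots> \<le> min (nrm M v x / real (Suc k)) 1 + min (nrm M w x / real (Suc k)) 1"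
      using elim(1) by blast
    also have "\<dots> \<le> nrm M v x / real (Suc k) + nrm M w x / real (Suc k)"
      by (intro add_mono min.cobounded1)
    also have "\<dots> = (nrm M v x + nrm M w x) / real (Suc k)" by (simp add: add_divide_distrib)
    finally show ?case by (simp add: divide_le_cancel del: of_nat_Suc)
  qed
qed

lemma nrm_abs_diff:
  assumes v: "v \<in> carrier M" and w: "w \<in> carrier M"
  shows "AE x in m. \<bar>nrm M v x - nrm M w x\<bar> \<le> nrm M (v \<ominus>\<^bsub>M\<^esub> w) x"
proof -
  interpret abelian_group M by (rule abelian_group_normed)
  have in_M: "v \<ominus>\<^bsub>M\<^esub> w \<in> carrier M" using v w by simp
  have 1: "(v \<ominus>\<^bsub>M\<^esub> w) \<oplus>\<^bsub>M\<^esub> w = v" using v w by (simp add: a_minus_def a_assoc l_neg)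
  have 2: "\<ominus>\<^bsub>M\<^esub> (v \<ominus>\<^bsub>M\<^esub> w) \<oplus>\<^bsub>M\<^esub> v = w"
  proof -
    have "\<ominus>\<^bsub>M\<^esub> (v \<ominus>\<^bsub>M\<^esub> w) \<oplus>\<^bsub>M\<^esub> v = (\<ominus>\<^bsub>M\<^esub> v \<oplus>\<^bsub>M\<^esub> w) \<oplus>\<^bsub>M\<^esub> v"
      using v w by (simp add: a_minus_def minus_add)
    also have "\<dots> = w \<oplus>\<^bsub>M\<^esub> (\<ominus>\<^bsub>M\<^esub> v \<oplus>\<^bsub>M\<^esub> v)" using v w by (simp add: a_ac)
    also have "\<dots> = w" using v w by (simp add: l_neg)
    finally show ?thesis .
  qed
  show ?thesis
    using nrm_triangle[OF in_M w] nrm_triangle[OF a_inv_closed[OF in_M] v] nrm_uminus[OF in_M]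
    unfolding 1 2 by eventually_elim linarith
qed

lemma nrm_zero: "AE x in m. nrm M \<zero>\<^bsub>M\<^esub> x = 0"
  using nrm_eq_0_iff[of "\<zero>\<^bsub>M\<^esub>"] abelian_monoid.zero_closed[OF abelian_group.axioms(1)[OF abelian_group_normed]]
  by simp

lemma nrm_finsum:
  assumes "finite A" "\<And>i. i \<in> A \<Longrightarrow> f i \<in> borel_measurable m" "\<And>i. i \<in> A \<Longrightarrow> a i \<in> carrier M"
  shows "AE x in m. nrm M (\<Oplus>\<^bsub>M\<^esub>i\<in>A. L0_class m (f i) \<odot>\<^bsub>M\<^esub> a i) x \<le> (\<Sum>i\<in>A. \<bar>f i x\<bar> * nrm M (a i) x)"
  using assms
proof (induction A rule: finite_induct)
  case empty
  then show ?case using nrm_zero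
    by (simp add: abelian_monoid.finsum_empty[OF abelian_group.axioms(1)[OF abelian_group_normed]] 
        eventually_mono[OF nrm_zero])
next
  case (insert k A)
  have in_M: "L0_class m (f i) \<odot>\<^bsub>M\<^esub> a i \<in> carrier M" if "i \<in> insert k A" for i
    using insert.prems that by (intro smult_in) auto
  have sum_in: "(\<Oplus>\<^bsub>M\<^esub>i\<in>A. L0_class m (f i) \<odot>\<^bsub>M\<^esub> a i) \<in> carrier M"
    using in_M by (intro abelian_monoid.finsum_closed[OF abelian_group.axioms(1)[OF abelian_group_normed]]) auto
  have eq: "(\<Oplus>\<^bsub>M\<^esub>i\<in>insert k A. L0_class m (f i) \<odot>\<^bsub>M\<^esub> a i) =
      L0_class m (f k) \<odot>\<^bsub>M\<^esub> a k \<oplus>\<^bsub>M\<^esub> (\<Oplus>\<^bsub>M\<^esub>i\<in>A. L0_class m (f i) \<odot>\<^bsub>M\<^esub> a i)"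
    using insert.hyps in_M
    by (intro abelian_monoid.finsum_insert[OF abelian_group.axioms(1)[OF abelian_group_normed]]) auto
  have k: "f k \<in> borel_measurable m" "a k \<in> carrier M" using insert.prems by auto
  have "AE x in m. nrm M (\<Oplus>\<^bsub>M\<^esub>i\<in>A. L0_class m (f i) \<odot>\<^bsub>M\<^esub> a i) x \<le> (\<Sum>i\<in>A. \<bar>f i x\<bar> * nrm M (a i) x)"
    using insert by auto
  then show ?case
    unfolding eq using nrm_triangle[OF smult_in[OF k] sum_in] nrm_smult[OF k]
    by eventually_elim (use insert.hyps in simp)
qed

text \<open>Locality along a countable cover: the pointwise norm of the difference vanishes almost
  everywhere on each piece, hence almost everywhere.\<close>

lemma eq_if_chi_eq:
  assumes v: "v \<in> carrier M" and w: "w \<in> carrier M"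
    and P: "\<And>n::nat. P n \<in> sets m" "(\<Union>n. P n) = UNIV"
    and eq: "\<And>n. chi m (P n) \<odot>\<^bsub>M\<^esub> v = chi m (P n) \<odot>\<^bsub>M\<^esub> w"
  shows "v = w"
proof -
  interpret module "L0 m" M by (rule normed_module)
  have in_M: "v \<ominus>\<^bsub>M\<^esub> w \<in> carrier M" using v w by simp
  have *: "chi m (P n) \<odot>\<^bsub>M\<^esub> (v \<ominus>\<^bsub>M\<^esub> w) = \<zero>\<^bsub>M\<^esub>" for n
    using v w chi_in[OF P(1)] chi_smult_in[OF P(1)] eq[of n]
    by (simp add: a_minus_def smult_r_distr smult_r_minus M.r_neg)
  have "AE x in m. \<forall>n. indicator (P n) x * nrm M (v \<ominus>\<^bsub>M\<^esub> w) x = 0"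
    unfolding AE_all_countable
  proof
    fix n
    show "AE x in m. indicator (P n) x * nrm M (v \<ominus>\<^bsub>M\<^esub> w) x = 0"
      using nrm_chi[OF P(1) in_M, of n] nrm_zero unfolding * by eventually_elim simp
  qed
  then have "AE x in m. nrm M (v \<ominus>\<^bsub>M\<^esub> w) x = 0"
  proof eventually_elim
    case (elim x)
    obtain n where "x \<in> P n" using P(2) by blast
    then show ?case using elim[rule_format, of n] by simp
  qed
  then have "v \<ominus>\<^bsub>M\<^esub> w = \<zero>\<^bsub>M\<^esub>" using nrm_eq_0_iff[OF in_M] by simp
  then show ?thesis using M.minus_eq_zero_iff[OF v w] by simp
qed

text \<open>The partial sums \<open>V\<close> of the pieces form a Cauchy sequence, because they
  stabilise on each \<open>P j\<close> and the part of the space not yet reached has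
  \<open>m'\<close>-measure tending to 0. Their limit glues the \<open>u n\<close>, since
  multiplication by \<open>chi\<close> is continuous.\<close>

lemma glueing:
  assumes P: "\<And>n::nat. P n \<in> sets m" "disjoint_family P" "(\<Union>n. P n) = UNIV"
    and u: "\<And>n. u n \<in> carrier M"
  shows "\<exists>v\<in>carrier M. \<forall>n. chi m (P n) \<odot>\<^bsub>M\<^esub> v = chi m (P n) \<odot>\<^bsub>M\<^esub> u n"
proof -
  interpret module "L0 m" M by (rule normed_module)
  obtain m' where m': "equiv_prob m'" "Metric_space (carrier M) (nmod_dist m' M)"
    "Metric_space.mcomplete (carrier M) (nmod_dist m' M)" by (rule ex_metric_prob)
  interpret prob_space m' by (rule equiv_prob_facts(1)[OF m'(1)])
  interpret Metric_space "carrier M" "nmod_dist m' M" by (rule m'(2))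
  have chi_R: "chi m (P n) \<in> carrier (L0 m)" for n by (rule chi_in[OF P(1)])
  define V where "V = rec_nat \<zero>\<^bsub>M\<^esub> (\<lambda>n v. v \<oplus>\<^bsub>M\<^esub> chi m (P n) \<odot>\<^bsub>M\<^esub> u n)"
  have V0: "V 0 = \<zero>\<^bsub>M\<^esub>" and VS: "V (Suc n) = V n \<oplus>\<^bsub>M\<^esub> chi m (P n) \<odot>\<^bsub>M\<^esub> u n" for n
    by (simp_all add: V_def)
  have V: "V n \<in> carrier M" for n by (induction n) (simp_all add: V0 VS u chi_R)
  have prod: "chi m (P j) \<odot>\<^bsub>M\<^esub> (chi m (P n) \<odot>\<^bsub>M\<^esub> u n) =
      (if j = n then chi m (P n) \<odot>\<^bsub>M\<^esub> u n else \<zero>\<^bsub>M\<^esub>)" for j n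
  proof -
    have "chi m (P j) \<odot>\<^bsub>M\<^esub> (chi m (P n) \<odot>\<^bsub>M\<^esub> u n) = (chi m (P j) \<otimes>\<^bsub>L0 m\<^esub> chi m (P n)) \<odot>\<^bsub>M\<^esub> u n"
      by (simp add: smult_assoc1 chi_R u)
    also have "chi m (P j) \<otimes>\<^bsub>L0 m\<^esub> chi m (P n) = (if j = n then chi m (P n) else \<zero>\<^bsub>L0 m\<^esub>)"
    proof (cases "j = n")
      case False
      then have "P j \<inter> P n = {}" using P(2) by (auto simp: disjoint_family_on_def)
      then show ?thesis using False chi_disjoint[OF P(1) P(1)] by simp
    qed (simp add: chi_idem[OF P(1)])
    finally show ?thesis by (simp add: u)
  qed
  have chi_V: "chi m (P j) \<odot>\<^bsub>M\<^esub> V n = (if j < n then chi m (P j) \<odot>\<^bsub>M\<^esub> u j else \<zero>\<^bsub>M\<^esub>)" for j n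
    by (induction n) (auto simp: V0 VS smult_r_distr chi_R u V prod less_Suc_eq)
  define D where "D N = - (\<Union>j<N. P j)" for N
  have D: "D N \<in> sets m'" for N
  proof -
    have "P j \<in> sets borel" for j using P(1) by (simp add: sets_m)
    then have "- (\<Union>j<N. P j) \<in> sets borel" by (intro borel_comp sets.finite_UN) auto
    then show ?thesis by (simp add: D_def equiv_prob_facts(2)[OF m'(1)])
  qed
  have lim_D: "(\<lambda>N. measure m' (D N)) \<longlonglongrightarrow> 0"
  proof -
    have "decseq D" by (force simp: decseq_def D_def)
    then have "(\<lambda>N. measure m' (D N)) \<longlonglongrightarrow> measure m' (\<Inter>N. D N)"
      using D by (intro finite_Lim_measure_decseq) auto
    moreover have "(\<Inter>N. D N) = {}"
    proof -
      have "\<exists>N. x \<notin> D N" for x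
      proof -
        obtain n where "x \<in> P n" using P(3) by blast
        then have "x \<notin> D (Suc n)" by (auto simp: D_def)
        then show ?thesis ..
      qed
      then show ?thesis by blast
    qed
    ultimately show ?thesis by simp
  qed
  have dist: "nmod_dist m' M v w = (\<integral>x. min (nrm M (v \<ominus>\<^bsub>M\<^esub> w) x) 1 \<partial>m')"
    if "v \<in> carrier M" "w \<in> carrier M" for v w using that by (simp add: nmod_dist_def)
  have int: "integrable m' (\<lambda>x. min (nrm M v x) 1)" if "v \<in> carrier M" for v
    by (intro integrable_min[OF m'(1)] nrm_measurable nrm_nonneg that)
  \<comment> \<open>From index \<open>N\<close> on, partial sums agree off \<open>D N\<close>, and
    on \<open>D N\<close> the truncation bounds the integrand by 1.\<close>
  have V_dist: "nmod_dist m' M (V k) (V l) \<le> measure m' (D N)" if "N \<le> k" "N \<le> l" for k l N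
  proof -
    have in_M: "V k \<ominus>\<^bsub>M\<^esub> V l \<in> carrier M" by (simp add: V)
    have "AE x in m. \<forall>j. j < N \<longrightarrow> indicator (P j) x * nrm M (V k \<ominus>\<^bsub>M\<^esub> V l) x = 0"
      unfolding AE_all_countable
    proof
      fix j
      show "AE x in m. j < N \<longrightarrow> indicator (P j) x * nrm M (V k \<ominus>\<^bsub>M\<^esub> V l) x = 0"
      proof (cases "j < N")
        case True
        then have "chi m (P j) \<odot>\<^bsub>M\<^esub> (V k \<ominus>\<^bsub>M\<^esub> V l) = \<zero>\<^bsub>M\<^esub>"
          using that by (simp add: a_minus_def smult_r_distr smult_r_minus chi_R V chi_V u M.r_neg)
        then show ?thesis using nrm_chi[OF P(1) in_M, of j] nrm_zero by (auto elim: eventually_elim2)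
      qed simp
    qed
    then have "AE x in m. min (nrm M (V k \<ominus>\<^bsub>M\<^esub> V l) x) 1 \<le> indicator (D N) x"
    proof eventually_elim
      case (elim x)
      show ?case
      proof (cases "x \<in> D N")
        case False
        then obtain j where "j < N" "x \<in> P j" by (auto simp: D_def)
        then show ?thesis using elim[rule_format, of j] False by simp
      qed simp
    qed
    then have "(\<integral>x. min (nrm M (V k \<ominus>\<^bsub>M\<^esub> V l) x) 1 \<partial>m') \<le> (\<integral>x. indicator (D N) x \<partial>m')"
      using D by (intro integral_mono_AE int in_M) (simp_all add: AE_equiv_prob[OF m'(1)] emeasure_eq_measure)
    then show ?thesis using D by (simp add: dist V equiv_prob_facts(4)[OF m'(1)])
  qed
  have "MCauchy V"
    unfolding MCauchy_def
  proof (intro conjI allI impI)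
    show "range V \<subseteq> carrier M" using V by auto
    fix \<epsilon> :: real assume "0 < \<epsilon>"
    then obtain N where "measure m' (D N) < \<epsilon>" using order_tendstoD(2)[OF lim_D] eventually_happens' by force
    then show "\<exists>N. \<forall>n n'. N \<le> n \<longrightarrow> N \<le> n' \<longrightarrow> nmod_dist m' M (V n) (V n') < \<epsilon>"
      using V_dist le_less_trans by blast
  qed
  then obtain v where lim: "limitin mtopology V v sequentially" using m'(3) unfolding mcomplete_def by blast
  then have v: "v \<in> carrier M" unfolding limit_metric_sequentially by simp
  have "chi m (P n) \<odot>\<^bsub>M\<^esub> v = chi m (P n) \<odot>\<^bsub>M\<^esub> u n" for n
  proof -
    let ?v = "chi m (P n) \<odot>\<^bsub>M\<^esub> v" and ?u = "chi m (P n) \<odot>\<^bsub>M\<^esub> u n"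
    have in_M: "?v \<in> carrier M" "?u \<in> carrier M" by (simp_all add: chi_R v u)
    \<comment> \<open>For \<open>n < k\<close> the element \<open>?u\<close> is also
      \<open>chi m (P n)\<close> times \<open>V k\<close>, and multiplication by \<open>chi\<close>
      does not increase distances.\<close>
    have le: "nmod_dist m' M ?u ?v \<le> nmod_dist m' M (V k) v" if "n < k" for k
    proof -
      have Vv: "V k \<ominus>\<^bsub>M\<^esub> v \<in> carrier M" by (simp add: V v)
      have "?u \<ominus>\<^bsub>M\<^esub> ?v = chi m (P n) \<odot>\<^bsub>M\<^esub> (V k \<ominus>\<^bsub>M\<^esub> v)"
        using that by (simp add: a_minus_def smult_r_distr smult_r_minus chi_R V chi_V v)
      then have "AE x in m. min (nrm M (?u \<ominus>\<^bsub>M\<^esub> ?v) x) 1 \<le> min (nrm M (V k \<ominus>\<^bsub>M\<^esub> v) x) 1"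
        using nrm_chi[OF P(1) Vv, of n] nrm_nonneg[OF Vv]
        by (auto elim!: eventually_elim2 simp: indicator_def)
      then show ?thesis unfolding dist[OF in_M(2,1)] dist[OF V v] AE_equiv_prob[OF m'(1), symmetric]
        by (intro integral_mono_AE int) (simp_all add: in_M V v)
    qed
    have "nmod_dist m' M ?u ?v \<le> \<epsilon>" if "0 < \<epsilon>" for \<epsilon>
    proof -
      obtain K where "\<And>k. k \<ge> K \<Longrightarrow> nmod_dist m' M (V k) v < \<epsilon>"
        using lim \<open>0 < \<epsilon>\<close> unfolding limit_metric_sequentially by blast
      from this[of "K + Suc n"] le[of "K + Suc n"] show ?thesis by simp
    qed
    then have "nmod_dist m' M ?u ?v \<le> 0" by (rule field_le_epsilon[of _ 0, simplified])
    then have "nmod_dist m' M ?u ?v = 0" using nonneg by (intro antisym)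
    then show ?thesis using zero[OF in_M(2,1)] by simp
  qed
  then show ?thesis using v by blast
qed

end

text \<open>Preservation of the norm gives injectivity, as only zero has norm 0, and makes the
  inverse a contraction too.\<close>

lemma nmod_isomorphismI:
  assumes M: "M \<in> Obj (NMod_pr m)" and N: "N \<in> Obj (NMod_pr m)"
    and \<Phi>: "\<Phi> \<in> carrier M \<rightarrow>\<^sub>E carrier N"
    and add: "\<And>v w. v \<in> carrier M \<Longrightarrow> w \<in> carrier M \<Longrightarrow> \<Phi> (v \<oplus>\<^bsub>M\<^esub> w) = \<Phi> v \<oplus>\<^bsub>N\<^esub> \<Phi> w"
    and smult: "\<And>F v. F \<in> carrier (L0 m) \<Longrightarrow> v \<in> carrier M \<Longrightarrow> \<Phi> (F \<odot>\<^bsub>M\<^esub> v) = F \<odot>\<^bsub>N\<^esub> \<Phi> v"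
    and norm: "\<And>v. v \<in> carrier M \<Longrightarrow> pnorm N (\<Phi> v) = pnorm M v"
    and surj: "\<And>w. w \<in> carrier N \<Longrightarrow> \<exists>v\<in>carrier M. \<Phi> v = w"
  shows "isomorphism (NMod_pr m) M N \<Phi>"
proof -
  have nM: "normed_L0_module m M" and nN: "normed_L0_module m N"
    using M N by (simp_all add: NMod_pr_def)
  interpret M: module "L0 m" M by (rule normed_module[OF nM])
  interpret N: module "L0 m" N by (rule normed_module[OF nN])
  have in_N: "\<Phi> v \<in> carrier N" if "v \<in> carrier M" for v using \<Phi> that by auto
  have inj: "v = w" if v: "v \<in> carrier M" and w: "w \<in> carrier M" and eq: "\<Phi> v = \<Phi> w" for v w
  proof -
    have in_M: "v \<ominus>\<^bsub>M\<^esub> w \<in> carrier M" using v w by simp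
    have "L0_class m (\<lambda>_. - 1) \<in> carrier (L0 m)" by (intro L0_class_in) simp
    then have "\<Phi> (v \<ominus>\<^bsub>M\<^esub> w) = \<Phi> v \<ominus>\<^bsub>N\<^esub> \<Phi> w"
      using v w in_N[OF w]
      by (simp add: a_minus_def add smult uminus_eq_smult[OF nM] uminus_eq_smult[OF nN])
    also have "\<dots> = \<zero>\<^bsub>N\<^esub>" using eq in_N[OF w] by (simp add: a_minus_def N.r_neg)
    finally have "pnorm M (v \<ominus>\<^bsub>M\<^esub> w) = pnorm N \<zero>\<^bsub>N\<^esub>" using norm[OF in_M] by simp
    then have "AE x in m. nrm M (v \<ominus>\<^bsub>M\<^esub> w) x = 0" using nrm_zero[OF nN] by simp
    then have "v \<ominus>\<^bsub>M\<^esub> w = \<zero>\<^bsub>M\<^esub>" using nrm_eq_0_iff[OF nM in_M] by simp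
    then show "v = w" using M.minus_eq_zero_iff[OF v w] by simp
  qed
  define \<Psi> where "\<Psi> = (\<lambda>w\<in>carrier N. SOME v. v \<in> carrier M \<and> \<Phi> v = w)"
  have \<Psi>: "\<Psi> w \<in> carrier M" "\<Phi> (\<Psi> w) = w" if w: "w \<in> carrier N" for w
  proof -
    have "\<exists>v. v \<in> carrier M \<and> \<Phi> v = w" using surj[OF w] by blast
    from someI_ex[OF this] show "\<Psi> w \<in> carrier M" "\<Phi> (\<Psi> w) = w" using w by (simp_all add: \<Psi>_def)
  qed
  have \<Psi>\<Phi>: "\<Psi> (\<Phi> v) = v" if "v \<in> carrier M" for v
    by (rule inj[OF \<Psi>(1)[OF in_N[OF that]] that \<Psi>(2)[OF in_N[OF that]]])
  have "\<Phi> \<in> nmod_hom m M N"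
    using \<Phi> add smult norm by (simp add: nmod_hom_def L0_le_def)
  moreover have "\<Psi> \<in> nmod_hom m N M"
    unfolding nmod_hom_def
  proof (intro CollectI conjI ballI PiE_I)
    show "\<Psi> w \<in> carrier M" if "w \<in> carrier N" for w using \<Psi>(1) that .
    show "\<Psi> w = undefined" if "w \<notin> carrier N" for w using that by (simp add: \<Psi>_def)
    fix w assume w: "w \<in> carrier N"
    show "L0_le m (pnorm M (\<Psi> w)) (pnorm N w)"
      using norm[OF \<Psi>(1)[OF w]] \<Psi>(2)[OF w] by (simp add: L0_le_def)
    show "\<Psi> (w \<oplus>\<^bsub>N\<^esub> w') = \<Psi> w \<oplus>\<^bsub>M\<^esub> \<Psi> w'" if w': "w' \<in> carrier N" for w'
      using w w' by - (rule inj, simp_all add: \<Psi> add)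
    show "\<Psi> (F \<odot>\<^bsub>N\<^esub> w) = F \<odot>\<^bsub>M\<^esub> \<Psi> w" if F: "F \<in> carrier (L0 m)" for F
      using w F by - (rule inj, simp_all add: \<Psi> smult)
  qed
  moreover have "compose (carrier M) \<Psi> \<Phi> = (\<lambda>v\<in>carrier M. v)" "compose (carrier N) \<Phi> \<Psi> = (\<lambda>v\<in>carrier N. v)"
    using \<Psi> \<Psi>\<Phi> by (auto simp: compose_def fun_eq_iff)
  ultimately show ?thesis
    unfolding isomorphism_def by (auto simp: NMod_pr_def intro: bexI[of _ \<Psi>])
qed

end

section \<open>Lipschitz extension of rational seminorms\<close>

text \<open>The infimum runs over the countable set \<open>Qn n\<close> only. Hence
  \<open>N0\<close> matters only at rational vectors, and measurable dependence of \<open>N0\<close>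
  and \<open>K\<close> on a parameter is inherited.\<close>

definition mcshane :: "nat \<Rightarrow> ((nat \<Rightarrow> real) \<Rightarrow> real) \<Rightarrow> real \<Rightarrow> (nat \<Rightarrow> real) \<Rightarrow> real" where
  "mcshane n N0 K v = (INF q\<in>Qn n. N0 q + K * l1norm n (\<lambda>i. v i - q i))"

lemma l1norm_triangle: "l1norm n (\<lambda>i. v i + w i) \<le> l1norm n v + l1norm n w"
  unfolding l1norm_def sum.distrib[symmetric] by (intro sum_mono abs_triangle_ineq)

lemma l1norm_triangle_diff:
  "l1norm n (\<lambda>i. u i - w i) \<le> l1norm n (\<lambda>i. u i - v i) + l1norm n (\<lambda>i. v i - w i)"
  using l1norm_triangle[of n "\<lambda>i. u i - v i" "\<lambda>i. v i - w i"] by simp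

lemma l1norm_tendsto:
  assumes "\<And>i. i < n \<Longrightarrow> (\<lambda>j. q j i) \<longlonglongrightarrow> v i"
  shows "(\<lambda>j. l1norm n (\<lambda>i. v i - q j i)) \<longlonglongrightarrow> 0"
proof -
  have "(\<lambda>j. \<Sum>i<n. \<bar>v i - q j i\<bar>) \<longlonglongrightarrow> (\<Sum>i<n. \<bar>v i - v i\<bar>)"
    by (intro tendsto_sum tendsto_rabs tendsto_diff tendsto_const assms) auto
  then show ?thesis by (simp add: l1norm_def)
qed

lemma l1norm_tendstoD:
  assumes "(\<lambda>j. l1norm n (\<lambda>i. v i - q j i)) \<longlonglongrightarrow> 0" "i < n"
  shows "(\<lambda>j. q j i) \<longlonglongrightarrow> v i"
proof -
  have "(\<lambda>j. q j i - v i) \<longlonglongrightarrow> 0"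
    by (rule Lim_null_comparison[OF _ assms(1)])
      (use l1norm_coord[OF assms(2)] in \<open>auto intro!: always_eventually simp: abs_minus_commute\<close>)
  then show ?thesis by (simp add: LIM_zero_iff)
qed

lemma Qn_zero: "(\<lambda>i. 0) \<in> Qn n"
  and Qn_add: "q \<in> Qn n \<Longrightarrow> r \<in> Qn n \<Longrightarrow> (\<lambda>i. q i + r i) \<in> Qn n"
  and Qn_scale: "c \<in> \<rat> \<Longrightarrow> q \<in> Qn n \<Longrightarrow> (\<lambda>i. c * q i) \<in> Qn n"
  by (auto simp: Qn_def Rn_iff)

context
  fixes n :: nat and N0 :: "(nat \<Rightarrow> real) \<Rightarrow> real" and K :: real
  assumes K: "0 \<le> K" and N0: "\<And>q. 0 \<le> N0 q"
begin

lemma mcshane_bdd: "bdd_below ((\<lambda>q. N0 q + K * l1norm n (\<lambda>i. v i - q i)) ` Qn n)"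
  by (rule bdd_belowI[of _ 0]) (auto intro!: add_nonneg_nonneg mult_nonneg_nonneg N0 K l1norm_nonneg)

lemma mcshane_le: "q \<in> Qn n \<Longrightarrow> mcshane n N0 K v \<le> N0 q + K * l1norm n (\<lambda>i. v i - q i)"
  unfolding mcshane_def by (rule cINF_lower[OF mcshane_bdd])

lemma mcshane_greatest:
  "(\<And>q. q \<in> Qn n \<Longrightarrow> c \<le> N0 q + K * l1norm n (\<lambda>i. v i - q i)) \<Longrightarrow> c \<le> mcshane n N0 K v"
  unfolding mcshane_def using Qn_zero by (intro cINF_greatest) auto

lemma mcshane_nonneg: "0 \<le> mcshane n N0 K v"
  by (intro mcshane_greatest add_nonneg_nonneg mult_nonneg_nonneg N0 K l1norm_nonneg)

text \<open>The hypothesis puts \<open>c\<close> below every term of the infimum, and a term at a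
  rational \<open>q\<close> exceeds \<open>c\<close> by at most \<open>2 * K\<close> times the
  distance of \<open>v\<close> and \<open>q\<close>, which can be made small. Thus the extension has
  the only value compatible with the Lipschitz bound at all rational vectors.\<close>

lemma mcshane_eq:
  assumes v: "v \<in> Rn n" and c: "\<And>q. q \<in> Qn n \<Longrightarrow> \<bar>c - N0 q\<bar> \<le> K * l1norm n (\<lambda>i. v i - q i)"
  shows "mcshane n N0 K v = c"
proof (rule antisym)
  show "c \<le> mcshane n N0 K v"
  proof (rule mcshane_greatest)
    fix q assume "q \<in> Qn n"
    from c[OF this] show "c \<le> N0 q + K * l1norm n (\<lambda>i. v i - q i)" by linarith
  qed
  show "mcshane n N0 K v \<le> c"
  proof (rule field_le_epsilon)
    fix e :: real assume e: "0 < e"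
    \<comment> \<open>The added 1 covers the case \<open>K = 0\<close>.\<close>
    have "0 < e / (2 * K + 1)" using e K by (intro divide_pos_pos) auto
    then obtain q where q: "q \<in> Qn n" "l1norm n (\<lambda>i. v i - q i) < e / (2 * K + 1)"
      using Qn_dense[OF v] by blast
    have "2 * K * l1norm n (\<lambda>i. v i - q i) \<le> (2 * K + 1) * l1norm n (\<lambda>i. v i - q i)"
      by (intro mult_right_mono l1norm_nonneg) simp
    also have "\<dots> < e" using q(2) K by (simp add: field_simps)
    finally have "2 * K * l1norm n (\<lambda>i. v i - q i) < e" .
    then show "mcshane n N0 K v \<le> c + e" using mcshane_le[OF q(1), of v] c[OF q(1)] by linarith
  qed
qed

lemma mcshane_lipschitz:
  "\<bar>mcshane n N0 K v - mcshane n N0 K w\<bar> \<le> K * l1norm n (\<lambda>i. w i - v i)"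
proof -
  have "mcshane n N0 K v \<le> mcshane n N0 K w + K * l1norm n (\<lambda>i. v i - w i)" for v w
  proof -
    have "mcshane n N0 K v - K * l1norm n (\<lambda>i. v i - w i) \<le> mcshane n N0 K w"
    proof (rule mcshane_greatest)
      fix q assume "q \<in> Qn n"
      moreover have "K * l1norm n (\<lambda>i. v i - q i) \<le>
          K * (l1norm n (\<lambda>i. v i - w i) + l1norm n (\<lambda>i. w i - q i))"
        by (intro mult_left_mono K l1norm_triangle_diff)
      ultimately show "mcshane n N0 K v - K * l1norm n (\<lambda>i. v i - w i) \<le>
          N0 q + K * l1norm n (\<lambda>i. w i - q i)"
        using mcshane_le[of q v] by (simp add: distrib_left)
    qed
    then show ?thesis by linarith
  qed
  from this[of v w] this[of w v] show ?thesis
    by (simp add: abs_le_iff l1norm_minus_commute[of n v w] algebra_simps)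
qed

text \<open>At rational vectors the extension agrees with \<open>N0\<close>. Since it is Lipschitz,
  the seminorm laws pass to the limit, with the scalar \<open>c\<close> approximated by rationals as
  well.\<close>

lemma mcshane_seminorm:
  assumes lip: "\<And>q r. q \<in> Qn n \<Longrightarrow> r \<in> Qn n \<Longrightarrow> \<bar>N0 q - N0 r\<bar> \<le> K * l1norm n (\<lambda>i. q i - r i)"
    and add: "\<And>q r. q \<in> Qn n \<Longrightarrow> r \<in> Qn n \<Longrightarrow> N0 (\<lambda>i. q i + r i) \<le> N0 q + N0 r"
    and scale: "\<And>c q. c \<in> \<rat> \<Longrightarrow> q \<in> Qn n \<Longrightarrow> N0 (\<lambda>i. c * q i) = \<bar>c\<bar> * N0 q"
  shows "seminorm_on_Rn n (mcshane n N0 K)"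
  unfolding seminorm_on_Rn_def
proof (intro conjI ballI allI)
  let ?N = "mcshane n N0 K"
  have N_eq: "?N q = N0 q" if "q \<in> Qn n" for q
    using that Qn_subset by (intro mcshane_eq lip) auto
  have lim: "(\<lambda>j. ?N (q j)) \<longlonglongrightarrow> ?N v" if "\<And>i. i < n \<Longrightarrow> (\<lambda>j. q j i) \<longlonglongrightarrow> v i" for q v
    by (rule lipschitz_tendsto[OF mcshane_lipschitz l1norm_tendsto[OF that]])
  fix v assume v: "v \<in> Rn n"
  obtain q where q: "\<And>j. q j \<in> Qn n" "(\<lambda>j. l1norm n (\<lambda>i. v i - q j i)) \<longlonglongrightarrow> 0"
    using Qn_approx[OF v] by blast
  note qi = l1norm_tendstoD[OF q(2)]
  show "0 \<le> ?N v" by (rule mcshane_nonneg)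
  fix c :: real
  have "\<forall>j. \<exists>r\<in>\<rat>. c < r \<and> r < c + inverse (real (Suc j))" by (auto intro!: Rats_dense_in_real)
  then obtain r where r: "\<And>j. r j \<in> \<rat>" "\<And>j. c < r j \<and> r j < c + inverse (real (Suc j))" by metis
  have r_lim: "r \<longlonglongrightarrow> c"
  proof (rule tendsto_sandwich[where f = "\<lambda>_. c"])
    show "(\<lambda>j. c + inverse (real (Suc j))) \<longlonglongrightarrow> c"
      using tendsto_add[OF tendsto_const[of c] LIMSEQ_inverse_real_of_nat] by simp
    show "eventually (\<lambda>j. c \<le> r j) sequentially"
      using r(2) by (auto intro!: always_eventually less_imp_le)
    show "eventually (\<lambda>j. r j \<le> c + inverse (real (Suc j))) sequentially"
      using r(2) by (auto simp del: of_nat_Suc intro!: always_eventually less_imp_le)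
  qed simp
  have "(\<lambda>j. ?N (\<lambda>i. r j * q j i)) \<longlonglongrightarrow> ?N (\<lambda>i. c * v i)"
    by (rule lim) (intro tendsto_mult r_lim qi)
  moreover have "?N (\<lambda>i. r j * q j i) = \<bar>r j\<bar> * ?N (q j)" for j
    using q(1) r(1) by (simp add: N_eq scale Qn_scale)
  moreover have "(\<lambda>j. \<bar>r j\<bar> * ?N (q j)) \<longlonglongrightarrow> \<bar>c\<bar> * ?N v"
    by (intro tendsto_mult tendsto_rabs r_lim lim qi)
  ultimately show "?N (\<lambda>i. c * v i) = \<bar>c\<bar> * ?N v" using LIMSEQ_unique by simp
next
  let ?N = "mcshane n N0 K"
  have N_eq: "?N q = N0 q" if "q \<in> Qn n" for q
    using that Qn_subset by (intro mcshane_eq lip) auto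
  have lim: "(\<lambda>j. ?N (q j)) \<longlonglongrightarrow> ?N v" if "\<And>i. i < n \<Longrightarrow> (\<lambda>j. q j i) \<longlonglongrightarrow> v i" for q v
    by (rule lipschitz_tendsto[OF mcshane_lipschitz l1norm_tendsto[OF that]])
  fix v w assume v: "v \<in> Rn n" and w: "w \<in> Rn n"
  obtain q where q: "\<And>j. q j \<in> Qn n" "(\<lambda>j. l1norm n (\<lambda>i. v i - q j i)) \<longlonglongrightarrow> 0"
    using Qn_approx[OF v] by blast
  obtain r where r: "\<And>j. r j \<in> Qn n" "(\<lambda>j. l1norm n (\<lambda>i. w i - r j i)) \<longlonglongrightarrow> 0"
    using Qn_approx[OF w] by blast
  note qi = l1norm_tendstoD[OF q(2)] and ri = l1norm_tendstoD[OF r(2)]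
  show "?N (\<lambda>i. v i + w i) \<le> ?N v + ?N w"
  proof (rule LIMSEQ_le)
    show "(\<lambda>j. ?N (\<lambda>i. q j i + r j i)) \<longlonglongrightarrow> ?N (\<lambda>i. v i + w i)"
      by (rule lim) (intro tendsto_add qi ri)
    show "(\<lambda>j. ?N (q j) + ?N (r j)) \<longlonglongrightarrow> ?N v + ?N w"
      by (intro tendsto_add lim qi ri)
    show "\<exists>M. \<forall>j\<ge>M. ?N (\<lambda>i. q j i + r j i) \<le> ?N (q j) + ?N (r j)"
      using q(1) r(1) by (auto simp: N_eq Qn_add intro: add)
  qed
qed

end

section \<open>Bases on null sets and the partition belonging to a proper module\<close>

lemma local_basis_cong:
  "chi m A = chi m B \<Longrightarrow> local_basis m M A n b \<longleftrightarrow> local_basis m M B n b"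
  unfolding local_basis_def L0_restrict_def mod_restrict_def by simp

lemma lincomb_zero:
  assumes "Module.module (L0 m) M" and "\<And>i. i < n \<Longrightarrow> a i \<in> carrier M"
  shows "lincomb m M n a (\<lambda>x i. 0) = \<zero>\<^bsub>M\<^esub>"
proof -
  interpret module "L0 m" M by (rule assms(1))
  have "lincomb m M n a (\<lambda>x i. 0) = (\<Oplus>\<^bsub>M\<^esub>i\<in>{..<n}. \<zero>\<^bsub>M\<^esub>)"
    unfolding lincomb_def L0_sel(3)[symmetric]
    by (intro M.finsum_cong') (auto simp: assms(2))
  then show ?thesis by (simp add: M.finsum_zero)
qed

text \<open>Over a null set the ring and the module are both zero, so any \<open>n\<close> elements
  form a basis there. A decomposition makes no claim about null parts, while every part of a bundle
  is to carry a basis; this closes the difference.\<close>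

lemma has_dim_null:
  assumes module: "Module.module (L0 m) M" and A: "A \<in> null_sets m"
  shows "has_dim m M A n"
proof -
  interpret module "L0 m" M by (rule module)
  have As: "A \<in> sets m" using A by auto
  have ae: "AE x in m. x \<notin> A" using A by (rule AE_not_in)
  have "chi m A = \<zero>\<^bsub>L0 m\<^esub>"
    unfolding chi_def L0_sel
    by (intro L0_class_cong borel_measurable_indicator As)
      (use ae in \<open>auto elim!: eventually_mono simp: indicator_def\<close>)
  then have chi0: "chi m A \<odot>\<^bsub>M\<^esub> w = \<zero>\<^bsub>M\<^esub>" if "w \<in> carrier M" for w using that by simp
  have "local_basis m M A n (\<lambda>_. \<zero>\<^bsub>M\<^esub>)"
  proof (subst local_basis_iff[OF module As])
    show "(\<lambda>_. \<zero>\<^bsub>M\<^esub>) \<in> {..<n} \<rightarrow> carrier M" by simp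
    show "(\<forall>f. (\<forall>i. (\<lambda>x. f x i) \<in> borel_measurable m) \<longrightarrow>
          lincomb m M n (\<lambda>i. chi m A \<odot>\<^bsub>M\<^esub> \<zero>\<^bsub>M\<^esub>) f = \<zero>\<^bsub>M\<^esub> \<longrightarrow>
          (\<forall>i<n. AE x in m. x \<in> A \<longrightarrow> f x i = 0)) \<and>
        (\<forall>w\<in>carrier M. \<exists>f. (\<forall>i. (\<lambda>x. f x i) \<in> borel_measurable m) \<and>
          chi m A \<odot>\<^bsub>M\<^esub> w = lincomb m M n (\<lambda>i. chi m A \<odot>\<^bsub>M\<^esub> \<zero>\<^bsub>M\<^esub>) f)"
    proof (intro conjI allI impI ballI)
      show "AE x in m. x \<in> A \<longrightarrow> f x i = 0" for f :: "_ \<Rightarrow> nat \<Rightarrow> real" and i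
        using ae by eventually_elim simp
      fix w assume w: "w \<in> carrier M"
      have "lincomb m M n (\<lambda>i. chi m A \<odot>\<^bsub>M\<^esub> \<zero>\<^bsub>M\<^esub>) (\<lambda>x i. 0) = \<zero>\<^bsub>M\<^esub>"
        by (intro lincomb_zero module) (simp add: chi0)
      then show "\<exists>f. (\<forall>i. (\<lambda>x. f x i) \<in> borel_measurable m) \<and>
          chi m A \<odot>\<^bsub>M\<^esub> w = lincomb m M n (\<lambda>i. chi m A \<odot>\<^bsub>M\<^esub> \<zero>\<^bsub>M\<^esub>) f"
        using chi0[OF w] by (intro exI[of _ "\<lambda>x i. 0"]) simp
    qed
  qed
  then show ?thesis unfolding has_dim_def by (intro exI[of _ "\<lambda>_. \<zero>\<^bsub>M\<^esub>"])
qed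

context mm_space
begin

lemma proper_partition:
  assumes module: "Module.module (L0 m) M" and proper: "proper_module m M"
  obtains P b where "\<And>n. P n \<in> sets borel" "disjoint_family P" "(\<Union>n::nat. P n) = UNIV"
    "\<And>n. local_basis m M (P n) n (b n)"
proof -
  obtain E where E: "\<And>k. E k \<in> sets borel" "disjoint_family E" "(\<Union>k. E k) = UNIV"
    and dim: "\<And>n::nat. emeasure m (E (enat n)) > 0 \<Longrightarrow> has_dim m M (E (enat n)) n"
    and inf: "emeasure m (E \<infinity>) = 0"
    using proper unfolding proper_module_def dimensional_decomposition_def by blast
  have dim': "has_dim m M (E (enat n)) n" for n
  proof (cases "emeasure m (E (enat n)) > 0")
    case False
    then have "E (enat n) \<in> null_sets m" using E(1) by (simp add: null_sets_def sets_m)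
    then show ?thesis by (rule has_dim_null[OF module])
  qed (rule dim)
  \<comment> \<open>Bundles have no part of infinite dimension, so the null set
    \<open>E \<infinity>\<close> is absorbed into the part of dimension 0. This leaves the class of
    the indicator, and with it the basis, unchanged.\<close>
  define P where "P n = (if n = 0 then E 0 \<union> E \<infinity> else E (enat n))" for n
  have P: "P n \<in> sets borel" for n using E(1) by (simp add: P_def)
  have "disjoint_family P"
    unfolding disjoint_family_on_def
  proof (intro ballI impI)
    fix i j :: nat assume "i \<noteq> j"
    then have "E (enat i) \<inter> E (enat j) = {}" "E (enat i) \<inter> E \<infinity> = {}" "E (enat j) \<inter> E \<infinity> = {}"
      using E(2) by (auto simp: disjoint_family_on_def)
    then show "P i \<inter> P j = {}" using \<open>i \<noteq> j\<close> by (auto simp: P_def zero_enat_def)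
  qed
  moreover have "(\<Union>n. P n) = UNIV"
  proof -
    have "\<exists>n. x \<in> P n" for x
    proof -
      obtain k where k: "x \<in> E k" using E(3) by blast
      show ?thesis
      proof (cases k)
        case (enat n)
        then have "x \<in> P n" using k by (auto simp: P_def zero_enat_def)
        then show ?thesis ..
      next
        case infinity
        then have "x \<in> P 0" using k by (simp add: P_def)
        then show ?thesis ..
      qed
    qed
    then show ?thesis by blast
  qed
  moreover have "chi m (P n) = chi m (E (enat n))" for n
    unfolding chi_def
  proof (intro L0_class_cong borel_measurable_indicator)
    have "E \<infinity> \<in> null_sets m" using inf E(1) by (simp add: null_sets_def sets_m)
    from AE_not_in[OF this]
    show "AE x in m. indicator (P n) x = (indicator (E (enat n)) x :: real)"
      by eventually_elim (auto simp: P_def indicator_def zero_enat_def)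
  qed (simp_all add: sets_m P E)
  then have "\<forall>n. \<exists>b. local_basis m M (P n) n b"
    using dim' local_basis_cong unfolding has_dim_def by metis
  then obtain b where "\<And>n. local_basis m M (P n) n (b n)" by metis
  ultimately show ?thesis using that P by blast
qed

end

section \<open>The norm of a linear combination of a local basis\<close>

definition local_frame ::
  "'x measure \<Rightarrow> ('x, 'v) L0_nmodule \<Rightarrow> 'x set \<Rightarrow> (nat \<Rightarrow> 'v) \<Rightarrow> nat \<Rightarrow> 'v" where
  "local_frame m M A b i = chi m A \<odot>\<^bsub>M\<^esub> b i"

text \<open>The pointwise norms of the combinations with constant rational coefficients, extended to real
  coefficients in a way that is jointly measurable by construction.\<close>

definition local_pnorm ::
  "'x measure \<Rightarrow> ('x, 'v) L0_nmodule \<Rightarrow> 'x set \<Rightarrow> nat \<Rightarrow> (nat \<Rightarrow> 'v) \<Rightarrow> 'x \<Rightarrow> (nat \<Rightarrow> real) \<Rightarrow> real"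
  where
  "local_pnorm m M A n b x = mcshane n
     (\<lambda>q. \<bar>nrm M (lincomb m M n (local_frame m M A b) (\<lambda>_. q)) x\<bar>)
     (\<Sum>i<n. \<bar>nrm M (local_frame m M A b i) x\<bar>)"

lemma local_pnorm_nonneg: "0 \<le> local_pnorm m M A n b x v"
  unfolding local_pnorm_def by (intro mcshane_nonneg sum_nonneg) auto

context mm_space
begin

context
  fixes M :: "('x, 'v) L0_nmodule" and A :: "'x set" and n :: nat and b :: "nat \<Rightarrow> 'v"
  assumes M: "normed_L0_module m M" and A: "A \<in> sets borel" and basis: "local_basis m M A n b"
begin

private abbreviation "a \<equiv> local_frame m M A b"
private abbreviation "L \<equiv> lincomb m M n a"
private abbreviation "N \<equiv> local_pnorm m M A n b"
private abbreviation mcoeff :: "('x \<Rightarrow> nat \<Rightarrow> real) \<Rightarrow> bool" where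
  "mcoeff f \<equiv> (\<forall>i. (\<lambda>x. f x i) \<in> borel_measurable m)"

interpretation M: module "L0 m" M by (rule normed_module[OF M])

private lemma A_sets: "A \<in> sets m" using A by (simp add: sets_m)

private lemma basis_in: "i < n \<Longrightarrow> b i \<in> carrier M"
  using basis by (auto simp: local_basis_def)

lemma frame_in: "i < n \<Longrightarrow> a i \<in> carrier M"
  unfolding local_frame_def by (intro chi_smult_in[OF M] A_sets basis_in)

private lemma term_in: "mcoeff f \<Longrightarrow> i < n \<Longrightarrow> L0_class m (\<lambda>x. f x i) \<odot>\<^bsub>M\<^esub> a i \<in> carrier M"
  by (intro smult_in[OF M] frame_in) auto

lemma lincomb_in: "mcoeff f \<Longrightarrow> L f \<in> carrier M"
  unfolding lincomb_def by (intro M.finsum_closed Pi_I term_in) auto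

lemma lincomb_add:
  assumes f: "mcoeff f" and g: "mcoeff g"
  shows "L f \<oplus>\<^bsub>M\<^esub> L g = L (\<lambda>x i. f x i + g x i)"
proof -
  have fg: "mcoeff (\<lambda>x i. f x i + g x i)" using f g by (auto intro: borel_measurable_add)
  have eq: "L0_class m (\<lambda>x. f x i + g x i) \<odot>\<^bsub>M\<^esub> a i =
      L0_class m (\<lambda>x. f x i) \<odot>\<^bsub>M\<^esub> a i \<oplus>\<^bsub>M\<^esub> L0_class m (\<lambda>x. g x i) \<odot>\<^bsub>M\<^esub> a i"
    if "i < n" for i
    using f g frame_in[OF that] by (simp add: L0_add[symmetric] M.smult_l_distr L0_class_in)
  have "L (\<lambda>x i. f x i + g x i) = (\<Oplus>\<^bsub>M\<^esub>i\<in>{..<n}.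
      L0_class m (\<lambda>x. f x i) \<odot>\<^bsub>M\<^esub> a i \<oplus>\<^bsub>M\<^esub> L0_class m (\<lambda>x. g x i) \<odot>\<^bsub>M\<^esub> a i)"
    unfolding lincomb_def using f g by (intro M.finsum_cong') (auto simp: eq term_in)
  also have "\<dots> = L f \<oplus>\<^bsub>M\<^esub> L g"
    unfolding lincomb_def using f g by (intro M.finsum_addf) (auto simp: term_in)
  finally show ?thesis by simp
qed

lemma lincomb_scale:
  assumes c: "c \<in> borel_measurable m" and f: "mcoeff f"
  shows "L0_class m c \<odot>\<^bsub>M\<^esub> L f = L (\<lambda>x i. c x * f x i)"
proof -
  have cf: "mcoeff (\<lambda>x i. c x * f x i)" using c f by (auto intro: borel_measurable_times)
  have eq: "L0_class m c \<odot>\<^bsub>M\<^esub> (L0_class m (\<lambda>x. f x i) \<odot>\<^bsub>M\<^esub> a i) =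
      L0_class m (\<lambda>x. c x * f x i) \<odot>\<^bsub>M\<^esub> a i" if "i < n" for i
    using c f frame_in[OF that] by (simp add: L0_mult[symmetric] M.smult_assoc1 L0_class_in)
  have "L0_class m c \<odot>\<^bsub>M\<^esub> L f =
      (\<Oplus>\<^bsub>M\<^esub>i\<in>{..<n}. L0_class m c \<odot>\<^bsub>M\<^esub> (L0_class m (\<lambda>x. f x i) \<odot>\<^bsub>M\<^esub> a i))"
    unfolding lincomb_def using f by (intro M.finsum_smult_ldistr L0_class_in c) (auto simp: term_in)
  also have "\<dots> = L (\<lambda>x i. c x * f x i)"
    unfolding lincomb_def by (intro M.finsum_cong') (auto simp: eq term_in[OF cf])
  finally show ?thesis .
qed

lemma lincomb_diff:
  assumes f: "mcoeff f" and g: "mcoeff g"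
  shows "L f \<ominus>\<^bsub>M\<^esub> L g = L (\<lambda>x i. f x i - g x i)"
proof -
  have g': "mcoeff (\<lambda>x i. - 1 * g x i)"
  proof
    fix i
    show "(\<lambda>x. - 1 * g x i) \<in> borel_measurable m"
      using g by (intro borel_measurable_times borel_measurable_const) auto
  qed
  have "\<ominus>\<^bsub>M\<^esub> L g = L (\<lambda>x i. - 1 * g x i)"
    unfolding uminus_eq_smult[OF M lincomb_in[OF g]] using g by (intro lincomb_scale) auto
  then have "L f \<ominus>\<^bsub>M\<^esub> L g = L (\<lambda>x i. f x i + - 1 * g x i)"
    unfolding a_minus_def by (simp only: lincomb_add[OF f g'])
  then show ?thesis by simp
qed

lemma nrm_lincomb_le:
  assumes f: "mcoeff f"
  shows "AE x in m. nrm M (L f) x \<le> (\<Sum>i<n. \<bar>f x i\<bar> * nrm M (a i) x)"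
  unfolding lincomb_def using f by (intro nrm_finsum[OF M] frame_in) auto

lemma nrm_frame_out:
  assumes "i < n" shows "AE x in m. x \<notin> A \<longrightarrow> nrm M (a i) x = 0"
  unfolding local_frame_def using nrm_chi[OF M A_sets basis_in[OF assms]] by eventually_elim simp

text \<open>The frame elements carry the factor \<open>chi m A\<close> and so have norm 0 off
  \<open>A\<close>; coefficients matter only on \<open>A\<close>.\<close>

lemma lincomb_cong:
  assumes f: "mcoeff f" and g: "mcoeff g" and eq: "AE x in m. x \<in> A \<longrightarrow> (\<forall>i<n. f x i = g x i)"
  shows "L f = L g"
proof -
  have fg: "mcoeff (\<lambda>x i. f x i - g x i)" using f g by (auto intro: borel_measurable_diff)
  have out: "AE x in m. \<forall>i. i < n \<longrightarrow> x \<notin> A \<longrightarrow> nrm M (a i) x = 0"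
    unfolding AE_all_countable using nrm_frame_out by auto
  have "AE x in m. nrm M (L f \<ominus>\<^bsub>M\<^esub> L g) x = 0"
    unfolding lincomb_diff[OF f g]
    using nrm_lincomb_le[OF fg] out eq nrm_nonneg[OF M lincomb_in[OF fg]]
  proof eventually_elim
    case (elim x)
    have "(\<Sum>i<n. \<bar>f x i - g x i\<bar> * nrm M (a i) x) = 0"
      using elim by (intro sum.neutral) (cases "x \<in> A", auto)
    then show ?case using elim by simp
  qed
  then have "L f \<ominus>\<^bsub>M\<^esub> L g = \<zero>\<^bsub>M\<^esub>"
    using nrm_eq_0_iff[OF M] lincomb_in[OF f] lincomb_in[OF g] by simp
  then show ?thesis using M.minus_eq_zero_iff[OF lincomb_in[OF f] lincomb_in[OF g]] by simp
qed

lemma chi_lincomb: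
  assumes f: "mcoeff f" shows "chi m A \<odot>\<^bsub>M\<^esub> L f = L f"
proof -
  have ind: "indicator A \<in> borel_measurable m" by (rule borel_measurable_indicator[OF A_sets])
  have "chi m A \<odot>\<^bsub>M\<^esub> L f = L (\<lambda>x i. indicator A x * f x i)"
    unfolding chi_def by (rule lincomb_scale[OF ind f])
  also have "\<dots> = L f"
  proof (rule lincomb_cong[OF _ f])
    show "mcoeff (\<lambda>x i. indicator A x * f x i)" using f ind by (auto intro: borel_measurable_times)
  qed simp
  finally show ?thesis .
qed

lemma basis_independent:
  assumes "mcoeff f" "L f = \<zero>\<^bsub>M\<^esub>" "i < n" shows "AE x in m. x \<in> A \<longrightarrow> f x i = 0"
proof -
  have "b \<in> {..<n} \<rightarrow> carrier M" using basis_in by auto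
  from conjunct1[OF basis[unfolded local_basis_iff[OF normed_module[OF M] A_sets this]]] assms
  show ?thesis by (simp add: local_frame_def[abs_def])
qed

lemma basis_spans:
  assumes "w \<in> carrier M" shows "\<exists>f. mcoeff f \<and> chi m A \<odot>\<^bsub>M\<^esub> w = L f"
proof -
  have "b \<in> {..<n} \<rightarrow> carrier M" using basis_in by auto
  from conjunct2[OF basis[unfolded local_basis_iff[OF normed_module[OF M] A_sets this]]] assms
  show ?thesis by (simp add: local_frame_def[abs_def])
qed

lemma local_pnorm_measurable:
  "(\<lambda>z. N (fst z) (snd z)) \<in> borel_measurable (borel :: ('x \<times> (nat \<Rightarrow> real)) measure)"
proof -
  have nrm: "(\<lambda>z. \<bar>nrm M v (fst z)\<bar>) \<in> borel_measurable (borel :: ('x \<times> (nat \<Rightarrow> real)) measure)"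
    if "v \<in> carrier M" for v
    using measurable_compose[OF borel_fst] nrm_measurable[OF M that] unfolding measurable_m
    by (intro borel_measurable_abs) auto
  have l1: "(\<lambda>z. l1norm n (\<lambda>i. snd z i - q i)) \<in> borel_measurable (borel :: ('x \<times> (nat \<Rightarrow> real)) measure)"
    for q unfolding l1norm_def
    using measurable_compose[OF borel_snd coordinate_measurable]
    by (intro borel_measurable_sum borel_measurable_abs borel_measurable_diff borel_measurable_const) auto
  show ?thesis
    unfolding local_pnorm_def mcshane_def
  proof (rule borel_measurable_cINF_real[OF countable_Qn])
    fix q
    show "(\<lambda>z. \<bar>nrm M (L (\<lambda>_. q)) (fst z)\<bar> + (\<Sum>i<n. \<bar>nrm M (a i) (fst z)\<bar>) *
        l1norm n (\<lambda>i. snd z i - q i)) \<in> borel_measurable (borel :: ('x \<times> (nat \<Rightarrow> real)) measure)"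
      by (intro borel_measurable_add borel_measurable_times borel_measurable_sum nrm l1 lincomb_in
          frame_in) auto
  qed
qed

text \<open>The hypothesis of \<open>mcshane_eq\<close> for variable coefficients \<open>f\<close>,
  with one null set for all rational vectors: \<open>L f\<close> differs from the combination with
  constant coefficients \<open>q\<close> by the combination with coefficients \<open>f - q\<close>,
  whose norm is bounded term by term.\<close>

lemma nrm_lincomb_dist:
  assumes f: "mcoeff f"
  shows "AE x in m. \<forall>q\<in>Qn n. \<bar>nrm M (L f) x - \<bar>nrm M (L (\<lambda>_. q)) x\<bar>\<bar> \<le>
    (\<Sum>i<n. \<bar>nrm M (a i) x\<bar>) * l1norm n (\<lambda>i. f x i - q i)"
  unfolding AE_ball_countable[OF countable_Qn]
proof
  fix q
  have q: "mcoeff (\<lambda>_. q)" by simp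
  have fq: "mcoeff (\<lambda>x i. f x i - q i)" using f by (auto intro: borel_measurable_diff)
  show "AE x in m. \<bar>nrm M (L f) x - \<bar>nrm M (L (\<lambda>_. q)) x\<bar>\<bar> \<le>
    (\<Sum>i<n. \<bar>nrm M (a i) x\<bar>) * l1norm n (\<lambda>i. f x i - q i)"
    using nrm_abs_diff[OF M lincomb_in[OF f] lincomb_in[OF q]] nrm_nonneg[OF M lincomb_in[OF q]]
      nrm_lincomb_le[OF fq]
    unfolding lincomb_diff[OF f q]
  proof eventually_elim
    case (elim x)
    have "(\<Sum>i<n. \<bar>f x i - q i\<bar> * nrm M (a i) x) \<le>
        (\<Sum>i<n. l1norm n (\<lambda>i. f x i - q i) * \<bar>nrm M (a i) x\<bar>)"
    proof (rule sum_mono)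
      fix i assume "i \<in> {..<n}"
      then have i: "i < n" by simp
      have "\<bar>f x i - q i\<bar> * nrm M (a i) x \<le> \<bar>f x i - q i\<bar> * \<bar>nrm M (a i) x\<bar>"
        by (intro mult_left_mono) auto
      also have "\<dots> \<le> l1norm n (\<lambda>i. f x i - q i) * \<bar>nrm M (a i) x\<bar>"
        using l1norm_coord[OF i, of "\<lambda>i. f x i - q i"] by (intro mult_right_mono) auto
      finally show "\<bar>f x i - q i\<bar> * nrm M (a i) x \<le> l1norm n (\<lambda>i. f x i - q i) * \<bar>nrm M (a i) x\<bar>" .
    qed
    also have "\<dots> = (\<Sum>i<n. \<bar>nrm M (a i) x\<bar>) * l1norm n (\<lambda>i. f x i - q i)"
      by (simp add: sum_distrib_left mult.commute)
    finally show ?case using elim by simp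
  qed
qed

lemma local_pnorm_eq:
  assumes f: "mcoeff f" shows "AE x in m. f x \<in> Rn n \<longrightarrow> N x (f x) = nrm M (L f) x"
  using nrm_lincomb_dist[OF f]
proof eventually_elim
  case (elim x)
  show ?case
  proof
    assume "f x \<in> Rn n"
    then show "N x (f x) = nrm M (L f) x"
      unfolding local_pnorm_def using elim by (intro mcshane_eq sum_nonneg) auto
  qed
qed

lemma local_pnorm_seminorm: "AE x in m. seminorm_on_Rn n (N x)"
proof -
  have const: "mcoeff (\<lambda>_. q)" for q by simp
  have nonneg: "AE x in m. \<forall>q\<in>Qn n. 0 \<le> nrm M (L (\<lambda>_. q)) x"
    unfolding AE_ball_countable[OF countable_Qn] using nrm_nonneg[OF M lincomb_in[OF const]] by simp
  have lip: "AE x in m. \<forall>q\<in>Qn n. \<forall>r\<in>Qn n. \<bar>nrm M (L (\<lambda>_. q)) x - \<bar>nrm M (L (\<lambda>_. r)) x\<bar>\<bar> \<le>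
      (\<Sum>i<n. \<bar>nrm M (a i) x\<bar>) * l1norm n (\<lambda>i. q i - r i)"
    by (subst AE_ball_countable[OF countable_Qn]) (use nrm_lincomb_dist[OF const] in simp)
  have add: "AE x in m. \<forall>q\<in>Qn n. \<forall>r\<in>Qn n.
      nrm M (L (\<lambda>_ i. q i + r i)) x \<le> nrm M (L (\<lambda>_. q)) x + nrm M (L (\<lambda>_. r)) x"
    unfolding AE_ball_countable[OF countable_Qn]
  proof (intro ballI)
    fix q r
    have "L (\<lambda>_. q) \<oplus>\<^bsub>M\<^esub> L (\<lambda>_. r) = L (\<lambda>_ i. q i + r i)" by (rule lincomb_add) simp_all
    then show "AE x in m. nrm M (L (\<lambda>_ i. q i + r i)) x \<le> nrm M (L (\<lambda>_. q)) x + nrm M (L (\<lambda>_. r)) x"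
      using nrm_triangle[OF M lincomb_in[OF const] lincomb_in[OF const], of q r] by simp
  qed
  have scale: "AE x in m. \<forall>c\<in>\<rat>. \<forall>q\<in>Qn n.
      nrm M (L (\<lambda>_ i. c * q i)) x = \<bar>c\<bar> * nrm M (L (\<lambda>_. q)) x"
    unfolding AE_ball_countable[OF countable_rat] AE_ball_countable[OF countable_Qn]
  proof (intro ballI)
    fix c :: real and q
    have "L0_class m (\<lambda>_. c) \<odot>\<^bsub>M\<^esub> L (\<lambda>_. q) = L (\<lambda>_ i. c * q i)" by (rule lincomb_scale) simp_all
    then show "AE x in m. nrm M (L (\<lambda>_ i. c * q i)) x = \<bar>c\<bar> * nrm M (L (\<lambda>_. q)) x"
      using nrm_smult[OF M _ lincomb_in[OF const], of "\<lambda>_. c" q] by simp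
  qed
  show ?thesis
    using nonneg lip add scale
  proof eventually_elim
    case (elim x)
    let ?N0 = "\<lambda>q. \<bar>nrm M (L (\<lambda>_. q)) x\<bar>"
    \<comment> \<open>The absolute values in \<open>local_pnorm\<close> make it nonnegative at every
      point, as required of a bundle norm and for the infimum to be bounded below. Off a null set
      they change nothing.\<close>
    have abs: "?N0 q = nrm M (L (\<lambda>_. q)) x" if "q \<in> Qn n" for q using elim(1) that by simp
    show ?case
      unfolding local_pnorm_def
    proof (rule mcshane_seminorm)
      fix q r assume q: "q \<in> Qn n" and r: "r \<in> Qn n"
      show "\<bar>?N0 q - ?N0 r\<bar> \<le> (\<Sum>i<n. \<bar>nrm M (a i) x\<bar>) * l1norm n (\<lambda>i. q i - r i)"
        using elim(2) q r unfolding abs[OF q] by blast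
      show "?N0 (\<lambda>i. q i + r i) \<le> ?N0 q + ?N0 r"
        unfolding abs[OF Qn_add[OF q r]] abs[OF q] abs[OF r] using elim(3) q r by blast
    next
      fix c :: real and q assume c: "c \<in> \<rat>" and q: "q \<in> Qn n"
      show "?N0 (\<lambda>i. c * q i) = \<bar>c\<bar> * ?N0 q"
        unfolding abs[OF Qn_scale[OF c q]] abs[OF q] using elim(4) c q by blast
    qed (auto intro: sum_nonneg)
  qed
qed

text \<open>The distance of \<open>unit_vec k\<close> to the span of its predecessors, with respect
  to \<open>N x\<close>. The sign of \<open>q\<close> is immaterial in a subspace, and the
  restriction to rational \<open>q\<close> makes the distance measurable in
  \<open>x\<close>.\<close>

private definition gap :: "nat \<Rightarrow> 'x \<Rightarrow> real" where
  "gap k x = (INF q\<in>Qn k. N x (\<lambda>i. unit_vec k i + q i))"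

private lemma N_fixed_measurable: "(\<lambda>x. N x v) \<in> borel_measurable borel"
proof -
  have "(\<lambda>x. (x, v)) \<in> borel \<rightarrow>\<^sub>M (borel :: ('x \<times> (nat \<Rightarrow> real)) measure)"
    unfolding borel_prod[symmetric] by (intro measurable_Pair) auto
  from measurable_compose[OF this local_pnorm_measurable] show ?thesis by simp
qed

private lemma gap_measurable: "gap k \<in> borel_measurable borel"
  unfolding gap_def[abs_def] by (rule borel_measurable_cINF_real[OF countable_Qn N_fixed_measurable])

private lemma gap_bdd: "bdd_below ((\<lambda>q. N x (\<lambda>i. unit_vec k i + q i)) ` Qn k)"
  by (rule bdd_belowI[of _ 0]) (auto intro: local_pnorm_nonneg)

private lemma gap_nonneg: "0 \<le> gap k x"
  unfolding gap_def using Qn_zero by (intro cINF_greatest local_pnorm_nonneg) auto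

text \<open>By density and continuity the infimum over rational vectors is also a lower bound for
  all real ones.\<close>

private lemma gap_le:
  assumes N: "seminorm_on_Rn n (N x)" and k: "k < n" and w: "w \<in> Rn k"
  shows "gap k x \<le> N x (\<lambda>i. unit_vec k i + w i)"
proof -
  obtain q where q: "\<And>j. q j \<in> Qn k" "(\<lambda>j. l1norm k (\<lambda>i. w i - q j i)) \<longlonglongrightarrow> 0"
    using Qn_approx[OF w] by blast
  have sub: "Rn k \<subseteq> Rn n" using k by (intro Rn_mono) simp
  have qR: "q j \<in> Rn k" for j using q(1) Qn_subset by blast
  have coord: "(\<lambda>j. q j i) \<longlonglongrightarrow> w i" for i
  proof (cases "i < k")
    case False
    then show ?thesis using qR w by (simp add: Rn_iff)
  qed (rule l1norm_tendstoD[OF q(2)])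
  have "(\<lambda>j. N x (\<lambda>i. unit_vec k i + q j i)) \<longlonglongrightarrow> N x (\<lambda>i. unit_vec k i + w i)"
  proof (rule seminorm_tendsto[OF N])
    show "(\<lambda>i. unit_vec k i + w i) \<in> Rn n" "(\<lambda>i. unit_vec k i + q j i) \<in> Rn n" for j
      using w qR sub by (auto intro!: Rn_add Rn_unit_vec k)
    show "(\<lambda>j. l1norm n (\<lambda>i. (unit_vec k i + w i) - (unit_vec k i + q j i))) \<longlonglongrightarrow> 0"
      by (intro l1norm_tendsto tendsto_add tendsto_const coord)
  qed
  moreover have "gap k x \<le> N x (\<lambda>i. unit_vec k i + q j i)" for j
    unfolding gap_def by (rule cINF_lower[OF gap_bdd q(1)])
  ultimately show ?thesis by (intro LIMSEQ_le_const) auto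
qed

text \<open>Where the distance of the \<open>k\<close>-th unit vector to the span of its predecessors vanishes, it is
  attained at a unique, hence measurable, combination of them; this is a vanishing linear
  combination of the basis.\<close>

private lemma gap_positive: "k < n \<Longrightarrow> AE x in m. x \<in> A \<longrightarrow> 0 < gap k x"
proof (induction k rule: less_induct)
  case (less k)
  define e where "e = from_nat_into (Qn k)"
  have Q_ne: "Qn k \<noteq> {}" using Qn_zero by blast
  have e: "e i \<in> Qn k" for i unfolding e_def by (rule from_nat_into[OF Q_ne])
  have e_surj: "\<exists>i. e i = q" if "q \<in> Qn k" for q
    using from_nat_into_surj[OF countable_Qn that] by (auto simp: e_def)
  \<comment> \<open>Measurable selection: the first vector in the enumeration \<open>e\<close> that
    comes within \<open>1 / (j + 1)\<close> of cancelling \<open>unit_vec k\<close>. Where none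
    does, the value is irrelevant, because \<open>f\<close> is cut off outside
    \<open>B\<close>.\<close>
  define idx where "idx j x = (LEAST i. N x (\<lambda>l. unit_vec k l + e i l) < inverse (real (Suc j)))" for j x
  define w where "w j x = e (idx j x)" for j x
  define u where "u x i = lim (\<lambda>j. w j x i)" for x i
  define B where "B = {x \<in> A. gap k x = 0}"
  \<comment> \<open>On \<open>B\<close> these coefficients form a kernel vector whose coordinate
    \<open>k\<close> is 1, since \<open>u x\<close> lies in \<open>Rn k\<close>. The combination
    \<open>L f\<close> is then zero, and independence forces \<open>B\<close> to be null.\<close>
  define f where "f x i = indicator B x * (unit_vec k i + u x i)" for x i
  have "{x \<in> space borel. gap k x = 0} \<in> sets borel"
    using gap_measurable[of k] by (intro borel_measurable_eq borel_measurable_const)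
  then have B: "B \<in> sets borel" using A sets.Int[of A borel] by (simp add: B_def Collect_conj_eq)
  have idx: "idx j \<in> borel \<rightarrow>\<^sub>M count_space UNIV" for j
    unfolding idx_def[abs_def]
  proof (rule measurable_Least)
    fix i
    have "{x \<in> space borel. N x (\<lambda>l. unit_vec k l + e i l) < inverse (real (Suc j))} \<in> sets borel"
      by (intro borel_measurable_less N_fixed_measurable borel_measurable_const)
    then show "Measurable.pred borel (\<lambda>x. N x (\<lambda>l. unit_vec k l + e i l) < inverse (real (Suc j)))"
      by (simp add: pred_def)
  qed
  have w_meas: "(\<lambda>x. w j x i) \<in> borel_measurable borel" for j i
    unfolding w_def by (rule measurable_compose_countable[OF _ idx]) simp
  have u_meas: "(\<lambda>x. u x i) \<in> borel_measurable borel" for i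
    unfolding u_def by (rule borel_measurable_lim_metric[OF w_meas])
  have f: "mcoeff f"
  proof
    fix i
    show "(\<lambda>x. f x i) \<in> borel_measurable m"
      unfolding f_def measurable_m using B u_meas
      by (intro borel_measurable_times borel_measurable_add borel_measurable_const
          borel_measurable_indicator)
  qed
  have sub: "Rn k \<subseteq> Rn n" using less.prems by (intro Rn_mono) simp
  have IH: "AE x in m. \<forall>l. l < k \<longrightarrow> x \<in> A \<longrightarrow> 0 < gap l x"
    unfolding AE_all_countable using less.IH less.prems by auto
  have kernel: "AE x in m. x \<in> B \<longrightarrow> u x \<in> Rn k \<and> N x (\<lambda>i. unit_vec k i + u x i) = 0"
    using IH local_pnorm_seminorm
  proof eventually_elim
    case (elim x)
    show ?case
    proof
      assume x: "x \<in> B"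
      \<comment> \<open>The gaps of smaller index are positive by the induction hypothesis; this
        makes the approximating vectors converge in \<open>seminorm_kernel_limit\<close>.\<close>
      have "\<exists>c>0. \<forall>v\<in>Rn k. c * l1norm k v \<le> N x v"
      proof (rule seminorm_dominates_l1norm[OF elim(2)])
        fix l assume l: "l < k"
        then show "\<exists>d>0. \<forall>w\<in>Rn l. d \<le> N x (\<lambda>i. unit_vec l i + w i)"
          using elim x less.prems by (intro exI[of _ "gap l x"]) (auto simp: B_def intro: gap_le)
      qed (use less.prems in simp)
      then obtain c where c: "0 < c" "\<And>v. v \<in> Rn k \<Longrightarrow> c * l1norm k v \<le> N x v" by auto
      have w_small: "N x (\<lambda>l. unit_vec k l + w j x l) < inverse (real (Suc j))" for j
      proof -
        have "gap k x < inverse (real (Suc j))" using x by (simp add: B_def)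
        then obtain q where "q \<in> Qn k" "N x (\<lambda>l. unit_vec k l + q l) < inverse (real (Suc j))"
          unfolding gap_def using cINF_less_iff[OF Q_ne gap_bdd] by auto
        then have "\<exists>i. N x (\<lambda>l. unit_vec k l + e i l) < inverse (real (Suc j))"
          using e_surj by metis
        then show ?thesis unfolding w_def idx_def by (rule LeastI_ex)
      qed
      have lim: "(\<lambda>j. N x (\<lambda>i. unit_vec k i + w j x i)) \<longlonglongrightarrow> 0"
        by (rule tendsto_sandwich[OF _ _ tendsto_const LIMSEQ_inverse_real_of_nat])
          (auto simp del: of_nat_Suc intro!: always_eventually less_imp_le[OF w_small] local_pnorm_nonneg)
      have wR: "w j x \<in> Rn k" for j unfolding w_def using e Qn_subset by blast
      have "u x = (\<lambda>i. lim (\<lambda>j. w j x i))" by (simp add: u_def fun_eq_iff)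
      then show "u x \<in> Rn k \<and> N x (\<lambda>i. unit_vec k i + u x i) = 0"
        using seminorm_kernel_limit[OF elim(2) less.prems c wR lim] by simp
    qed
  qed
  have "AE x in m. nrm M (L f) x = 0"
    using kernel local_pnorm_eq[OF f] local_pnorm_seminorm
  proof eventually_elim
    case (elim x)
    show ?case
    proof (cases "x \<in> B")
      case True
      then have fx: "f x = (\<lambda>i. unit_vec k i + u x i)" by (simp add: f_def fun_eq_iff)
      have "f x \<in> Rn n" unfolding fx using elim(1) True sub by (intro Rn_add Rn_unit_vec less.prems) auto
      then show ?thesis using elim(1,2) True by (simp add: fx)
    next
      case False
      then have fx: "f x = (\<lambda>i. 0)" by (simp add: f_def fun_eq_iff)
      then show ?thesis using elim(2) seminorm_zero[OF elim(3)] by (simp add: Rn_zero)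
    qed
  qed
  then have "L f = \<zero>\<^bsub>M\<^esub>" using nrm_eq_0_iff[OF M lincomb_in[OF f]] by simp
  from basis_independent[OF f this less.prems] kernel
  show ?case
  proof eventually_elim
    case (elim x)
    show ?case
    proof
      assume x: "x \<in> A"
      have "x \<notin> B"
      proof
        assume "x \<in> B"
        moreover from this have "u x k = 0" using elim(2) by (simp add: Rn_iff)
        ultimately have "f x k = 1" by (simp add: f_def unit_vec_def)
        then show False using elim(1) x by simp
      qed
      then show "0 < gap k x" using x gap_nonneg[of k x] by (auto simp: B_def less_le)
    qed
  qed
qed

text \<open>Once all gaps are positive, \<open>N x\<close> dominates \<open>l1norm\<close> on
  \<open>Rn n\<close>, and definiteness follows.\<close>

lemma local_pnorm_norm: "AE x in m. x \<in> A \<longrightarrow> norm_on_Rn n (N x)"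
proof -
  have "AE x in m. \<forall>k. k < n \<longrightarrow> x \<in> A \<longrightarrow> 0 < gap k x"
    unfolding AE_all_countable using gap_positive by auto
  then show ?thesis using local_pnorm_seminorm
  proof eventually_elim
    case (elim x)
    show ?case
    proof
      assume x: "x \<in> A"
      have "\<exists>c>0. \<forall>v\<in>Rn n. c * l1norm n v \<le> N x v"
      proof (rule seminorm_dominates_l1norm[OF elim(2)])
        fix l assume "l < n"
        then show "\<exists>d>0. \<forall>w\<in>Rn l. d \<le> N x (\<lambda>i. unit_vec l i + w i)"
          using elim x by (intro exI[of _ "gap l x"]) (auto intro: gap_le)
      qed simp
      then obtain c where c: "0 < c" "\<And>v. v \<in> Rn n \<Longrightarrow> c * l1norm n v \<le> N x v" by auto
      have "v = (\<lambda>i. 0)" if v: "v \<in> Rn n" "N x v = 0" for v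
      proof
        fix i
        have "c * l1norm n v \<le> 0" using c(2)[OF v(1)] v(2) by simp
        then have "l1norm n v \<le> 0" using c(1) by (simp add: mult_le_0_iff)
        then show "v i = 0"
          using v(1) l1norm_coord[of i n v] by (cases "i < n") (auto simp: Rn_iff)
      qed
      then show "norm_on_Rn n (N x)" using elim(2) by (simp add: norm_on_Rn_iff)
    qed
  qed
qed

end

end

section \<open>Essential surjectivity\<close>

text \<open>Needs only Borel parts and not \<open>is_mbb\<close>: measurability of the norm is
  itself among the conditions for the bundle under construction, so
  \<open>measurable_total_space\<close> cannot be applied to it yet.\<close>

lemma measurable_total_spaceI:
  assumes "\<And>n. part T n \<in> sets borel" "f \<in> borel \<rightarrow>\<^sub>M N"
  shows "f \<in> total_space T \<rightarrow>\<^sub>M N"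
proof (rule measurableI)
  fix z assume "z \<in> space (total_space T)"
  then show "f z \<in> space N" using measurable_space[OF assms(2)] by simp
next
  fix B assume B: "B \<in> sets N"
  let ?S = "{S. S \<subseteq> total_set T \<and> (\<forall>n. S \<inter> (part T n \<times> Rn n) \<in> sets borel)}"
  have "space (total_space T) = total_set T"
    unfolding total_space_def by (rule space_measure_of) auto
  moreover have "f -` B \<inter> total_set T \<in> ?S"
  proof -
    have "(f -` B \<inter> total_set T) \<inter> (part T n \<times> Rn n) = f -` B \<inter> (part T n \<times> Rn n)" for n
      by (auto simp: total_set_def)
    moreover have "f -` B \<in> sets borel" using measurable_sets[OF assms(2) B] by simp
    ultimately show ?thesis by (auto intro!: sets.Int borel_Times assms(1))
  qed
  moreover have "sets (total_space T) = sigma_sets (total_set T) ?S"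
    unfolding total_space_def by (rule sets_measure_of) auto
  ultimately show "f -` B \<inter> space (total_space T) \<in> sets (total_space T)"
    by (simp only: sigma_sets.Basic)
qed

context mm_space
begin

context
  fixes M :: "('x, ('x, 'u) melem) L0_nmodule" and P :: "nat \<Rightarrow> 'x set"
    and b :: "nat \<Rightarrow> nat \<Rightarrow> ('x, 'u) melem"
  assumes M: "normed_L0_module m M"
    and P: "\<And>n. P n \<in> sets borel" "disjoint_family P" "(\<Union>n. P n) = UNIV"
    and basis: "\<And>n. local_basis m M (P n) n (b n)"
begin

private definition idx :: "'x \<Rightarrow> nat" where "idx x = (THE n. x \<in> P n)"

private abbreviation "fnorm n \<equiv> local_pnorm m M (P n) n (b n)"
private abbreviation "comb n \<equiv> lincomb m M n (local_frame m M (P n) (b n))"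

definition coordinate_bundle :: "'x mbb" where
  "coordinate_bundle = \<lparr>part = P, bnorm = (\<lambda>z. fnorm (idx (fst z)) (fst z) (snd z))\<rparr>"

private lemma idx_iff: "x \<in> P n \<longleftrightarrow> idx x = n"
proof -
  obtain k where k: "x \<in> P k" using P(3) by blast
  have uniq: "i = k" if "x \<in> P i" for i
  proof (rule ccontr)
    assume "i \<noteq> k"
    then have "P i \<inter> P k = {}" using P(2) by (simp add: disjoint_family_on_def)
    then show False using k that by blast
  qed
  have idx: "idx x = k" unfolding idx_def using k uniq by (rule the_equality)
  show ?thesis
  proof
    assume "x \<in> P n"
    from uniq[OF this] show "idx x = n" by (simp add: idx)
  next
    assume "idx x = n"
    then show "x \<in> P n" using k by (simp add: idx)
  qed
qed

private lemma idx_measurable: "idx \<in> borel \<rightarrow>\<^sub>M count_space UNIV"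
proof -
  have "idx -` {n} = P n" for n by (auto simp: idx_iff)
  then show ?thesis using P(1) by (auto simp: measurable_count_space_eq_countable)
qed

lemma is_mbb_coordinate_bundle: "is_mbb m coordinate_bundle"
  unfolding is_mbb_def
proof (intro conjI allI ballI)
  let ?T = coordinate_bundle
  have part: "part ?T = P" by (simp add: coordinate_bundle_def)
  show "part ?T n \<in> sets borel" for n using P(1) by (simp add: part)
  show "disjoint_family (part ?T)" "(\<Union>n. part ?T n) = UNIV" using P by (simp_all add: part)
  have "(\<lambda>z. fnorm (idx (fst z)) (fst z) (snd z)) \<in> borel_measurable (borel :: ('x \<times> (nat \<Rightarrow> real)) measure)"
    by (rule measurable_compose_countable[OF local_pnorm_measurable[OF M P(1) basis]
        measurable_compose[OF borel_fst idx_measurable]])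
  then show "bnorm ?T \<in> borel_measurable (total_space ?T)"
    using P(1) by (intro measurable_total_spaceI) (simp_all add: coordinate_bundle_def)
  show "0 \<le> bnorm ?T z" for z by (simp add: coordinate_bundle_def local_pnorm_nonneg)
  show "AE x in m. x \<in> part ?T n \<longrightarrow> norm_on_Rn n (\<lambda>v. bnorm ?T (x, v))" for n
    using local_pnorm_norm[OF M P(1) basis, of n]
  proof eventually_elim
    case (elim x)
    show ?case
    proof
      assume "x \<in> part ?T n"
      then have "x \<in> P n" by (simp add: part)
      moreover from this have "idx x = n" by (simp add: idx_iff)
      ultimately show "norm_on_Rn n (\<lambda>v. bnorm ?T (x, v))"
        using elim by (simp add: coordinate_bundle_def)
    qed
  qed
qed

private lemma bdim_idx: "bdim coordinate_bundle x = idx x"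
  using in_part_iff[OF is_mbb_coordinate_bundle, of x "idx x"] idx_iff[of x "idx x"]
  by (simp add: coordinate_bundle_def)

private abbreviation "coords \<equiv> msec coordinate_bundle"

private lemma coords_measurable: "s \<in> coords \<Longrightarrow> \<forall>i. (\<lambda>x. s x i) \<in> borel_measurable m"
  using msec_measurable[OF is_mbb_coordinate_bundle] by (simp add: measurable_m)

text \<open>A relation, because \<open>v\<close> fixes its coordinates \<open>s\<close> among
  \<open>coords\<close> only up to a null set, whereas \<open>s\<close> determines \<open>v\<close>
  exactly.\<close>

private definition represents :: "('x, 'u) melem \<Rightarrow> ('x \<Rightarrow> nat \<Rightarrow> real) \<Rightarrow> bool" where
  "represents v s \<longleftrightarrow> v \<in> carrier M \<and> (\<forall>n. chi m (P n) \<odot>\<^bsub>M\<^esub> v = comb n s)"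

private lemma P_sets: "P n \<in> sets m" using P(1) by (simp add: sets_m)

private lemma represents_unique: "represents v s \<Longrightarrow> represents w s \<Longrightarrow> v = w"
  unfolding represents_def using eq_if_chi_eq[OF M _ _ P_sets P(3), of v w] by simp

private lemma represents_exists:
  assumes s: "s \<in> coords" shows "\<exists>v. represents v s"
proof -
  have "comb n s \<in> carrier M" "chi m (P n) \<odot>\<^bsub>M\<^esub> comb n s = comb n s" for n
    using lincomb_in[OF M P(1) basis] chi_lincomb[OF M P(1) basis] coords_measurable[OF s] by auto
  then show ?thesis
    using glueing[OF M P_sets P(2,3), of "\<lambda>n. comb n s"] unfolding represents_def by auto
qed

private lemma represents_cong:
  assumes "s \<in> coords" "t \<in> coords" "AE x in m. s x = t x" "represents v s"
  shows "represents v t"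
proof -
  have "comb n s = comb n t" for n
    using assms(3) by (intro lincomb_cong[OF M P(1) basis] coords_measurable assms)
      (auto elim: eventually_mono)
  then show ?thesis using assms(4) by (simp add: represents_def)
qed

private lemma represents_add:
  assumes s: "s \<in> coords" and t: "t \<in> coords" and v: "represents v s" and w: "represents w t"
  shows "represents (v \<oplus>\<^bsub>M\<^esub> w) (\<lambda>x i. s x i + t x i)"
proof -
  interpret module "L0 m" M by (rule normed_module[OF M])
  have in_M: "v \<in> carrier M" "w \<in> carrier M" using v w by (simp_all add: represents_def)
  have "chi m (P n) \<odot>\<^bsub>M\<^esub> (v \<oplus>\<^bsub>M\<^esub> w) = comb n s \<oplus>\<^bsub>M\<^esub> comb n t" for n
    using v w in_M by (simp add: represents_def smult_r_distr chi_in[OF P_sets])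
  then show ?thesis
    using lincomb_add[OF M P(1) basis coords_measurable[OF s] coords_measurable[OF t]] in_M
    by (simp add: represents_def)
qed

private lemma represents_smult:
  assumes c: "c \<in> borel_measurable m" and s: "s \<in> coords" and v: "represents v s"
  shows "represents (L0_class m c \<odot>\<^bsub>M\<^esub> v) (\<lambda>x i. c x * s x i)"
proof -
  interpret module "L0 m" M by (rule normed_module[OF M])
  have in_M: "v \<in> carrier M" using v by (simp add: represents_def)
  have "chi m (P n) \<odot>\<^bsub>M\<^esub> (L0_class m c \<odot>\<^bsub>M\<^esub> v) = L0_class m c \<odot>\<^bsub>M\<^esub> (chi m (P n) \<odot>\<^bsub>M\<^esub> v)" for n
    using in_M L0_class_in[OF c] chi_in[OF P_sets]
    by (simp add: smult_assoc1[symmetric] R.m_comm)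
  then show ?thesis
    using lincomb_scale[OF M P(1) basis c coords_measurable[OF s]] v in_M L0_class_in[OF c]
    by (simp add: represents_def)
qed

text \<open>On each piece the norm of \<open>v\<close> is that of the combination
  \<open>comb n s\<close>, which \<open>local_pnorm_eq\<close> evaluates as the fibre norm at
  \<open>s x\<close>; countably many pieces cost one null set.\<close>

private lemma represents_pnorm:
  assumes s: "s \<in> coords" and v: "represents v s"
  shows "pnorm M v = L0_class m (\<lambda>x. bnorm coordinate_bundle (x, s x))"
proof -
  have in_M: "v \<in> carrier M" using v by (simp add: represents_def)
  have "AE x in m. \<forall>n. x \<in> P n \<longrightarrow> nrm M v x = fnorm n x (s x)"
    unfolding AE_all_countable
  proof
    fix n
    have "chi m (P n) \<odot>\<^bsub>M\<^esub> v = comb n s" using v by (simp add: represents_def)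
    with nrm_chi[OF M P_sets in_M, of n]
    have "AE x in m. nrm M (comb n s) x = indicator (P n) x * nrm M v x" by simp
    then show "AE x in m. x \<in> P n \<longrightarrow> nrm M v x = fnorm n x (s x)"
      using local_pnorm_eq[OF M P(1) basis coords_measurable[OF s], of n]
    proof eventually_elim
      case (elim x)
      show ?case
      proof
        assume x: "x \<in> P n"
        then have "s x \<in> Rn n"
          using msec_Rn[OF is_mbb_coordinate_bundle s, of x] by (simp add: bdim_idx idx_iff)
        then show "nrm M v x = fnorm n x (s x)" using elim x by simp
      qed
    qed
  qed
  then have "AE x in m. nrm M v x = bnorm coordinate_bundle (x, s x)"
    by eventually_elim (simp add: coordinate_bundle_def idx_iff)
  moreover have "(\<lambda>x. bnorm coordinate_bundle (x, s x)) \<in> borel_measurable m"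
    using bnorm_measurable[OF is_mbb_coordinate_bundle s] by (simp add: measurable_m)
  ultimately have "L0_class m (nrm M v) = L0_class m (\<lambda>x. bnorm coordinate_bundle (x, s x))"
    by (intro L0_class_cong nrm_measurable[OF M] in_M)
  then show ?thesis using L0_class_rep[OF pnorm_in[OF M in_M]] by simp
qed

private lemma represents_surj:
  assumes v: "v \<in> carrier M" shows "\<exists>s\<in>coords. represents v s"
proof -
  have "\<forall>n. \<exists>f. (\<forall>i. (\<lambda>x. f x i) \<in> borel_measurable m) \<and> chi m (P n) \<odot>\<^bsub>M\<^esub> v = comb n f"
    using basis_spans[OF M P(1) basis v] by blast
  then obtain f where f: "\<And>n i. (\<lambda>x. f n x i) \<in> borel_measurable m"
    "\<And>n. chi m (P n) \<odot>\<^bsub>M\<^esub> v = comb n (f n)" by metis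
  \<comment> \<open>The coefficients found on the separate pieces, put together. Those beyond the
    dimension do not enter the combinations and are set to 0 so that \<open>s x\<close> lies in the
    fibre.\<close>
  define s where "s x i = (if i < idx x then f (idx x) x i else 0)" for x i
  have s: "s \<in> coords"
    unfolding msec_iff[OF is_mbb_coordinate_bundle] bdim_idx
  proof (intro conjI allI impI)
    fix i
    have "(\<lambda>x. if i < n then f n x i else 0) \<in> borel_measurable borel" for n
      using f(1) by (simp add: measurable_m)
    from measurable_compose_countable[OF this idx_measurable]
    show "(\<lambda>x. s x i) \<in> borel_measurable borel" by (simp add: s_def)
  qed (simp add: s_def)
  have "comb n (f n) = comb n s" for n
  proof (rule lincomb_cong[OF M P(1) basis _ coords_measurable[OF s]])
    show "\<forall>i. (\<lambda>x. f n x i) \<in> borel_measurable m" using f(1) by simp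
    show "AE x in m. x \<in> P n \<longrightarrow> (\<forall>i<n. f n x i = s x i)" by (simp add: s_def idx_iff)
  qed
  then have "represents v s" using v f(2) by (simp add: represents_def)
  then show ?thesis using s by blast
qed

lemma coordinate_bundle_isomorphism:
  assumes proper: "proper_module m M"
  shows "\<exists>e. isomorphism (NMod_pr m) (section_module m coordinate_bundle) M e"
proof -
  let ?T = coordinate_bundle
  let ?\<Gamma> = "section_module m ?T :: ('x, ('x, 'u) melem) L0_nmodule"
  note T = is_mbb_coordinate_bundle
  \<comment> \<open>Existence of \<open>v\<close> is glueing and uniqueness is locality; by
    \<open>represents_cong\<close> the choice of representative of \<open>S\<close> does not
    matter.\<close>
  define \<Phi> where "\<Phi> = (\<lambda>S\<in>carrier ?\<Gamma>. THE v. represents v (srep S))"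
  have \<Phi>: "represents (\<Phi> (sec_class m ?T s)) s" if s: "s \<in> coords" for s
  proof -
    have in_C: "(sec_class m ?T s :: ('x, 'u) melem) \<in> carrier ?\<Gamma>" by (rule sec_class_in[OF T s])
    note r = rep_section[OF T s, where ?'u = 'u]
    obtain v where v: "represents v (srep (sec_class m ?T s :: ('x, 'u) melem))"
      using represents_exists[OF r(2)] by blast
    then have "(THE v. represents v (srep (sec_class m ?T s :: ('x, 'u) melem))) = v"
      using represents_unique by (intro the_equality) auto
    then have "\<Phi> (sec_class m ?T s) = v" using in_C by (simp add: \<Phi>_def)
    then show ?thesis using represents_cong[OF r(2) s r(3) v] by simp
  qed
  have "isomorphism (NMod_pr m) ?\<Gamma> M \<Phi>"
  proof (rule nmod_isomorphismI)
    show "?\<Gamma> \<in> Obj (NMod_pr m)"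
      using normed_section_module[OF T] proper_section_module[OF T] by (simp add: NMod_pr_def)
    show "M \<in> Obj (NMod_pr m)" using M proper by (simp add: NMod_pr_def)
    show "\<Phi> \<in> carrier ?\<Gamma> \<rightarrow>\<^sub>E carrier M"
    proof (rule PiE_I)
      fix S assume "S \<in> carrier ?\<Gamma>"
      then obtain s where "s \<in> coords" "S = sec_class m ?T s" by (rule section_cases[OF T])
      then show "\<Phi> S \<in> carrier M" using \<Phi> by (simp add: represents_def)
    qed (simp add: \<Phi>_def)
  next
    fix S S' assume S: "S \<in> carrier ?\<Gamma>" "S' \<in> carrier ?\<Gamma>"
    obtain s where s: "s \<in> coords" "S = sec_class m ?T s" using S(1) by (rule section_cases[OF T])
    obtain t where t: "t \<in> coords" "S' = sec_class m ?T t" using S(2) by (rule section_cases[OF T])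
    show "\<Phi> (S \<oplus>\<^bsub>?\<Gamma>\<^esub> S') = \<Phi> S \<oplus>\<^bsub>M\<^esub> \<Phi> S'"
      unfolding s(2) t(2) section_add[OF T s(1) t(1)]
      by (rule represents_unique[OF \<Phi>[OF msec_add[OF T s(1) t(1)]]
            represents_add[OF s(1) t(1) \<Phi>[OF s(1)] \<Phi>[OF t(1)]]])
  next
    fix F S assume F: "F \<in> carrier (L0 m)" and S: "S \<in> carrier ?\<Gamma>"
    obtain s where s: "s \<in> coords" "S = sec_class m ?T s" using S by (rule section_cases[OF T])
    obtain c where c: "c \<in> borel_measurable m" "F = L0_class m c" using F by (rule L0_cases)
    show "\<Phi> (F \<odot>\<^bsub>?\<Gamma>\<^esub> S) = F \<odot>\<^bsub>M\<^esub> \<Phi> S"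
      unfolding s(2) c(2) section_smult[OF T c(1) s(1)]
      by (rule represents_unique[OF \<Phi>[OF msec_scale[OF T c(1) s(1)]]
            represents_smult[OF c(1) s(1) \<Phi>[OF s(1)]]])
  next
    fix S assume "S \<in> carrier ?\<Gamma>"
    then obtain s where s: "s \<in> coords" "S = sec_class m ?T s" by (rule section_cases[OF T])
    show "pnorm M (\<Phi> S) = pnorm ?\<Gamma> S"
      unfolding s(2) section_pnorm[OF T s(1)] by (rule represents_pnorm[OF s(1) \<Phi>[OF s(1)]])
  next
    fix v assume "v \<in> carrier M"
    then obtain s where s: "s \<in> coords" "represents v s" using represents_surj by blast
    have "\<Phi> (sec_class m ?T s) = v" by (rule represents_unique[OF \<Phi>[OF s(1)] s(2)])
    then show "\<exists>S\<in>carrier ?\<Gamma>. \<Phi> S = v" using sec_class_in[OF T s(1)] by blast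
  qed
  then show ?thesis by blast
qed

end

lemma section_functor_ess_surj:
  fixes M :: "('x, ('x, 'u) melem) L0_nmodule"
  assumes "M \<in> Obj (NMod_pr m)"
  shows "\<exists>T. is_mbb m T \<and> (\<exists>e. isomorphism (NMod_pr m) (section_module m T) M e)"
proof -
  have M: "normed_L0_module m M" and proper: "proper_module m M"
    using assms by (simp_all add: NMod_pr_def)
  obtain P b where P: "\<And>n. P n \<in> sets borel" "disjoint_family P" "(\<Union>n. P n) = UNIV"
    and basis: "\<And>n. local_basis m M (P n) n (b n)"
    using proper_partition[OF normed_module[OF M] proper] by blast
  show ?thesis
    using is_mbb_coordinate_bundle[OF M P basis] coordinate_bundle_isomorphism[OF M P basis proper]
    by blast
qed

end

theorem theorem3p4:
  fixes m :: "'x::polish_space measure"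
  assumes "metric_measure_space m"
  shows "equivalence_of_categories (MBB m)
           (NMod_pr m :: (('x, ('x, 'u) melem) L0_nmodule,
                          ('x, 'u) melem \<Rightarrow> ('x, 'u) melem) precat)
           (section_functor m)"
proof -
  interpret mm_space m by standard (rule assms)
  show ?thesis
  proof (rule equivalence_of_categoriesI[OF is_functor_section_functor], unfold section_functor_obj)
    fix T1 T2 and g :: "('x, 'u) melem \<Rightarrow> ('x, 'u) melem"
    assume "T1 \<in> Obj (MBB m)" "T2 \<in> Obj (MBB m)"
      and "g \<in> Hom (NMod_pr m) (section_module m T1) (section_module m T2)"
    then show "\<exists>f\<in>Hom (MBB m) T1 T2. farr (section_functor m) T1 T2 f = g"
      using section_functor_full[of T1 T2 g] by (auto simp: Obj_MBB Hom_MBB NMod_pr_def)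
  next
    fix T1 T2 f f'
    assume T: "T1 \<in> Obj (MBB m)" "T2 \<in> Obj (MBB m)"
      and f: "f \<in> Hom (MBB m) T1 T2" and f': "f' \<in> Hom (MBB m) T1 T2"
      and eq: "farr (section_functor m) T1 T2 f =
        (farr (section_functor m) T1 T2 f' :: ('x, 'u) melem \<Rightarrow> ('x, 'u) melem)"
    obtain \<phi> where \<phi>: "\<phi> \<in> premorphisms m T1 T2" "f = bundle_arrow T1 T2 \<phi>"
      using f by (auto simp: Hom_MBB)
    obtain \<psi> where \<psi>: "\<psi> \<in> premorphisms m T1 T2" "f' = bundle_arrow T1 T2 \<psi>"
      using f' by (auto simp: Hom_MBB)
    show "f = f'"
      using section_functor_faithful[OF _ _ \<phi>(1) \<psi>(1)] eq T unfolding \<phi>(2) \<psi>(2) Obj_MBB by blast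
  next
    fix M :: "('x, ('x, 'u) melem) L0_nmodule"
    assume "M \<in> Obj (NMod_pr m)"
    from section_functor_ess_surj[OF this]
    show "\<exists>T\<in>Obj (MBB m). \<exists>e. isomorphism (NMod_pr m) (section_module m T) M e"
      by (auto simp: Obj_MBB)
  qed
qed

end
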